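(* Assume that, as $n\to\infty$, $\rho_n\to 0$ and $m_n\to\infty$, and that for all $j,j'=1,\dots,J$ and every $g\in C[0,1]$, $$\int_0^1 \mathcal{D}^{j,j'}_{m_n}(s,s)\,g(s)\,\mathrm{d}s\ \longrightarrow\ \int_0^1 g(s)\,\mathrm{d}s\qquad (n\to\infty).$$ Assume moreover that: (i) for every $p\ge 1$, $$A_p:=\mathbf{E}\Big[\big(\sup_{t\in[0,1]}\sum_j|b^j(t)|^2\big)^{p/2}\Big]+\mathbf{E}\Big[\big(\sup_{t\in[0,1]}\sum_{r,j}|\sigma^j_r(t)|^2\big)^{p/2}\Big]<+\infty;$$ (ii) each $t\mapsto\sigma^j_r(t)$, $j=1,\dots,J$, $r=1,\dots,d$, is continuous on $[0,1]$ almost surely. Then, for all $j,j'=1,\dots,J$, $$V^{j,j'}_{n,m_n}\ \longrightarrow\ \int_0^1\Sigma^{j,j'}(s)\,\mathrm{d}s\quad\text{in probability as } n\to\infty.$$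
   Context: Let $(\Omega,\mathcal{F},\mathbf{P})$ be a complete probability space supporting a $d$-dimensional Wiener process $\mathbf{W}=(W^1,\dots,W^d)$ on $[0,1]$, let $\mathcal{F}_t$ be the complete $\sigma$-algebra generated by $\{\mathbf{W}_s:0\le s\le t\}$, and let $L^2_a[0,1]$ be the space of $\{\mathcal{F}_t\}$-adapted processes $\theta$ with $\mathbf{E}[\int_0^1|\theta(s)|^2\mathrm{d}s]<\infty$. For $J\in\mathbb{N}$ and $j=1,\dots,J$ let $$X^j_t=X^j_0+\int_0^t b^j(s)\,\mathrm{d}s+\sum_{r=1}^d\int_0^t\sigma^j_r(s)\,\mathrm{d}W^r_s,\quad t\in[0,1],\qquad b^j,\sigma^j_r\in L^2_a[0,1],$$ and $\Sigma^{j,j'}(s):=\sum_{r=1}^d\sigma^j_r(s)\sigma^{j'}_r(s)$. Sampling scheme. A grid $\Pi=\{(t^j_k)_{k=0,\dots,n_j}: j=1,\dots,J\}$ consists of times $0=t^j_0<t^j_1<\dots<t^j_{n_j}=1$. Put $n:=\min_{1\le j\le J}n_j$ and $\rho_n:=\max_{j,k}|t^j_k-t^j_{k-1}|$. Let $\Pi^*$ be the set of functions $\varphi=(\varphi^1,\dots,\varphi^J):[0,1]\to[0,1]^J$ such that (A1) for all $j$ and $k=1,\dots,n_j$, $\varphi^j$ is constant on $[t^j_{k-1},t^j_k)$ with value in $[t^j_{k-1},t^j_k]$; (A2) for all $j$ and $k=1,\dots,n_j-1$, the values of $\varphi^j$ on $[t^j_{k-1},t^j_k)$ and on $[t^j_k,t^j_{k+1})$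 are different. A sequence of grids $\Pi$ (indexed by $n$), functions $\varphi\in\Pi^*$ (depending on $n$), and positive integers $m_n$ is given, and limits are taken along this sequence. Kernel. For a positive integer $m$ and $u,s\in[0,1]$, $$\mathcal{D}^{j,j'}_m(u,s):=\frac{1}{2m}\frac{\sin m\pi(\varphi^j(u)+\varphi^{j'}(s))}{\sin \pi(\varphi^j(u)+\varphi^{j'}(s))/2}+\frac{1}{2m}\frac{\sin m\pi(\varphi^j(u)-\varphi^{j'}(s))}{\sin\pi(\varphi^j(u)-\varphi^{j'}(s))/2},$$ with quotients extended by continuity; equivalently $\mathcal{D}^{j,j'}_m(u,s)=\frac2m\sum_{l=1}^m\cos\big((l-\tfrac12)\pi\varphi^j(u)\big)\cos\big((l-\tfrac12)\pi\varphi^{j'}(s)\big)$. SIML estimator (no microstructure noise). $$V^{j,j'}_{n,m_n}:=\frac{2n}{n+\frac12}\frac1{m_n}\sum_{l=1}^{m_n}\Big(\int_0^1\cos\big((l-\tfrac12)\pi\varphi^j(s)\big)\,\mathrm{d}X^j_s\Big)\Big(\int_0^1\cos\big((l-\tfrac12)\pi\varphi^{j'}(s)\big)\,\mathrm{d}X^{j'}_s\Big).$$ *)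

theory Defs
  imports "HOL-Probability.Probability"
begin

section \<open>Wiener process and its completed filtration\<close>

text \<open>
  Processes are functions \<^term>\<open>X :: real \<Rightarrow> 'a \<Rightarrow> real\<close> of a time in \<^term>\<open>{0..1::real}\<close> and a sample
  point; their values at other times are irrelevant. Components and indices run through
  \<^term>\<open>{1..d}\<close> and \<^term>\<open>{1..J}\<close>.
\<close>

definition wiener_process :: "'a measure \<Rightarrow> nat \<Rightarrow> (nat \<Rightarrow> real \<Rightarrow> 'a \<Rightarrow> real) \<Rightarrow> bool" where
  "wiener_process M d W \<longleftrightarrow>
     (\<forall>r\<in>{1..d}. \<forall>t\<in>{0..1}. W r t \<in> borel_measurable M) \<and>
     (\<forall>r\<in>{1..d}. AE \<omega> in M. W r 0 \<omega> = 0) \<and>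
     (\<forall>r\<in>{1..d}. AE \<omega> in M. continuous_on {0..1} (\<lambda>t. W r t \<omega>)) \<and>
     (\<forall>r\<in>{1..d}. \<forall>s t. 0 \<le> s \<and> s < t \<and> t \<le> 1 \<longrightarrow>
        distributed M lborel (\<lambda>\<omega>. W r t \<omega> - W r s \<omega>) (normal_density 0 (sqrt (t - s)))) \<and>
     (\<forall>n (\<tau> :: nat \<Rightarrow> real). strict_mono_on {0..n} \<tau> \<and> \<tau> ` {0..n} \<subseteq> {0..1} \<longrightarrow>
        prob_space.indep_vars M (\<lambda>_. borel)
          (\<lambda>(r, k) \<omega>. W r (\<tau> (Suc k)) \<omega> - W r (\<tau> k) \<omega>) ({1..d} \<times> {..<n}))"

text \<open>
  For a complete measure \<^term>\<open>M\<close>, \<^term>\<open>null_sets M\<close> contains all subsets of null events, so the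
  \<open>\<sigma>\<close>-algebra below is complete. Only the measurable sets of the resulting measure are used.
\<close>

definition wiener_filtration :: "'a measure \<Rightarrow> nat \<Rightarrow> (nat \<Rightarrow> real \<Rightarrow> 'a \<Rightarrow> real) \<Rightarrow> real \<Rightarrow> 'a measure" where
  "wiener_filtration M d W t =
     sigma (space M)
       ({W r s -` B \<inter> space M | r s B. r \<in> {1..d} \<and> s \<in> {0..t} \<and> B \<in> sets borel} \<union> null_sets M)"

definition L2a :: "'a measure \<Rightarrow> (real \<Rightarrow> 'a measure) \<Rightarrow> (real \<Rightarrow> 'a \<Rightarrow> real) set" where
  "L2a M F = {\<theta>.
     (\<lambda>(s, \<omega>). \<theta> s \<omega>) \<in> borel_measurable (restrict_space borel {0..1} \<Otimes>\<^sub>M M) \<and>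
     (\<forall>t\<in>{0..1}. \<theta> t \<in> borel_measurable (F t)) \<and>
     (\<integral>\<^sup>+ \<omega>. (\<integral>\<^sup>+ s\<in>{0..1}. ennreal (\<bar>\<theta> s \<omega>\<bar>\<^sup>2) \<partial>lborel) \<partial>M) < \<infinity>}"


section \<open>Stochastic integral\<close>

text \<open>
  The integral over \<open>[0,t]\<close>, with respect to \<^term>\<open>X\<close>, of an integrand \<^term>\<open>H\<close> that is constant in time
  on each \<open>[\<tau> k, \<tau> (k + 1))\<close>, \<open>k < n\<close>.
\<close>

definition elementary_integral ::
  "(nat \<Rightarrow> real) \<Rightarrow> nat \<Rightarrow> (real \<Rightarrow> 'a \<Rightarrow> real) \<Rightarrow> (real \<Rightarrow> 'a \<Rightarrow> real) \<Rightarrow> real \<Rightarrow> 'a \<Rightarrow> real" where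
  "elementary_integral \<tau> n H X t \<omega> =
     (\<Sum>k<n. H (\<tau> k) \<omega> * (X (min (\<tau> (Suc k)) t) \<omega> - X (min (\<tau> k) t) \<omega>))"

definition simple_process ::
  "'a measure \<Rightarrow> (real \<Rightarrow> 'a measure) \<Rightarrow> (nat \<Rightarrow> real) \<Rightarrow> nat \<Rightarrow> (real \<Rightarrow> 'a \<Rightarrow> real) \<Rightarrow> bool" where
  "simple_process M F \<tau> n H \<longleftrightarrow>
     \<tau> 0 = 0 \<and> \<tau> n = 1 \<and> strict_mono_on {0..n} \<tau> \<and>
     (\<forall>k<n. \<forall>s\<in>{\<tau> k..<\<tau> (Suc k)}. \<forall>\<omega>\<in>space M. H s \<omega> = H (\<tau> k) \<omega>) \<and>
     (\<forall>k<n. H (\<tau> k) \<in> borel_measurable (F (\<tau> k))) \<and>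
     (\<exists>C. \<forall>k<n. \<forall>\<omega>\<in>space M. \<bar>H (\<tau> k) \<omega>\<bar> \<le> C)"

text \<open>
  \<^term>\<open>Y\<close> is a version of the Ito integral of \<^term>\<open>\<theta>\<close> over \<open>[0,t]\<close> with respect to the scalar Wiener
  process \<^term>\<open>B\<close>: the \<open>L\<^sup>2\<close>-limit of the integrals of simple processes that approximate \<^term>\<open>\<theta>\<close> in
  \<open>L\<^sup>2\<close>. By the Ito isometry it is unique up to null sets.
\<close>

definition has_ito_integral ::
  "'a measure \<Rightarrow> (real \<Rightarrow> 'a measure) \<Rightarrow> (real \<Rightarrow> 'a \<Rightarrow> real) \<Rightarrow> (real \<Rightarrow> 'a \<Rightarrow> real) \<Rightarrow> real \<Rightarrow> ('a \<Rightarrow> real) \<Rightarrow> bool" where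
  "has_ito_integral M F B \<theta> t Y \<longleftrightarrow>
     Y \<in> borel_measurable M \<and>
     (\<exists>\<tau> n H. (\<forall>i::nat. simple_process M F (\<tau> i) (n i) (H i)) \<and>
        (\<lambda>i. \<integral>\<^sup>+ \<omega>. (\<integral>\<^sup>+ s\<in>{0..1}. ennreal ((H i s \<omega> - \<theta> s \<omega>)\<^sup>2) \<partial>lborel) \<partial>M) \<longlonglongrightarrow> 0 \<and>
        (\<lambda>i. \<integral>\<^sup>+ \<omega>. ennreal ((elementary_integral (\<tau> i) (n i) (H i) B t \<omega> - Y \<omega>)\<^sup>2) \<partial>M) \<longlonglongrightarrow> 0)"

definition ito_process ::
  "'a measure \<Rightarrow> nat \<Rightarrow> (nat \<Rightarrow> real \<Rightarrow> 'a \<Rightarrow> real) \<Rightarrow>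
   (real \<Rightarrow> 'a \<Rightarrow> real) \<Rightarrow> (nat \<Rightarrow> real \<Rightarrow> 'a \<Rightarrow> real) \<Rightarrow> (real \<Rightarrow> 'a \<Rightarrow> real) \<Rightarrow> bool" where
  "ito_process M d W b \<sigma> X \<longleftrightarrow>
     X 0 \<in> borel_measurable M \<and>
     b \<in> L2a M (wiener_filtration M d W) \<and>
     (\<forall>r\<in>{1..d}. \<sigma> r \<in> L2a M (wiener_filtration M d W)) \<and>
     (\<forall>t\<in>{0..1}. \<exists>I.
        (\<forall>r\<in>{1..d}. has_ito_integral M (wiener_filtration M d W) (W r) (\<sigma> r) t (I r)) \<and>
        (AE \<omega> in M. X t \<omega> = X 0 \<omega> + (LINT s:{0..t}|lborel. b s \<omega>) + (\<Sum>r\<in>{1..d}. I r \<omega>)))"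


section \<open>Sampling scheme\<close>

definition sampling_grid :: "nat \<Rightarrow> (nat \<Rightarrow> nat) \<Rightarrow> (nat \<Rightarrow> nat \<Rightarrow> real) \<Rightarrow> bool" where
  "sampling_grid J N t \<longleftrightarrow>
     (\<forall>j\<in>{1..J}. t j 0 = 0 \<and> t j (N j) = 1 \<and> strict_mono_on {0..N j} (t j))"

definition grid_size :: "nat \<Rightarrow> (nat \<Rightarrow> nat) \<Rightarrow> nat" where
  "grid_size J N = Min (N ` {1..J})"

definition grid_mesh :: "nat \<Rightarrow> (nat \<Rightarrow> nat) \<Rightarrow> (nat \<Rightarrow> nat \<Rightarrow> real) \<Rightarrow> real" where
  "grid_mesh J N t = Max {\<bar>t j k - t j (k - 1)\<bar> | j k. j \<in> {1..J} \<and> k \<in> {1..N j}}"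

definition Pi_star :: "nat \<Rightarrow> (nat \<Rightarrow> nat) \<Rightarrow> (nat \<Rightarrow> nat \<Rightarrow> real) \<Rightarrow> (nat \<Rightarrow> real \<Rightarrow> real) set" where
  "Pi_star J N t = {\<phi>. \<forall>j\<in>{1..J}.
     (\<forall>s\<in>{0..1}. \<phi> j s \<in> {0..1}) \<and>
     (\<forall>k\<in>{1..N j}. \<exists>c\<in>{t j (k - 1)..t j k}. \<forall>s\<in>{t j (k - 1)..<t j k}. \<phi> j s = c) \<and>
     (\<forall>k\<in>{1..N j - 1}. \<phi> j (t j (k - 1)) \<noteq> \<phi> j (t j k))}"


section \<open>Kernel and estimator\<close>

definition sin_ratio :: "nat \<Rightarrow> real \<Rightarrow> real" where
  "sin_ratio m x =
     (if sin (pi * x / 2) = 0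
      then Lim (at x) (\<lambda>y. sin (real m * pi * y) / sin (pi * y / 2))
      else sin (real m * pi * x) / sin (pi * x / 2))"

definition siml_kernel :: "nat \<Rightarrow> (real \<Rightarrow> real) \<Rightarrow> (real \<Rightarrow> real) \<Rightarrow> real \<Rightarrow> real \<Rightarrow> real" where
  "siml_kernel m \<phi> \<phi>' u s =
     1 / (2 * real m) * sin_ratio m (\<phi> u + \<phi>' s) + 1 / (2 * real m) * sin_ratio m (\<phi> u - \<phi>' s)"

lemma sum_cos_mult_sin:
  "2 * sin (x / 2) * (\<Sum>l=1..m. cos ((real l - 1/2) * x)) = sin (real m * x)"
proof (induction m)
  case (Suc m)
  have "2 * sin (x / 2) * cos ((real (Suc m) - 1/2) * x) = sin (real (Suc m) * x) - sin (real m * x)"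
    unfolding sin_diff_sin by (simp add: field_simps)
  then show ?case using Suc.IH by (simp add: distrib_left)
qed simp

lemma sin_ratio_eq_sum:
  "sin_ratio m x = 2 * (\<Sum>l=1..m. cos ((real l - 1/2) * pi * x))"
proof -
  define S where "S y = 2 * (\<Sum>l=1..m. cos ((real l - 1/2) * pi * y))" for y :: real
  have quot: "sin (real m * pi * y) / sin (pi * y / 2) = S y" if "sin (pi * y / 2) \<noteq> 0" for y
    using sum_cos_mult_sin[of "pi * y" m] that by (simp add: S_def field_simps)
  show ?thesis
  proof (cases "sin (pi * x / 2) = 0")
    case True
    have "sin (pi * y / 2) \<noteq> 0" if "y \<noteq> x" "dist y x < 2" for y
    proof
      assume "sin (pi * y / 2) = 0"
      then have "sin (pi * y / 2 - pi * x / 2) = 0"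
        using True by (simp add: sin_diff)
      moreover have "pi * y / 2 - pi * x / 2 = pi * ((y - x) / 2)"
        by (simp add: field_simps)
      ultimately have "sin (pi * ((y - x) / 2)) = 0"
        by metis
      moreover have "\<bar>pi * ((y - x) / 2)\<bar> < pi"
        using that(2) by (simp add: abs_mult dist_real_def)
      ultimately have "pi * ((y - x) / 2) = 0"
        using sin_eq_0_pi[of "pi * ((y - x) / 2)"] by linarith
      with that(1) show False by simp
    qed
    then have "eventually (\<lambda>y. sin (pi * y / 2) \<noteq> 0) (at x)"
      unfolding eventually_at by (intro exI[of _ 2]) auto
    then have "eventually (\<lambda>y. S y = sin (real m * pi * y) / sin (pi * y / 2)) (at x)"
      by eventually_elim (simp add: quot)
    moreover have "(S \<longlongrightarrow> S x) (at x)"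
      unfolding S_def by (intro tendsto_intros)
    ultimately have "((\<lambda>y. sin (real m * pi * y) / sin (pi * y / 2)) \<longlongrightarrow> S x) (at x)"
      by (rule Lim_transform_eventually[rotated])
    then show ?thesis
      using True by (simp add: sin_ratio_def tendsto_Lim S_def)
  qed (simp add: sin_ratio_def quot S_def)
qed

lemma siml_kernel_eq_sum:
  "siml_kernel m \<phi> \<phi>' u s =
     2 / real m * (\<Sum>l=1..m. cos ((real l - 1/2) * pi * \<phi> u) * cos ((real l - 1/2) * pi * \<phi>' s))"
proof -
  have "cos (c * (a + b)) + cos (c * (a - b)) = 2 * (cos (c * a) * cos (c * b))" for a b c :: real
    by (simp add: distrib_left right_diff_distrib cos_add cos_diff)
  then have "(\<Sum>l=1..m. cos ((real l - 1/2) * pi * (\<phi> u + \<phi>' s))) +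
      (\<Sum>l=1..m. cos ((real l - 1/2) * pi * (\<phi> u - \<phi>' s))) =
      2 * (\<Sum>l=1..m. cos ((real l - 1/2) * pi * \<phi> u) * cos ((real l - 1/2) * pi * \<phi>' s))"
    unfolding sum.distrib[symmetric] sum_distrib_left by (intro sum.cong) auto
  moreover have "1 / (2 * c) * (2 * A) + 1 / (2 * c) * (2 * B) = 2 / c * S"
    if "A + B = 2 * S" for A B S c :: real
  proof -
    have "1 / (2 * c) * (2 * A) + 1 / (2 * c) * (2 * B) = (A + B) / c"
      by (simp add: add_divide_distrib)
    with that show ?thesis by simp
  qed
  ultimately show ?thesis
    unfolding siml_kernel_def sin_ratio_eq_sum by blast
qed

text \<open>
  On \<open>[t j (k - 1), t j k)\<close> the integrand \<open>s \<mapsto> cos ((l - 1/2) \<pi> \<phi> j s)\<close> is constant, so its integral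
  with respect to \<open>X j\<close> over \<open>[0,1]\<close> is elementary.
\<close>

definition siml_estimator ::
  "nat \<Rightarrow> (nat \<Rightarrow> nat) \<Rightarrow> (nat \<Rightarrow> nat \<Rightarrow> real) \<Rightarrow> (nat \<Rightarrow> real \<Rightarrow> real) \<Rightarrow> nat \<Rightarrow>
   (nat \<Rightarrow> real \<Rightarrow> 'a \<Rightarrow> real) \<Rightarrow> nat \<Rightarrow> nat \<Rightarrow> 'a \<Rightarrow> real" where
  "siml_estimator J N t \<phi> m X j j' \<omega> =
     2 * real (grid_size J N) / (real (grid_size J N) + 1/2) * (1 / real m) *
     (\<Sum>l=1..m.
        elementary_integral (t j) (N j) (\<lambda>s _. cos ((real l - 1/2) * pi * \<phi> j s)) (X j) 1 \<omega> *
        elementary_integral (t j') (N j') (\<lambda>s _. cos ((real l - 1/2) * pi * \<phi> j' s)) (X j') 1 \<omega>)"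


section \<open>Moments and convergence\<close>

text \<open>Meaningful for \<open>p > 0\<close>.\<close>

definition ennreal_powr :: "ennreal \<Rightarrow> real \<Rightarrow> ennreal" where
  "ennreal_powr x p = (if x = \<infinity> then \<infinity> else ennreal (enn2real x powr p))"

text \<open>
  The supremum over the uncountable set of times is a measurable function of the sample point when
  \<^term>\<open>M\<close> is complete and \<^term>\<open>f\<close> is jointly measurable (projection theorem).
\<close>

definition sup_moment :: "'a measure \<Rightarrow> real \<Rightarrow> (real \<Rightarrow> 'a \<Rightarrow> real) \<Rightarrow> ennreal" where
  "sup_moment M q f = (\<integral>\<^sup>+ \<omega>. ennreal_powr (SUP t\<in>{0..1}. ennreal (f t \<omega>)) q \<partial>M)"

definition tendsto_in_probability :: "'a measure \<Rightarrow> (nat \<Rightarrow> 'a \<Rightarrow> real) \<Rightarrow> ('a \<Rightarrow> real) \<Rightarrow> bool" where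
  "tendsto_in_probability M Y Z \<longleftrightarrow>
     (\<forall>i. Y i \<in> borel_measurable M) \<and> Z \<in> borel_measurable M \<and>
     (\<forall>\<epsilon>>0. (\<lambda>i. measure M {\<omega> \<in> space M. \<bar>Y i \<omega> - Z \<omega>\<bar> > \<epsilon>}) \<longlonglongrightarrow> 0)"

end

theory Submission
  imports Defs
begin

text \<open>
  For a process \<open>Y\<close> let \<open>A\<^sub>l(Y)\<close> be its integral over \<open>[0,1]\<close> against the step function \<open>c\<^sub>l(s) =
  cos ((l - 1/2) \<pi> \<phi>(s))\<close>. Up to the factor \<open>n / (n + 1/2)\<close>, which tends to 1, the estimator is
  the bilinear form \<open>B(Y, Y') = (2/m) \<Sum>\<^sub>l A\<^sub>l(Y) A'\<^sub>l(Y')\<close>, formally the double integral of the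
  kernel \<open>D(u,s)\<close> against \<open>dY\<^sub>u dY'\<^sub>s\<close>. The proof rests on three properties of \<open>D\<close>. It is bounded
  by 2. It tends to 0 off the diagonal, because \<open>\<phi>(s)\<close> tends to \<open>s\<close> and Dirichlet kernels divided
  by their order vanish away from their poles; hence \<open>\<integral>\<integral> D\<^sup>2\<close> and \<open>\<integral> \<bar>D(u,s)\<bar> ds\<close> tend to 0
  (\<open>kernel_square_tendsto_0\<close>, \<open>kernel_mass_tendsto_0\<close>). On the diagonal, the assumed convergence
  for continuous test functions extends to indicators of intervals (\<open>kernel_diagonal_tendsto\<close>).

  Let \<open>Y\<close> and \<open>Y'\<close> first be the increments of components of the Wiener process over two fixed
  intervals. On a common refinement of both grids, \<open>B(Y, Y')\<close> is a quadratic form in independent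
  centred normal variables. By Wick's formula its variance is at most \<open>2 \<integral>\<integral> D\<^sup>2\<close>; its mean is \<open>\<integral>
  D(s,s) ds\<close> over the intersection of the intervals if the components agree and 0 otherwise
  (\<open>form_brownian_piece_l2\<close>). So \<open>B(Y, Y')\<close> converges to the length of the intersection,
  respectively to 0. The random coefficients of a simple process do not depend on time within a
  cell and factor out of \<open>B\<close>, which gives the limit \<open>\<integral> H H' ds\<close> for integrals of simple processes
  \<open>H\<close> and \<open>H'\<close> with respect to the same component (\<open>form_simple_tendsto\<close>).

  General integrands follow by approximation. By Young's inequality, \<open>E \<bar>B(Y, Y')\<bar>\<close> is controlled
  by the energies \<open>(1/m) \<Sum>\<^sub>l E A\<^sub>l(Y)\<^sup>2\<close>. Since \<open>\<bar>c\<^sub>l\<bar> \<le> 1\<close>, the Ito isometry bounds the energy of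
  an integral of \<open>\<theta>\<close> by a multiple of \<open>E \<integral> \<theta>\<^sup>2 ds\<close>, whatever the grid and \<open>m\<close> are
  (\<open>ito_integral_weighted_approximation\<close>). Replacing integrands by simple processes therefore
  costs an error that is small uniformly along the sequence of grids (\<open>form_ito_tendsto\<close>). The
  isometry itself needs that the increments of the Wiener process are independent of the completed
  filtration (\<open>indep_set_F_increment\<close>).

  The drift contributes nothing in the limit, even though it is not a martingale: its energy is a
  double integral of \<open>D(u,s) b(u) b(s)\<close>, at most \<open>\<integral> b(u)\<^sup>2 \<integral> \<bar>D(u,s)\<bar> ds du\<close> by Schur's test, and
  this tends to 0 (\<open>energy_drift_tendsto_0\<close>). Terms that pair the drift with a martingale vanish
  for the same reason.
\<close>

section \<open>Convergence in probability\<close>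

lemma (in complete_measure) borel_measurable_AE_eq:
  fixes f g :: "'a \<Rightarrow> real"
  assumes f: "f \<in> borel_measurable M" and eq: "AE \<omega> in M. g \<omega> = f \<omega>"
  shows "g \<in> borel_measurable M"
proof (rule measurableI)
  fix B :: "real set" assume "B \<in> sets borel"
  show "g -` B \<inter> space M \<in> sets M"
  proof (rule in_sets_AE)
    show "f -` B \<inter> space M \<in> sets M" by (rule measurable_sets[OF f \<open>B \<in> sets borel\<close>])
    show "AE \<omega> in M. \<omega> \<in> f -` B \<inter> space M \<longleftrightarrow> \<omega> \<in> g -` B \<inter> space M"
      using eq by eventually_elim auto
  qed auto
qed simp

context prob_space begin

lemma prob_gt_le_moment:
  assumes [measurable]: "f \<in> borel_measurable M" and e: "e > 0"
  shows "ennreal (measure M {\<omega> \<in> space M. \<bar>f \<omega>\<bar> > e}) \<le> ennreal (1 / e ^ q) * (\<integral>\<^sup>+ \<omega>. ennreal (\<bar>f \<omega>\<bar> ^ q) \<partial>M)"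
proof -
  have "emeasure M {\<omega> \<in> space M. \<bar>f \<omega>\<bar> > e} \<le>
    emeasure M {\<omega> \<in> space M. 1 \<le> ennreal (1 / e ^ q) * ennreal (\<bar>f \<omega>\<bar> ^ q)}"
  proof (rule emeasure_mono)
    show "{\<omega> \<in> space M. e < \<bar>f \<omega>\<bar>} \<subseteq> {\<omega> \<in> space M. 1 \<le> ennreal (1 / e ^ q) * ennreal (\<bar>f \<omega>\<bar> ^ q)}"
    proof safe
      fix \<omega> assume "e < \<bar>f \<omega>\<bar>"
      then have "e ^ q \<le> \<bar>f \<omega>\<bar> ^ q" using e by (intro power_mono) auto
      then have "1 \<le> (1 / e ^ q) * \<bar>f \<omega>\<bar> ^ q" using e by (simp add: field_simps)
      then show "1 \<le> ennreal (1 / e ^ q) * ennreal (\<bar>f \<omega>\<bar> ^ q)"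
        using e by (simp add: ennreal_mult'[symmetric] ennreal_ge_1)
    qed
  qed measurable
  also have "\<dots> \<le> ennreal (1 / e ^ q) * (\<integral>\<^sup>+ \<omega>. ennreal (\<bar>f \<omega>\<bar> ^ q) * indicator (space M) \<omega> \<partial>M)"
    by (rule nn_integral_Markov_inequality) auto
  also have "(\<integral>\<^sup>+ \<omega>. ennreal (\<bar>f \<omega>\<bar> ^ q) * indicator (space M) \<omega> \<partial>M) = (\<integral>\<^sup>+ \<omega>. ennreal (\<bar>f \<omega>\<bar> ^ q) \<partial>M)"
    by (intro nn_integral_cong) auto
  finally show ?thesis by (simp add: emeasure_eq_measure)
qed

lemma tendsto_in_probabilityD:
  "tendsto_in_probability M Y Z \<Longrightarrow> e > 0 \<Longrightarrow> (\<lambda>i. prob {\<omega> \<in> space M. \<bar>Y i \<omega> - Z \<omega>\<bar> > e}) \<longlonglongrightarrow> 0"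
  "tendsto_in_probability M Y Z \<Longrightarrow> Y i \<in> borel_measurable M"
  "tendsto_in_probability M Y Z \<Longrightarrow> Z \<in> borel_measurable M"
  unfolding tendsto_in_probability_def by auto

lemma tendsto_in_probabilityI_moment:
  assumes [measurable]: "\<And>i. Y i \<in> borel_measurable M" "Z \<in> borel_measurable M"
    and lim: "(\<lambda>i. \<integral>\<^sup>+ \<omega>. ennreal (\<bar>Y i \<omega> - Z \<omega>\<bar> ^ q) \<partial>M) \<longlonglongrightarrow> 0"
  shows "tendsto_in_probability M Y Z"
  unfolding tendsto_in_probability_def
proof (intro conjI allI impI)
  fix e :: real assume e: "e > 0"
  have "(\<lambda>i. ennreal (1 / e ^ q) * (\<integral>\<^sup>+ \<omega>. ennreal (\<bar>Y i \<omega> - Z \<omega>\<bar> ^ q) \<partial>M)) \<longlonglongrightarrow> ennreal (1 / e ^ q) * 0"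
    by (intro ennreal_tendsto_cmult lim) auto
  then have "(\<lambda>i. ennreal (prob {\<omega> \<in> space M. \<bar>Y i \<omega> - Z \<omega>\<bar> > e})) \<longlonglongrightarrow> ennreal 0"
    unfolding mult_zero_right ennreal_0
    by (rule tendsto_sandwich[OF _ _ tendsto_const[of "0::ennreal"], rotated -1])
       (auto intro!: always_eventually prob_gt_le_moment e)
  then show "(\<lambda>i. prob {\<omega> \<in> space M. \<bar>Y i \<omega> - Z \<omega>\<bar> > e}) \<longlonglongrightarrow> 0"
    by (subst (asm) tendsto_ennreal_iff) auto
qed auto

lemma tendsto_in_probability_cong_AE:
  assumes Y: "tendsto_in_probability M Y Z" and m: "\<And>i. Y' i \<in> borel_measurable M" "Z' \<in> borel_measurable M"
    and eq: "\<And>i. AE \<omega> in M. Y' i \<omega> = Y i \<omega>" "AE \<omega> in M. Z' \<omega> = Z \<omega>"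
  shows "tendsto_in_probability M Y' Z'"
  unfolding tendsto_in_probability_def
proof (intro conjI allI impI m)
  fix e :: real assume e: "e > 0"
  note [measurable] = tendsto_in_probabilityD(2,3)[OF Y] m
  have "prob {\<omega> \<in> space M. \<bar>Y' i \<omega> - Z' \<omega>\<bar> > e} = prob {\<omega> \<in> space M. \<bar>Y i \<omega> - Z \<omega>\<bar> > e}" for i
    by (intro finite_measure_eq_AE) (use eq(1)[of i] eq(2) in auto)
  then show "(\<lambda>i. prob {\<omega> \<in> space M. \<bar>Y' i \<omega> - Z' \<omega>\<bar> > e}) \<longlonglongrightarrow> 0"
    using tendsto_in_probabilityD(1)[OF Y e] by simp
qed

lemma tendsto_in_probability_add:
  assumes Y: "tendsto_in_probability M Y Z" and Y': "tendsto_in_probability M Y' Z'"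
  shows "tendsto_in_probability M (\<lambda>i \<omega>. Y i \<omega> + Y' i \<omega>) (\<lambda>\<omega>. Z \<omega> + Z' \<omega>)"
proof -
  note [measurable] = tendsto_in_probabilityD(2,3)[OF Y] tendsto_in_probabilityD(2,3)[OF Y']
  show ?thesis unfolding tendsto_in_probability_def
  proof (intro conjI allI impI)
    fix e :: real assume e: "e > 0"
    have le: "prob {\<omega> \<in> space M. \<bar>Y i \<omega> + Y' i \<omega> - (Z \<omega> + Z' \<omega>)\<bar> > e} \<le>
      prob {\<omega> \<in> space M. \<bar>Y i \<omega> - Z \<omega>\<bar> > e / 2} + prob {\<omega> \<in> space M. \<bar>Y' i \<omega> - Z' \<omega>\<bar> > e / 2}"
      (is "prob ?E \<le> prob ?A + prob ?B") for i
    proof -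
      have "prob ?E \<le> prob (?A \<union> ?B)"
      proof (rule finite_measure_mono; safe?)
        fix \<omega> assume "\<omega> \<in> space M" "e < \<bar>Y i \<omega> + Y' i \<omega> - (Z \<omega> + Z' \<omega>)\<bar>"
          "\<not> e / 2 < \<bar>Y' i \<omega> - Z' \<omega>\<bar>"
        then show "e / 2 < \<bar>Y i \<omega> - Z \<omega>\<bar>" by linarith
      qed measurable
      also have "\<dots> \<le> prob ?A + prob ?B" by (rule measure_Un_le) measurable
      finally show ?thesis .
    qed
    have "(\<lambda>i. prob {\<omega> \<in> space M. \<bar>Y i \<omega> - Z \<omega>\<bar> > e / 2} + prob {\<omega> \<in> space M. \<bar>Y' i \<omega> - Z' \<omega>\<bar> > e / 2}) \<longlonglongrightarrow> 0 + 0"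
      by (intro tendsto_add tendsto_in_probabilityD(1)[OF Y] tendsto_in_probabilityD(1)[OF Y']) (use e in auto)
    then show "(\<lambda>i. prob {\<omega> \<in> space M. \<bar>Y i \<omega> + Y' i \<omega> - (Z \<omega> + Z' \<omega>)\<bar> > e}) \<longlonglongrightarrow> 0"
      unfolding add_0_left
      by (rule tendsto_sandwich[OF _ _ tendsto_const[of 0], rotated -1]) (use le in \<open>auto intro!: always_eventually\<close>)
  qed auto
qed

lemma tendsto_in_probability_const:
  "Z \<in> borel_measurable M \<Longrightarrow> tendsto_in_probability M (\<lambda>_. Z) Z"
  unfolding tendsto_in_probability_def by auto

lemma tendsto_in_probability_sum:
  assumes "\<And>k. k \<in> K \<Longrightarrow> tendsto_in_probability M (Y k) (Z k)"
  shows "tendsto_in_probability M (\<lambda>i \<omega>. \<Sum>k\<in>K. Y k i \<omega>) (\<lambda>\<omega>. \<Sum>k\<in>K. Z k \<omega>)"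
  using assms
  by (induction K rule: infinite_finite_induct)
     (auto intro!: tendsto_in_probability_add tendsto_in_probability_const)

lemma tendsto_in_probability_mult_bounded:
  assumes Y: "tendsto_in_probability M Y Z" and \<xi>[measurable]: "\<xi> \<in> borel_measurable M"
    and b: "\<And>\<omega>. \<omega> \<in> space M \<Longrightarrow> \<bar>\<xi> \<omega>\<bar> \<le> C"
  shows "tendsto_in_probability M (\<lambda>i \<omega>. \<xi> \<omega> * Y i \<omega>) (\<lambda>\<omega>. \<xi> \<omega> * Z \<omega>)"
proof -
  note [measurable] = tendsto_in_probabilityD(2,3)[OF Y]
  define C' where "C' = max C 1"
  have C': "C' > 0" "\<And>\<omega>. \<omega> \<in> space M \<Longrightarrow> \<bar>\<xi> \<omega>\<bar> \<le> C'"
    using b by (force simp: C'_def)+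
  show ?thesis unfolding tendsto_in_probability_def
  proof (intro conjI allI impI)
    fix e :: real assume e: "e > 0"
    have le: "prob {\<omega> \<in> space M. \<bar>\<xi> \<omega> * Y i \<omega> - \<xi> \<omega> * Z \<omega>\<bar> > e} \<le>
      prob {\<omega> \<in> space M. \<bar>Y i \<omega> - Z \<omega>\<bar> > e / C'}" for i
    proof (rule finite_measure_mono; safe?)
      fix \<omega> assume \<omega>: "\<omega> \<in> space M" "e < \<bar>\<xi> \<omega> * Y i \<omega> - \<xi> \<omega> * Z \<omega>\<bar>"
      have "\<bar>\<xi> \<omega> * Y i \<omega> - \<xi> \<omega> * Z \<omega>\<bar> = \<bar>\<xi> \<omega>\<bar> * \<bar>Y i \<omega> - Z \<omega>\<bar>"
        by (simp add: abs_mult[symmetric] right_diff_distrib)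
      also have "\<dots> \<le> C' * \<bar>Y i \<omega> - Z \<omega>\<bar>" using C'(2)[OF \<omega>(1)] by (intro mult_right_mono) auto
      finally show "e / C' < \<bar>Y i \<omega> - Z \<omega>\<bar>" using \<omega> C'(1) by (simp add: field_simps)
    qed measurable
    show "(\<lambda>i. prob {\<omega> \<in> space M. \<bar>\<xi> \<omega> * Y i \<omega> - \<xi> \<omega> * Z \<omega>\<bar> > e}) \<longlonglongrightarrow> 0"
      by (rule tendsto_sandwich[OF _ _ tendsto_const[of 0] tendsto_in_probabilityD(1)[OF Y, of "e / C'"]])
         (use e C' le in \<open>auto intro!: always_eventually\<close>)
  qed auto
qed

text \<open>
  An \<open>L\<^sup>1\<close> error of size \<open>e\<close> costs, by Markov's inequality, a probability of order \<open>e\<close>. As the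
  error bound is uniform in \<open>i\<close>, the approximation may be fixed before \<open>i\<close> tends to infinity. The
  bound need only hold for large \<open>i\<close>, from an index that may depend on \<open>e\<close>.
\<close>

lemma tendsto_in_probability_approx:
  assumes [measurable]: "\<And>i. Y i \<in> borel_measurable M" "Z \<in> borel_measurable M"
    and approx: "\<And>e. e > 0 \<Longrightarrow> \<exists>Y' Z'. tendsto_in_probability M Y' Z' \<and>
      (\<forall>\<^sub>F i in sequentially. (\<integral>\<^sup>+ \<omega>. ennreal \<bar>Y i \<omega> - Y' i \<omega>\<bar> \<partial>M) \<le> ennreal e) \<and>
      (\<integral>\<^sup>+ \<omega>. ennreal \<bar>Z \<omega> - Z' \<omega>\<bar> \<partial>M) \<le> ennreal e"
  shows "tendsto_in_probability M Y Z"
  unfolding tendsto_in_probability_def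
proof (intro conjI allI impI)
  fix e :: real assume e: "e > 0"
  show "(\<lambda>i. prob {\<omega> \<in> space M. \<bar>Y i \<omega> - Z \<omega>\<bar> > e}) \<longlonglongrightarrow> 0"
    unfolding tendsto_iff
  proof (intro allI impI)
    fix h :: real assume h: "h > 0"
    (* Markov's inequality at level e / 3 bounds each approximation error by 3 e' / e = h /
       4. *)
    define e' where "e' = h * e / 12"
    have e': "e' > 0" using h e by (simp add: e'_def)
    from approx[OF e'] obtain Y' Z' where YZ: "tendsto_in_probability M Y' Z'"
      and ev: "\<forall>\<^sub>F i in sequentially. (\<integral>\<^sup>+ \<omega>. ennreal \<bar>Y i \<omega> - Y' i \<omega>\<bar> \<partial>M) \<le> ennreal e'"
      and Z: "(\<integral>\<^sup>+ \<omega>. ennreal \<bar>Z \<omega> - Z' \<omega>\<bar> \<partial>M) \<le> ennreal e'" by auto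
    note [measurable] = tendsto_in_probabilityD(2,3)[OF YZ]
    have small: "prob {\<omega> \<in> space M. \<bar>f \<omega>\<bar> > e / 3} \<le> h / 4"
      if [measurable]: "f \<in> borel_measurable M" and "(\<integral>\<^sup>+ \<omega>. ennreal \<bar>f \<omega>\<bar> \<partial>M) \<le> ennreal e'" for f
    proof -
      have "ennreal (prob {\<omega> \<in> space M. \<bar>f \<omega>\<bar> > e / 3}) \<le> ennreal (1 / (e / 3)) * (\<integral>\<^sup>+ \<omega>. ennreal \<bar>f \<omega>\<bar> \<partial>M)"
        using prob_gt_le_moment[OF that(1), of "e / 3" 1] e by simp
      also have "\<dots> \<le> ennreal (1 / (e / 3)) * ennreal e'" by (intro mult_left_mono that) auto
      also have "\<dots> = ennreal (h / 4)" using e h by (simp add: ennreal_mult'[symmetric] e'_def field_simps)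
      finally show ?thesis using h by simp
    qed
    have "\<forall>\<^sub>F i in sequentially. prob {\<omega> \<in> space M. \<bar>Y' i \<omega> - Z' \<omega>\<bar> > e / 3} < h / 4"
      by (rule order_tendstoD(2)[OF tendsto_in_probabilityD(1)[OF YZ]]) (use e h in auto)
    with ev show "\<forall>\<^sub>F i in sequentially. dist (prob {\<omega> \<in> space M. \<bar>Y i \<omega> - Z \<omega>\<bar> > e}) 0 < h"
    proof eventually_elim
      case (elim i)
      let ?A = "{\<omega> \<in> space M. \<bar>Y i \<omega> - Y' i \<omega>\<bar> > e / 3}"
      let ?B = "{\<omega> \<in> space M. \<bar>Y' i \<omega> - Z' \<omega>\<bar> > e / 3}"
      let ?C = "{\<omega> \<in> space M. \<bar>Z \<omega> - Z' \<omega>\<bar> > e / 3}"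
      have "prob {\<omega> \<in> space M. \<bar>Y i \<omega> - Z \<omega>\<bar> > e} \<le> prob ((?A \<union> ?B) \<union> ?C)"
      proof (rule finite_measure_mono; safe?)
        fix \<omega> assume "\<omega> \<in> space M" "e < \<bar>Y i \<omega> - Z \<omega>\<bar>"
          "\<not> e / 3 < \<bar>Z \<omega> - Z' \<omega>\<bar>" "\<not> e / 3 < \<bar>Y' i \<omega> - Z' \<omega>\<bar>"
        then show "e / 3 < \<bar>Y i \<omega> - Y' i \<omega>\<bar>" by linarith
      qed measurable
      also have "\<dots> \<le> prob (?A \<union> ?B) + prob ?C" by (rule measure_Un_le) auto
      also have "prob (?A \<union> ?B) \<le> prob ?A + prob ?B" by (rule measure_Un_le) auto
      also have "prob ?A \<le> h / 4" using elim by (intro small) auto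
      also have "prob ?C \<le> h / 4" using Z by (intro small) auto
      finally show ?case using elim h by simp
    qed
  qed
qed auto

lemma tendsto_in_probability_scale:
  fixes \<kappa> :: "nat \<Rightarrow> real"
  assumes Y: "tendsto_in_probability M Y Z" and \<kappa>: "\<kappa> \<longlonglongrightarrow> 1"
    and Z: "(\<integral>\<^sup>+ \<omega>. ennreal \<bar>Z \<omega>\<bar> \<partial>M) < \<infinity>"
  shows "tendsto_in_probability M (\<lambda>i \<omega>. \<kappa> i * Y i \<omega>) Z"
proof -
  note [measurable] = tendsto_in_probabilityD(2,3)[OF Y]
  have 1: "tendsto_in_probability M (\<lambda>i \<omega>. \<kappa> i * Z \<omega>) Z"
  proof (rule tendsto_in_probabilityI_moment[where q=1])
    have "(\<integral>\<^sup>+ \<omega>. ennreal (\<bar>\<kappa> i * Z \<omega> - Z \<omega>\<bar> ^ 1) \<partial>M) = ennreal \<bar>\<kappa> i - 1\<bar> * (\<integral>\<^sup>+ \<omega>. ennreal \<bar>Z \<omega>\<bar> \<partial>M)" for i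
    proof -
      have "\<bar>\<kappa> i * Z \<omega> - Z \<omega>\<bar> = \<bar>\<kappa> i - 1\<bar> * \<bar>Z \<omega>\<bar>" for \<omega>
        by (simp add: abs_mult[symmetric] left_diff_distrib)
      then show ?thesis by (simp add: ennreal_mult nn_integral_cmult)
    qed
    moreover have "(\<lambda>i. ennreal \<bar>\<kappa> i - 1\<bar> * (\<integral>\<^sup>+ \<omega>. ennreal \<bar>Z \<omega>\<bar> \<partial>M)) \<longlonglongrightarrow> ennreal \<bar>1 - 1\<bar> * (\<integral>\<^sup>+ \<omega>. ennreal \<bar>Z \<omega>\<bar> \<partial>M)"
      using Z by (intro tendsto_mult_ennreal tendsto_intros tendsto_ennrealI \<kappa>) auto
    ultimately show "(\<lambda>i. \<integral>\<^sup>+ \<omega>. ennreal (\<bar>\<kappa> i * Z \<omega> - Z \<omega>\<bar> ^ 1) \<partial>M) \<longlonglongrightarrow> 0" by simp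
  qed auto
  have 2: "tendsto_in_probability M (\<lambda>i \<omega>. \<kappa> i * (Y i \<omega> - Z \<omega>)) (\<lambda>_. 0)"
    unfolding tendsto_in_probability_def
  proof (intro conjI allI impI)
    fix e :: real assume e: "e > 0"
    have "\<forall>\<^sub>F i in sequentially. \<kappa> i < 2" "\<forall>\<^sub>F i in sequentially. \<kappa> i > 0"
      using order_tendstoD[OF \<kappa>] by auto
    then have le: "\<forall>\<^sub>F i in sequentially. prob {\<omega> \<in> space M. \<bar>\<kappa> i * (Y i \<omega> - Z \<omega>) - 0\<bar> > e} \<le>
        prob {\<omega> \<in> space M. \<bar>Y i \<omega> - Z \<omega>\<bar> > e / 2}"
    proof eventually_elim
      case (elim i)
      have "\<bar>\<kappa> i * x\<bar> \<le> 2 * \<bar>x\<bar>" for x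
        using elim by (simp add: abs_mult mult_right_mono)
      then have "e / 2 < \<bar>x\<bar>" if "e < \<bar>\<kappa> i * x\<bar>" for x
        using that less_le_trans[OF that \<open>\<bar>\<kappa> i * x\<bar> \<le> 2 * \<bar>x\<bar>\<close>] by linarith
      then show ?case
        by (intro finite_measure_mono) auto
    qed
    show "(\<lambda>i. prob {\<omega> \<in> space M. \<bar>\<kappa> i * (Y i \<omega> - Z \<omega>) - 0\<bar> > e}) \<longlonglongrightarrow> 0"
      by (rule tendsto_sandwich[OF _ le tendsto_const[of 0] tendsto_in_probabilityD(1)[OF Y]])
         (use e in auto)
  qed auto
  show ?thesis using tendsto_in_probability_add[OF 1 2] by (simp add: right_diff_distrib)
qed

end

section \<open>Independence of Brownian increments from the past\<close>

lemma finite_set_enumeration: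
  fixes P :: "real set"
  assumes "finite P" "P \<noteq> {}"
  obtains n \<tau> where "strict_mono_on {0..n::nat} \<tau>" "\<tau> ` {0..n} = P"
proof -
  define L where "L = sorted_list_of_set P"
  have L: "sorted_wrt (<) L" "set L = P" using assms by (auto simp: L_def)
  have ne: "L \<noteq> []" using L(2) assms by auto
  have "strict_mono_on {0..length L - 1} ((!) L)"
  proof (rule strict_mono_onI)
    fix i j assume "i \<in> {0..length L - 1}" "j \<in> {0..length L - 1}" "i < j"
    then show "L ! i < L ! j" using ne by (intro sorted_wrt_nth_less[OF L(1)]) (cases L, auto)
  qed
  moreover have "{0..length L - 1} = {..<length L}" using ne by (cases L) (simp_all add: atLeast0AtMost lessThan_Suc_atMost)
  then have "(!) L ` {0..length L - 1} = P"
    using nth_image[of "length L" L] L(2) by (simp add: atLeast0LessThan)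
  ultimately show ?thesis by (rule that)
qed

locale wiener = prob_space M for M :: "'a measure" +
  fixes d :: nat and W :: "nat \<Rightarrow> real \<Rightarrow> 'a \<Rightarrow> real"
  assumes complete: "complete_measure M" and wiener: "wiener_process M d W"
begin

abbreviation F where "F \<equiv> wiener_filtration M d W"

lemma W_measurable: "r \<in> {1..d} \<Longrightarrow> 0 \<le> s \<Longrightarrow> s \<le> 1 \<Longrightarrow> W r s \<in> borel_measurable M"
  using wiener by (auto simp: wiener_process_def)

lemma space_F [simp]: "space (F a) = space M"
  and sets_F: "sets (F a) = sigma_sets (space M)
    ({W r s -` B \<inter> space M | r s B. r \<in> {1..d} \<and> s \<in> {0..a} \<and> B \<in> sets borel} \<union> null_sets M)"
proof -
  have "{W r s -` B \<inter> space M | r s B. r \<in> {1..d} \<and> s \<in> {0..a} \<and> B \<in> sets borel} \<union> null_sets M \<subseteq> Pow (space M)"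
    using sets.sets_into_space by (auto simp: null_sets_def)
  then show "space (F a) = space M" "sets (F a) = sigma_sets (space M)
    ({W r s -` B \<inter> space M | r s B. r \<in> {1..d} \<and> s \<in> {0..a} \<and> B \<in> sets borel} \<union> null_sets M)"
    unfolding wiener_filtration_def by (auto simp: sets_measure_of space_measure_of)
qed

lemma sets_F_subset: "0 \<le> a \<Longrightarrow> a \<le> 1 \<Longrightarrow> sets (F a) \<subseteq> sets M"
  unfolding sets_F
proof (intro sets.sigma_sets_subset Un_least subsetI)
  fix A assume "0 \<le> a" "a \<le> 1" "A \<in> {W r s -` B \<inter> space M | r s B. r \<in> {1..d} \<and> s \<in> {0..a} \<and> B \<in> sets borel}"
  then obtain r s B where A: "A = W r s -` B \<inter> space M" "r \<in> {1..d}" "0 \<le> s" "s \<le> 1" "B \<in> sets borel"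
    by (elim CollectE exE conjE) simp
  show "A \<in> sets M" unfolding A(1) by (rule measurable_sets[OF W_measurable[OF A(2-4)] A(5)])
qed (rule null_setsD2)

lemma F_mono: "a \<le> b \<Longrightarrow> sets (F a) \<subseteq> sets (F b)"
  unfolding sets_F
proof (intro sigma_sets_mono' Un_mono subset_refl subsetI)
  fix A assume "a \<le> b" "A \<in> {W r s -` B \<inter> space M | r s B. r \<in> {1..d} \<and> s \<in> {0..a} \<and> B \<in> sets borel}"
  then obtain r s B where "A = W r s -` B \<inter> space M" "r \<in> {1..d}" "s \<in> {0..b}" "B \<in> sets borel"
    by (elim CollectE exE conjE) simp
  then show "A \<in> {W r s -` B \<inter> space M | r s B. r \<in> {1..d} \<and> s \<in> {0..b} \<and> B \<in> sets borel}" by blast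
qed

lemma measurable_F_mono: "f \<in> borel_measurable (F a) \<Longrightarrow> a \<le> b \<Longrightarrow> f \<in> borel_measurable (F b)"
  using F_mono[of a b] measurable_sets[of f "F a" borel] by (intro measurableI) auto

lemma measurable_F: "f \<in> borel_measurable (F a) \<Longrightarrow> 0 \<le> a \<Longrightarrow> a \<le> 1 \<Longrightarrow> f \<in> borel_measurable M"
  using sets_F_subset[of a] measurable_sets[of f "F a" borel] by (intro measurableI) auto

lemma W_measurable_F: "r \<in> {1..d} \<Longrightarrow> 0 \<le> s \<Longrightarrow> s \<le> a \<Longrightarrow> W r s \<in> borel_measurable (F a)"
  by (rule measurableI, simp, unfold sets_F space_F, rule sigma_sets.Basic) force

text \<open>
  On a grid that contains \<open>0\<close>, \<open>a\<close>, \<open>b\<close> and the times in \<open>S\<close>, the value of a component at a time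
  in \<open>S\<close> is almost surely the sum of its increments up to that time, because it vanishes at 0.
  Hence the cylinder event is almost surely determined by increments before \<open>a\<close>, which are
  independent of the last one.
\<close>

lemma indep_cylinder:
  assumes S: "finite S" "S \<subseteq> {0..a}" and ab: "0 \<le> a" "a < b" "b \<le> 1" and r0: "r0 \<in> {1..d}"
    and B: "\<And>r s. B r s \<in> sets borel" and C: "C \<in> sets borel"
  defines "A \<equiv> {\<omega> \<in> space M. \<forall>r\<in>{1..d}. \<forall>s\<in>S. W r s \<omega> \<in> B r s}"
    and "D \<equiv> {\<omega> \<in> space M. W r0 b \<omega> - W r0 a \<omega> \<in> C}"
  shows "prob (A \<inter> D) = prob A * prob D"
proof -
  have "finite (insert 0 (insert a (insert b S)))" using S by auto
  then obtain n \<tau> where \<tau>: "strict_mono_on {0..n::nat} \<tau>" and im: "\<tau> ` {0..n} = insert 0 (insert a (insert b S))"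
    by (rule finite_set_enumeration) auto
  have bounds: "\<tau> k \<in> {0..b}" if "k \<le> n" for k
  proof -
    have "\<tau> k \<in> insert 0 (insert a (insert b S))" unfolding im[symmetric] using that by auto
    then show ?thesis using S ab by auto
  qed
  have less: "\<tau> i < \<tau> j \<longleftrightarrow> i < j" if "i \<le> n" "j \<le> n" for i j
    using strict_mono_onD[OF \<tau>, of i j] strict_mono_onD[OF \<tau>, of j i] that
    by (metis atLeastAtMost_iff less_asym linorder_neqE_nat zero_le order_less_irrefl)
  have idx: "\<exists>k\<le>n. \<tau> k = s" if "s \<in> insert 0 (insert a (insert b S))" for s
    using that unfolding im[symmetric] by auto
  have \<tau>0: "\<tau> 0 = 0"
  proof -
    obtain k where k: "k \<le> n" "\<tau> k = 0" using idx[of 0] by auto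
    with less[of 0 k] bounds[of 0] show ?thesis by (cases "k = 0") auto
  qed
  have \<tau>n: "\<tau> n = b"
  proof -
    obtain k where k: "k \<le> n" "\<tau> k = b" using idx[of b] by auto
    with less[of k n] bounds[of n] show ?thesis by (cases "k = n") auto
  qed
  have lt_n: "k < n" if "k \<le> n" "\<tau> k \<le> a" for k
    using that less[of k n] \<tau>n ab by auto
  obtain ka where ka: "ka \<le> n" "\<tau> ka = a" using idx[of a] by auto
  obtain n' where n': "n = Suc n'" using lt_n[of ka] ka by (cases n) auto
  (* The grid points a and b are adjacent, so the increment from a to b is a single one. *)
  have \<tau>n': "\<tau> n' = a"
  proof -
    have "\<tau> n' \<in> insert 0 (insert a (insert b S))" unfolding im[symmetric] using n' by auto
    moreover have "\<tau> n' \<noteq> b" using less[of n' n] \<tau>n n' by auto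
    ultimately have "\<tau> n' \<le> a" using S ab by auto
    moreover have "\<not> \<tau> n' < \<tau> ka" using less[of n' ka] lt_n[of ka] ka n' by auto
    ultimately show ?thesis using ka by auto
  qed
  define inc where "inc = (\<lambda>(r, k) \<omega>. W r (\<tau> (Suc k)) \<omega> - W r (\<tau> k) \<omega>)"
  have "\<tau> ` {0..n} \<subseteq> {0..1}" using bounds ab by fastforce
  then have ind: "indep_vars (\<lambda>_. borel) inc ({1..d} \<times> {..<n})"
    using wiener \<tau> unfolding wiener_process_def inc_def by blast
  let ?A = "{1..d} \<times> {..<n'}" and ?B = "{(r0, n')}"
  let ?MA = "PiM ?A (\<lambda>_. borel :: real measure)" and ?MB = "PiM ?B (\<lambda>_. borel :: real measure)"
  have ind': "indep_var ?MA (\<lambda>\<omega>. \<lambda>i\<in>?A. inc i \<omega>) ?MB (\<lambda>\<omega>. \<lambda>i\<in>?B. inc i \<omega>)"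
    by (rule indep_var_restrict[OF ind]) (use r0 n' in auto)
  have rvA: "(\<lambda>\<omega>. \<lambda>i\<in>?A. inc i \<omega>) \<in> M \<rightarrow>\<^sub>M ?MA" and rvB: "(\<lambda>\<omega>. \<lambda>i\<in>?B. inc i \<omega>) \<in> M \<rightarrow>\<^sub>M ?MB"
    using ind' by (auto dest: indep_var_rv1 indep_var_rv2)
  have "\<forall>s\<in>S. \<exists>k\<le>n'. \<tau> k = s"
  proof
    fix s assume s: "s \<in> S"
    then obtain k where "k \<le> n" "\<tau> k = s" using idx[of s] by auto
    with lt_n[of k] s S n' show "\<exists>k\<le>n'. \<tau> k = s" by (intro exI[of _ k]) auto
  qed
  then obtain \<kappa> where \<kappa>: "\<And>s. s \<in> S \<Longrightarrow> \<kappa> s \<le> n'" "\<And>s. s \<in> S \<Longrightarrow> \<tau> (\<kappa> s) = s" by metis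
  define XA where "XA = {x \<in> space ?MA. \<forall>r\<in>{1..d}. \<forall>s\<in>S. (\<Sum>k<\<kappa> s. x (r, k)) \<in> B r s}"
  define XB where "XB = {x \<in> space ?MB. x (r0, n') \<in> C}"
  have XA: "XA \<in> sets ?MA"
  proof -
    have [measurable]: "(\<lambda>x. x (r, k)) \<in> borel_measurable ?MA" if "r \<in> {1..d}" "k < n'" for r k
      by (rule measurable_component_singleton) (use that in auto)
    have "(\<lambda>x. \<Sum>k<\<kappa> s. x (r, k)) \<in> borel_measurable ?MA" if "r \<in> {1..d}" "s \<in> S" for r s
      using \<kappa>(1)[OF that(2)] that by (intro borel_measurable_sum) auto
    then have "{x \<in> space ?MA. (\<Sum>k<\<kappa> s. x (r, k)) \<in> B r s} \<in> sets ?MA" if "r \<in> {1..d}" "s \<in> S" for r s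
      using measurable_sets[of _ ?MA borel "B r s"] that B by (simp add: vimage_def Int_def conj_commute)
    then show ?thesis unfolding XA_def using S(1)
      by (intro sets.sets_Collect_finite_All) (auto)
  qed
  have XB: "XB \<in> sets ?MB"
    using measurable_sets[OF measurable_component_singleton[of "(r0, n')" ?B "\<lambda>_. borel"] C]
    by (simp add: XB_def vimage_def Int_def conj_commute)
  have W0: "AE \<omega> in M. \<forall>r\<in>{1..d}. W r 0 \<omega> = 0"
    using wiener by (intro AE_finite_allI) (auto simp: wiener_process_def)
  have tele: "(\<Sum>k<\<kappa> s. (\<lambda>i\<in>?A. inc i \<omega>) (r, k)) = W r s \<omega> - W r 0 \<omega>" if "r \<in> {1..d}" "s \<in> S" for r s \<omega>
  proof -
    have "(\<Sum>k<\<kappa> s. (\<lambda>i\<in>?A. inc i \<omega>) (r, k)) = (\<Sum>k<\<kappa> s. W r (\<tau> (Suc k)) \<omega> - W r (\<tau> k) \<omega>)"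
      using \<kappa>(1)[OF that(2)] that by (intro sum.cong) (auto simp: inc_def)
    also have "\<dots> = W r s \<omega> - W r 0 \<omega>" using \<kappa>(2)[OF that(2)] \<tau>0 sum_lessThan_telescope[of "\<lambda>k. W r (\<tau> k) \<omega>" "\<kappa> s"] by simp
    finally show ?thesis .
  qed
  let ?P = "(\<lambda>\<omega>. \<lambda>i\<in>?A. inc i \<omega>) -` XA \<inter> space M" and ?Q = "(\<lambda>\<omega>. \<lambda>i\<in>?B. inc i \<omega>) -` XB \<inter> space M"
  have Q: "?Q = D"
  proof -
    have "(\<lambda>i\<in>?B. inc i \<omega>) \<in> XB \<longleftrightarrow> W r0 b \<omega> - W r0 a \<omega> \<in> C" if "\<omega> \<in> space M" for \<omega>
      using measurable_space[OF rvB that] \<tau>n \<tau>n' n' by (simp add: XB_def inc_def)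
    then show ?thesis by (auto simp: D_def)
  qed
  have PA: "AE \<omega> in M. \<omega> \<in> ?P \<longleftrightarrow> \<omega> \<in> A"
    using W0
  proof eventually_elim
    case (elim \<omega>)
    have "(\<lambda>i\<in>?A. inc i \<omega>) \<in> XA \<longleftrightarrow> (\<forall>r\<in>{1..d}. \<forall>s\<in>S. W r s \<omega> \<in> B r s)" if "\<omega> \<in> space M"
      using measurable_space[OF rvA that] elim tele by (simp add: XA_def)
    then show ?case by (auto simp: A_def)
  qed
  have meas: "?P \<in> sets M" "?Q \<in> sets M" "A \<in> sets M"
  proof -
    show "?P \<in> sets M" "?Q \<in> sets M" by (rule measurable_sets[OF rvA XA], rule measurable_sets[OF rvB XB])
    have "{\<omega> \<in> space M. W r s \<omega> \<in> B r s} \<in> sets M" if "r \<in> {1..d}" "s \<in> S" for r s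
    proof -
      have "0 \<le> s" "s \<le> 1" using that(2) S ab by auto
      then have "W r s -` B r s \<inter> space M \<in> sets M"
        using B by (intro measurable_sets[OF W_measurable[OF that(1)]]) auto
      then show ?thesis by (simp add: vimage_def Int_def conj_commute)
    qed
    then show "A \<in> sets M" unfolding A_def using S(1)
      by (intro sets.sets_Collect_finite_All) auto
  qed
  have "prob (?P \<inter> ?Q) = prob ?P * prob ?Q"
  proof -
    have "?P \<inter> ?Q = (\<lambda>\<omega>. (\<lambda>i\<in>?A. inc i \<omega>, \<lambda>i\<in>?B. inc i \<omega>)) -` (XA \<times> XB) \<inter> space M" by blast
    then show ?thesis using indep_varD[OF ind' XA XB] by simp
  qed
  moreover have "prob (?P \<inter> ?Q) = prob (A \<inter> D)"
    by (rule finite_measure_eq_AE) (use PA Q meas in auto)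
  moreover have "prob ?P = prob A"
    by (rule finite_measure_eq_AE) (use PA meas in auto)
  ultimately show ?thesis using Q by simp
qed

text \<open>
  Cylinder events together with the null events form an intersection-stable generator of the
  completed filtration, since intersecting with a null event gives a null event. Independence
  extends from the generator to the \<open>\<sigma>\<close>-algebra.
\<close>

lemma indep_set_F_increment:
  assumes ab: "0 \<le> a" "a < b" "b \<le> 1" and r: "r \<in> {1..d}"
  shows "indep_set (sets (F a)) {(\<lambda>\<omega>. W r b \<omega> - W r a \<omega>) -` C \<inter> space M | C. C \<in> sets borel}"
proof -
  define G where "G = {{\<omega> \<in> space M. \<forall>r\<in>{1..d}. \<forall>s\<in>S. W r s \<omega> \<in> B r s} | S B. finite S \<and> S \<subseteq> {0..a} \<and> (\<forall>r s. B r s \<in> sets borel)}"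
  let ?D = "{(\<lambda>\<omega>. W r b \<omega> - W r a \<omega>) -` C \<inter> space M | C. C \<in> sets borel}"
  have G_M: "G \<subseteq> sets M"
  proof
    fix A assume "A \<in> G"
    then obtain S B where A: "A = {\<omega> \<in> space M. \<forall>r\<in>{1..d}. \<forall>s\<in>S. W r s \<omega> \<in> B r s}" "finite S" "S \<subseteq> {0..a}" "\<forall>r s. B r s \<in> sets borel"
      unfolding G_def by blast
    have "{\<omega> \<in> space M. W r s \<omega> \<in> B r s} \<in> sets M" if "r \<in> {1..d}" "s \<in> S" for r s
    proof -
      have "0 \<le> s" "s \<le> 1" using that(2) A(3) ab by auto
      then have "W r s -` B r s \<inter> space M \<in> sets M"
        using A(4) by (intro measurable_sets[OF W_measurable[OF that(1)]]) auto
      then show ?thesis by (simp add: vimage_def Int_def conj_commute)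
    qed
    then show "A \<in> sets M" unfolding A(1) using A(2)
      by (intro sets.sets_Collect_finite_All) auto
  qed
  have [measurable]: "W r b \<in> borel_measurable M" "W r a \<in> borel_measurable M"
    using ab r by (auto intro!: W_measurable)
  have "(\<lambda>\<omega>. W r b \<omega> - W r a \<omega>) -` C \<inter> space M \<in> sets M" if "C \<in> sets borel" for C
    using that by (intro measurable_sets[where A=borel]) auto
  then have D_M: "?D \<subseteq> sets M" by blast
  have stable_G: "A \<inter> A' \<in> G" if AG: "A \<in> G" "A' \<in> G" for A A'
  proof -
    obtain S B where A: "A = {\<omega> \<in> space M. \<forall>r\<in>{1..d}. \<forall>s\<in>S. W r s \<omega> \<in> B r s}" "finite S" "S \<subseteq> {0..a}" "\<forall>r s. B r s \<in> sets borel"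
      using AG unfolding G_def by blast
    obtain S' B' where A': "A' = {\<omega> \<in> space M. \<forall>r\<in>{1..d}. \<forall>s\<in>S'. W r s \<omega> \<in> B' r s}" "finite S'" "S' \<subseteq> {0..a}" "\<forall>r s. B' r s \<in> sets borel"
      using AG unfolding G_def by blast
    let ?B = "\<lambda>r s. (if s \<in> S then B r s else UNIV) \<inter> (if s \<in> S' then B' r s else UNIV)"
    have "A \<inter> A' = {\<omega> \<in> space M. \<forall>r\<in>{1..d}. \<forall>s\<in>S \<union> S'. W r s \<omega> \<in> ?B r s}"
      unfolding A(1) A'(1) by auto
    then show ?thesis unfolding G_def using A A' by (intro CollectI exI[of _ "S \<union> S'"] exI[of _ ?B]) auto
  qed
  have "indep_set (G \<union> null_sets M) ?D"
  proof (rule indep_setI)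
    show "G \<union> null_sets M \<subseteq> events" using G_M by auto
    show "?D \<subseteq> events" by (rule D_M)
  next
    fix A D assume A: "A \<in> G \<union> null_sets M" and D: "D \<in> ?D"
    show "prob (A \<inter> D) = prob A * prob D"
      using A
    proof
      assume "A \<in> G"
      then obtain S B where A: "A = {\<omega> \<in> space M. \<forall>r\<in>{1..d}. \<forall>s\<in>S. W r s \<omega> \<in> B r s}" "finite S" "S \<subseteq> {0..a}" "\<forall>r s. B r s \<in> sets borel"
        unfolding G_def by blast
      obtain C where C: "D = {\<omega> \<in> space M. W r b \<omega> - W r a \<omega> \<in> C}" "C \<in> sets borel" using D by blast
      show ?thesis unfolding A(1) C(1)
        by (rule indep_cylinder[OF A(2,3) ab r]) (use A C in auto)
    next
      assume "A \<in> null_sets M"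
      moreover from this have "A \<inter> D \<in> null_sets M" using D D_M by (intro null_set_Int2) blast+
      ultimately show ?thesis by (simp add: measure_eq_0_null_sets)
    qed
  qed
  moreover have "Int_stable (G \<union> null_sets M)"
  proof (rule Int_stableI)
    fix A A' assume "A \<in> G \<union> null_sets M" "A' \<in> G \<union> null_sets M"
    then show "A \<inter> A' \<in> G \<union> null_sets M"
      using stable_G[of A A'] G_M null_set_Int1[of A' M A] null_set_Int2[of A M A'] by blast
  qed
  moreover have "Int_stable ?D"
  proof (rule Int_stableI, clarify)
    fix C C' :: "real set" assume "C \<in> sets borel" "C' \<in> sets borel"
    then show "\<exists>C''. ((\<lambda>\<omega>. W r b \<omega> - W r a \<omega>) -` C \<inter> space M) \<inter> ((\<lambda>\<omega>. W r b \<omega> - W r a \<omega>) -` C' \<inter> space M) = (\<lambda>\<omega>. W r b \<omega> - W r a \<omega>) -` C'' \<inter> space M \<and> C'' \<in> sets borel"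
      by (intro exI[of _ "C \<inter> C'"]) auto
  qed
  ultimately have "indep_set (sigma_sets (space M) (G \<union> null_sets M)) (sigma_sets (space M) ?D)"
    by (rule indep_set_sigma_sets)
  moreover have "sets (F a) \<subseteq> sigma_sets (space M) (G \<union> null_sets M)"
    unfolding sets_F
  proof (rule sigma_sets_mono, safe)
    fix r s and B :: "real set" assume rs: "r \<in> {1..d}" "s \<in> {0..a}" "B \<in> sets borel"
    have "W r s -` B \<inter> space M = {\<omega> \<in> space M. \<forall>r'\<in>{1..d}. \<forall>s'\<in>{s}. W r' s' \<omega> \<in> (if r' = r then B else UNIV)}"
      using rs by auto
    then have "W r s -` B \<inter> space M \<in> G" unfolding G_def using rs
      by (intro CollectI exI[of _ "{s}"] exI[of _ "\<lambda>r' s'. if r' = r then B else UNIV"]) auto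
    then show "W r s -` B \<inter> space M \<in> sigma_sets (space M) (G \<union> null_sets M)" by auto
  qed auto
  ultimately show ?thesis
    unfolding indep_set_def by (elim indep_sets_mono_sets) (auto split: bool.split)
qed

lemma indep_var_F_increment:
  assumes ab: "0 \<le> a" "a < b" "b \<le> 1" and r: "r \<in> {1..d}" and \<eta>: "\<eta> \<in> borel_measurable (F a)"
  shows "indep_var borel \<eta> borel (\<lambda>\<omega>. W r b \<omega> - W r a \<omega>)"
proof -
  have [measurable]: "W r b \<in> borel_measurable M" "W r a \<in> borel_measurable M" "\<eta> \<in> borel_measurable M"
    using ab r \<eta> by (auto intro!: W_measurable measurable_F[OF \<eta>])
  let ?E = "{\<eta> -` B \<inter> space M | B. B \<in> sets borel}"
  let ?D = "{(\<lambda>\<omega>. W r b \<omega> - W r a \<omega>) -` C \<inter> space M | C. C \<in> sets borel}"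
  have "indep_set ?E ?D"
    using indep_set_F_increment[OF ab r] measurable_sets[OF \<eta>]
    unfolding indep_set_def by (elim indep_sets_mono_sets) (auto split: bool.split)
  moreover have "Int_stable {f -` B \<inter> space M | B. B \<in> sets borel}" for f :: "'a \<Rightarrow> real"
  proof (rule Int_stableI, clarify)
    fix B B' :: "real set" assume "B \<in> sets borel" "B' \<in> sets borel"
    then show "\<exists>B''. (f -` B \<inter> space M) \<inter> (f -` B' \<inter> space M) = f -` B'' \<inter> space M \<and> B'' \<in> sets borel"
      by (intro exI[of _ "B \<inter> B'"]) auto
  qed
  ultimately have "indep_set (sigma_sets (space M) ?E) (sigma_sets (space M) ?D)"
    by (intro indep_set_sigma_sets)
  then show ?thesis unfolding indep_var_eq by simp
qed

lemma
  assumes ab: "0 \<le> a" "a \<le> b" "b \<le> 1" and r: "r \<in> {1..d}"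
  shows integrable_increment_power: "integrable M (\<lambda>\<omega>. (W r b \<omega> - W r a \<omega>) ^ k)" (is ?A)
    and expectation_increment: "expectation (\<lambda>\<omega>. W r b \<omega> - W r a \<omega>) = 0" (is ?B)
    and expectation_increment_power2: "expectation (\<lambda>\<omega>. (W r b \<omega> - W r a \<omega>)\<^sup>2) = b - a" (is ?C)
    and expectation_increment_power4: "expectation (\<lambda>\<omega>. (W r b \<omega> - W r a \<omega>) ^ 4) = 3 * (b - a)\<^sup>2" (is ?D)
    and expectation_increment_power3: "expectation (\<lambda>\<omega>. (W r b \<omega> - W r a \<omega>) ^ 3) = 0" (is ?E)
proof -
  have *: "?A \<and> ?B \<and> ?C \<and> ?D \<and> ?E"
  proof (cases "a = b")
    case True
    then show ?thesis by (cases k) auto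
  next
    case False
    then have D: "distributed M lborel (\<lambda>\<omega>. W r b \<omega> - W r a \<omega>) (normal_density 0 (sqrt (b - a)))"
      using wiener ab r unfolding wiener_process_def by auto
    let ?s = "sqrt (b - a)"
    have s: "?s > 0" using False ab by simp
    have I: "expectation (\<lambda>\<omega>. (W r b \<omega> - W r a \<omega>) ^ k) = (\<integral>x. normal_density 0 ?s x * (x - 0) ^ k \<partial>lborel)" for k
      by (subst distributed_integral[OF D, symmetric]) auto
    show ?thesis
    proof (intro conjI)
      show ?A
        using distributed_integrable[OF D, of "\<lambda>x. x ^ k"] integrable_normal_moment[OF s, of 0 k] by simp
      show ?B
        using I[of 1] integral_normal_moment_odd[OF s, of 0 0] by simp
      show ?C
        using I[of 2] integral_normal_moment_even[OF s, of 0 1] ab by simp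
      show ?D
        using I[of 4] integral_normal_moment_even[OF s, of 0 2] ab by (simp add: fact_numeral power_divide)
      show ?E
        using I[of 3] integral_normal_moment_odd[OF s, of 0 1] by (simp add: numeral_3_eq_3)
    qed
  qed
  then show ?A ?B ?C ?D ?E by blast+
qed

text \<open>
  The martingale property of a component and of its square minus time, tested against \<open>\<eta>\<close>.
  Boundedness of \<open>\<eta>\<close> would be too restrictive: below, \<open>\<eta>\<close> contains earlier increments as factors.
\<close>

lemma
  assumes ab: "0 \<le> a" "a \<le> b" "b \<le> 1" and r: "r \<in> {1..d}"
    and \<eta>: "\<eta> \<in> borel_measurable (F a)" "integrable M \<eta>"
  shows integrable_F_increment: "integrable M (\<lambda>\<omega>. \<eta> \<omega> * (W r b \<omega> - W r a \<omega>))" (is ?A)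
    and expectation_F_increment: "expectation (\<lambda>\<omega>. \<eta> \<omega> * (W r b \<omega> - W r a \<omega>)) = 0" (is ?B)
    and integrable_F_increment_power2: "integrable M (\<lambda>\<omega>. \<eta> \<omega> * (W r b \<omega> - W r a \<omega>)\<^sup>2)" (is ?C)
    and expectation_F_increment_power2: "expectation (\<lambda>\<omega>. \<eta> \<omega> * (W r b \<omega> - W r a \<omega>)\<^sup>2) = expectation \<eta> * (b - a)" (is ?D)
proof -
  have *: "?A \<and> ?B \<and> ?C \<and> ?D"
  proof (cases "a = b")
    case False
    then have ab': "a < b" using ab by simp
    note ind = indep_var_F_increment[OF ab(1) ab' ab(3) r \<eta>(1)]
    have ind2: "indep_var borel \<eta> borel (\<lambda>\<omega>. (W r b \<omega> - W r a \<omega>)\<^sup>2)"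
      using indep_var_compose[OF ind, of "\<lambda>x. x" borel "\<lambda>x. x\<^sup>2" borel] by (simp add: comp_def)
    show ?thesis
      using indep_var_lebesgue_integral[OF ind \<eta>(2)] indep_var_lebesgue_integral[OF ind2 \<eta>(2)]
        indep_var_integrable[OF ind \<eta>(2)] indep_var_integrable[OF ind2 \<eta>(2)]
        integrable_increment_power[OF ab r, of 1] integrable_increment_power[OF ab r, of 2]
        expectation_increment[OF ab r] expectation_increment_power2[OF ab r]
      by simp
  qed simp
  then show ?A ?B ?C ?D by blast+
qed

end

section \<open>The Ito isometry\<close>

text \<open>
  Half-open, so that the cells \<open>[\<tau> k, \<tau> (k + 1))\<close> of a partition of \<open>[0,1]\<close> cover the space
  exactly and a step function is determined by its values at the \<open>\<tau> k\<close>.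
\<close>

abbreviation \<U> :: "real measure" where
  "\<U> \<equiv> restrict_space lborel {0..<1}"

lemma space_unit_interval [simp]: "space \<U> = {0..<1}"
  by (simp add: space_restrict_space)

lemma prob_space_unit_interval: "prob_space \<U>"
  by (rule prob_spaceI) (simp add: emeasure_restrict_space)

interpretation unit_interval: prob_space \<U>
  by (rule prob_space_unit_interval)

lemma indicator_measurable_unit_interval [measurable]:
  "(indicator {a..<b} :: real \<Rightarrow> real) \<in> borel_measurable \<U>"
  by (rule measurable_restrict_space1) simp

lemma integral_unit_interval_indicator:
  assumes "0 \<le> a" "b \<le> 1"
  shows "(\<integral>s. indicator {a..<b} s \<partial>\<U>) = max 0 (b - a)"
proof -
  have "(\<integral>s. indicator {a..<b} s \<partial>\<U>) = measure \<U> {a..<b}"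
    using assms by (simp add: Int_absorb2)
  also have "\<dots> = measure lborel {a..<b}"
    using assms by (subst measure_restrict_space) auto
  also have "\<dots> = max 0 (b - a)" by (cases "a \<le> b") (auto simp: max_def)
  finally show ?thesis .
qed

lemma integrable_bounded_mult:
  fixes \<xi> f :: "'a \<Rightarrow> real"
  assumes [measurable]: "\<xi> \<in> borel_measurable M" and C: "\<And>\<omega>. \<omega> \<in> space M \<Longrightarrow> \<bar>\<xi> \<omega>\<bar> \<le> C" and f: "integrable M f"
  shows "integrable M (\<lambda>\<omega>. \<xi> \<omega> * f \<omega>)"
proof (rule Bochner_Integration.integrable_bound[of _ "\<lambda>\<omega>. C * \<bar>f \<omega>\<bar>"])
  show "AE \<omega> in M. norm (\<xi> \<omega> * f \<omega>) \<le> norm (C * \<bar>f \<omega>\<bar>)"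
  proof (rule AE_I2)
    fix \<omega> assume "\<omega> \<in> space M"
    from C[OF this] have "\<bar>\<xi> \<omega>\<bar> \<le> \<bar>C\<bar>" by linarith
    then show "norm (\<xi> \<omega> * f \<omega>) \<le> norm (C * \<bar>f \<omega>\<bar>)" by (simp add: abs_mult mult_right_mono)
  qed
qed (use f in auto)

context wiener begin

text \<open>
  With \<open>a \<le> a'\<close>, both increments are cut at \<open>a'\<close> and at \<open>min b b'\<close>. Products of increments over
  disjoint intervals have mean 0, because the later increment is independent of all other factors;
  only the square of the common increment remains.
\<close>

lemma increment_product_aux:
  assumes ab: "0 \<le> a" "a \<le> b" "b \<le> 1" and ab': "a' \<le> b'" "b' \<le> 1" and aa': "a \<le> a'" and r: "r \<in> {1..d}"
    and \<xi>: "\<xi> \<in> borel_measurable (F a)" "\<And>\<omega>. \<omega> \<in> space M \<Longrightarrow> \<bar>\<xi> \<omega>\<bar> \<le> C"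
    and \<xi>': "\<xi>' \<in> borel_measurable (F a')" "\<And>\<omega>. \<omega> \<in> space M \<Longrightarrow> \<bar>\<xi>' \<omega>\<bar> \<le> C'"
  shows "has_bochner_integral M (\<lambda>\<omega>. (\<xi> \<omega> * (W r b \<omega> - W r a \<omega>)) * (\<xi>' \<omega> * (W r b' \<omega> - W r a' \<omega>)))
      (expectation (\<lambda>\<omega>. \<xi> \<omega> * \<xi>' \<omega>) * max 0 (min b b' - max a a'))"
proof -
  define \<eta> where "\<eta> \<omega> = \<xi> \<omega> * \<xi>' \<omega>" for \<omega>
  have \<xi>a: "\<xi> \<in> borel_measurable (F a')" by (rule measurable_F_mono[OF \<xi>(1) aa'])
  have \<eta>F: "\<eta> \<in> borel_measurable (F a')" unfolding \<eta>_def using \<xi>a \<xi>'(1) by measurable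
  have \<eta>b: "\<bar>\<eta> \<omega>\<bar> \<le> C * C'" if "\<omega> \<in> space M" for \<omega>
  proof -
    have "\<bar>\<xi> \<omega>\<bar> * \<bar>\<xi>' \<omega>\<bar> \<le> C * C'" using \<xi>(2)[OF that] \<xi>'(2)[OF that] by (intro mult_mono) auto
    then show ?thesis by (simp add: \<eta>_def abs_mult)
  qed
  have a'0: "0 \<le> a'" "a' \<le> 1" using ab aa' ab' by auto
  have \<eta>M: "\<eta> \<in> borel_measurable M" by (rule measurable_F[OF \<eta>F a'0])
  have \<eta>i: "integrable M (\<lambda>\<omega>. \<eta> \<omega> * (W r v \<omega> - W r u \<omega>))" if "0 \<le> u" "u \<le> v" "v \<le> 1" for u v
    using integrable_bounded_mult[OF \<eta>M \<eta>b integrable_increment_power[OF that r, of 1]] by simp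
  have \<eta>0: "integrable M \<eta>"
    using integrable_bounded_mult[OF \<eta>M \<eta>b, of "\<lambda>_. 1"] by simp
  have \<eta>W: "(\<lambda>\<omega>. \<eta> \<omega> * (W r v \<omega> - W r u \<omega>)) \<in> borel_measurable (F c)"
    if "0 \<le> u" "u \<le> v" "v \<le> c" "a' \<le> c" for u v c
  proof -
    have [measurable]: "\<eta> \<in> borel_measurable (F c)" "W r u \<in> borel_measurable (F c)" "W r v \<in> borel_measurable (F c)"
      using that by (auto intro: measurable_F_mono[OF \<eta>F] W_measurable_F[OF r])
    show ?thesis by measurable
  qed
  have F1: "has_bochner_integral M (\<lambda>\<omega>. (\<eta> \<omega> * (W r v \<omega> - W r u \<omega>)) * (W r z \<omega> - W r c \<omega>)) 0"
    if "0 \<le> u" "u \<le> v" "v \<le> c" "a' \<le> c" "c \<le> z" "z \<le> 1" for u v c z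
    using integrable_F_increment[OF _ that(5,6) r \<eta>W[OF that(1-4)] \<eta>i]
      expectation_F_increment[OF _ that(5,6) r \<eta>W[OF that(1-4)] \<eta>i] that a'0
    by (simp add: has_bochner_integral_iff)
  show ?thesis
  proof (cases "b \<le> a'")
    case True
    have "max 0 (min b b' - max a a') = 0" using True aa' by (simp add: max_def min_def)
    then show ?thesis using F1[of a b a' b'] True ab ab' by (simp add: \<eta>_def mult_ac)
  next
    case False
    define c where "c = min b b'"
    have c: "a' \<le> c" "c \<le> b" "c \<le> b'" "c = b \<or> c = b'" "c \<le> 1" "0 \<le> c" using False ab' a'0 ab unfolding c_def by auto
    have F2: "has_bochner_integral M (\<lambda>\<omega>. \<eta> \<omega> * (W r c \<omega> - W r a' \<omega>)\<^sup>2) (expectation \<eta> * (c - a'))"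
      using integrable_F_increment_power2[OF a'0(1) c(1,5) r \<eta>F \<eta>0]
        expectation_F_increment_power2[OF a'0(1) c(1,5) r \<eta>F \<eta>0] by (simp add: has_bochner_integral_iff)
    have "has_bochner_integral M (\<lambda>\<omega>. (\<eta> \<omega> * (W r a' \<omega> - W r a \<omega>)) * (W r b' \<omega> - W r a' \<omega>)
      + \<eta> \<omega> * (W r c \<omega> - W r a' \<omega>)\<^sup>2
      + (\<eta> \<omega> * (W r c \<omega> - W r a' \<omega>)) * (W r b' \<omega> - W r c \<omega>)
      + (\<eta> \<omega> * (W r c \<omega> - W r a' \<omega>)) * (W r b \<omega> - W r c \<omega>)) (0 + expectation \<eta> * (c - a') + 0 + 0)"
      using ab ab' aa' a'0 c by (intro has_bochner_integral_add F1 F2) auto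
    moreover have "(\<eta> \<omega> * (W r a' \<omega> - W r a \<omega>)) * (W r b' \<omega> - W r a' \<omega>)
      + \<eta> \<omega> * (W r c \<omega> - W r a' \<omega>)\<^sup>2
      + (\<eta> \<omega> * (W r c \<omega> - W r a' \<omega>)) * (W r b' \<omega> - W r c \<omega>)
      + (\<eta> \<omega> * (W r c \<omega> - W r a' \<omega>)) * (W r b \<omega> - W r c \<omega>) =
      (\<xi> \<omega> * (W r b \<omega> - W r a \<omega>)) * (\<xi>' \<omega> * (W r b' \<omega> - W r a' \<omega>))" for \<omega>
      using c(4) by (auto simp: \<eta>_def power2_eq_square algebra_simps)
    moreover have "max 0 (min b b' - max a a') = c - a'" using aa' c by (simp add: c_def[symmetric])
    ultimately show ?thesis by (simp add: \<eta>_def[abs_def])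
  qed
qed

lemma increment_product:
  assumes ab: "0 \<le> a" "a \<le> b" "b \<le> 1" and ab': "0 \<le> a'" "a' \<le> b'" "b' \<le> 1" and r: "r \<in> {1..d}"
    and \<xi>: "\<xi> \<in> borel_measurable (F a)" "\<And>\<omega>. \<omega> \<in> space M \<Longrightarrow> \<bar>\<xi> \<omega>\<bar> \<le> C"
    and \<xi>': "\<xi>' \<in> borel_measurable (F a')" "\<And>\<omega>. \<omega> \<in> space M \<Longrightarrow> \<bar>\<xi>' \<omega>\<bar> \<le> C'"
  shows "has_bochner_integral M (\<lambda>\<omega>. (\<xi> \<omega> * (W r b \<omega> - W r a \<omega>)) * (\<xi>' \<omega> * (W r b' \<omega> - W r a' \<omega>)))
      (expectation (\<lambda>\<omega>. \<xi> \<omega> * \<xi>' \<omega>) * max 0 (min b b' - max a a'))"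
proof (cases "a \<le> a'")
  case True
  then show ?thesis using assms by (intro increment_product_aux) auto
next
  case False
  then have "a' \<le> a" by simp
  from increment_product_aux[OF ab' ab(2,3) this r \<xi>' \<xi>] show ?thesis
    by (simp add: mult.commute min.commute max.commute)
qed

text \<open>
  Pairs of a stochastic integral and its integrand, generated from single intervals. Since the
  intervals may overlap arbitrarily, integrals over different partitions can be added without
  passing to a common refinement. Being a relation, it also covers integrands that agree only at
  the times in \<open>[0,1)\<close>.
\<close>

inductive ito_simple :: "nat \<Rightarrow> ('a \<Rightarrow> real) \<Rightarrow> (real \<Rightarrow> 'a \<Rightarrow> real) \<Rightarrow> bool" for r where
  piece: "0 \<le> a \<Longrightarrow> a \<le> b \<Longrightarrow> b \<le> 1 \<Longrightarrow> \<xi> \<in> borel_measurable (F a) \<Longrightarrow> (\<And>\<omega>. \<omega> \<in> space M \<Longrightarrow> \<bar>\<xi> \<omega>\<bar> \<le> C) \<Longrightarrow>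
    ito_simple r (\<lambda>\<omega>. \<xi> \<omega> * (W r b \<omega> - W r a \<omega>)) (\<lambda>s \<omega>. \<xi> \<omega> * indicator {a..<b} s)"
| add: "ito_simple r \<Phi> \<phi> \<Longrightarrow> ito_simple r \<Psi> \<psi> \<Longrightarrow> ito_simple r (\<lambda>\<omega>. \<Phi> \<omega> + \<Psi> \<omega>) (\<lambda>s \<omega>. \<phi> s \<omega> + \<psi> s \<omega>)"
| eq_on: "ito_simple r \<Phi> \<phi> \<Longrightarrow> (\<And>s \<omega>. 0 \<le> s \<Longrightarrow> s < 1 \<Longrightarrow> \<omega> \<in> space M \<Longrightarrow> \<psi> s \<omega> = \<phi> s \<omega>) \<Longrightarrow> ito_simple r \<Phi> \<psi>"

lemma ito_simple_zero: "ito_simple r (\<lambda>_. 0) (\<lambda>_ _. 0)"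
  using ito_simple.piece[of 0 0 "\<lambda>_. 0" 0 r] by simp

lemma ito_simple_sum:
  "(\<And>k. k \<in> K \<Longrightarrow> ito_simple r (\<Phi> k) (\<phi> k)) \<Longrightarrow>
    ito_simple r (\<lambda>\<omega>. \<Sum>k\<in>K. \<Phi> k \<omega>) (\<lambda>s \<omega>. \<Sum>k\<in>K. \<phi> k s \<omega>)"
proof (induction K rule: infinite_finite_induct)
  case (insert k K)
  then have "ito_simple r (\<lambda>\<omega>. \<Phi> k \<omega> + (\<Sum>k\<in>K. \<Phi> k \<omega>)) (\<lambda>s \<omega>. \<phi> k s \<omega> + (\<Sum>k\<in>K. \<phi> k s \<omega>))"
    by (intro ito_simple.add) simp_all
  with insert(1,2) show ?case by simp
qed (simp_all add: ito_simple_zero)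

lemma ito_simple_cmult: "ito_simple r \<Phi> \<phi> \<Longrightarrow> ito_simple r (\<lambda>\<omega>. c * \<Phi> \<omega>) (\<lambda>s \<omega>. c * \<phi> s \<omega>)"
proof (induction rule: ito_simple.induct)
  case (piece a b \<xi> C)
  have "ito_simple r (\<lambda>\<omega>. (c * \<xi> \<omega>) * (W r b \<omega> - W r a \<omega>)) (\<lambda>s \<omega>. (c * \<xi> \<omega>) * indicator {a..<b} s)"
  proof (rule ito_simple.piece[where C="\<bar>c\<bar> * C"])
    show "\<bar>c * \<xi> \<omega>\<bar> \<le> \<bar>c\<bar> * C" if "\<omega> \<in> space M" for \<omega>
      using piece(5)[OF that] by (simp add: abs_mult mult_left_mono)
  qed (use piece in auto)
  then show ?case by (simp add: mult.assoc)
next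
  case (add \<Phi> \<phi> \<Psi> \<psi>)
  then show ?case by (simp add: distrib_left ito_simple.add)
next
  case (eq_on \<Phi> \<phi> \<psi>)
  then show ?case by (intro ito_simple.eq_on[OF eq_on(3)]) auto
qed

lemma ito_simple_diff:
  assumes "ito_simple r \<Phi> \<phi>" "ito_simple r \<Psi> \<psi>"
  shows "ito_simple r (\<lambda>\<omega>. \<Phi> \<omega> - \<Psi> \<omega>) (\<lambda>s \<omega>. \<phi> s \<omega> - \<psi> s \<omega>)"
  using ito_simple.add[OF assms(1) ito_simple_cmult[OF assms(2), of "-1"]] by simp

text \<open>
  The polarised isometry. Unlike the isometry for norms it is additive in each of the two pairs,
  so that it can be proved by induction on one pair at a time; integrability is included because
  additivity needs it.
\<close>

definition isometric :: "('a \<Rightarrow> real) \<Rightarrow> (real \<Rightarrow> 'a \<Rightarrow> real) \<Rightarrow> ('a \<Rightarrow> real) \<Rightarrow> (real \<Rightarrow> 'a \<Rightarrow> real) \<Rightarrow> bool" where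
  "isometric \<Phi> \<phi> \<Psi> \<psi> \<longleftrightarrow> (\<forall>\<omega>\<in>space M. integrable \<U> (\<lambda>s. \<phi> s \<omega> * \<psi> s \<omega>)) \<and>
     (\<exists>v. has_bochner_integral M (\<lambda>\<omega>. \<Phi> \<omega> * \<Psi> \<omega>) v \<and>
       has_bochner_integral M (\<lambda>\<omega>. \<integral>s. \<phi> s \<omega> * \<psi> s \<omega> \<partial>\<U>) v)"

lemma isometric_add:
  assumes "isometric \<Phi> \<phi> \<Psi> \<psi>" "isometric \<Phi> \<phi> \<Psi>' \<psi>'"
  shows "isometric \<Phi> \<phi> (\<lambda>\<omega>. \<Psi> \<omega> + \<Psi>' \<omega>) (\<lambda>s \<omega>. \<psi> s \<omega> + \<psi>' s \<omega>)"
proof -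
  from assms obtain v v' where v: "has_bochner_integral M (\<lambda>\<omega>. \<Phi> \<omega> * \<Psi> \<omega>) v"
      "has_bochner_integral M (\<lambda>\<omega>. \<integral>s. \<phi> s \<omega> * \<psi> s \<omega> \<partial>\<U>) v"
      "has_bochner_integral M (\<lambda>\<omega>. \<Phi> \<omega> * \<Psi>' \<omega>) v'"
      "has_bochner_integral M (\<lambda>\<omega>. \<integral>s. \<phi> s \<omega> * \<psi>' s \<omega> \<partial>\<U>) v'"
    and i: "\<And>\<omega>. \<omega> \<in> space M \<Longrightarrow> integrable \<U> (\<lambda>s. \<phi> s \<omega> * \<psi> s \<omega>)"
      "\<And>\<omega>. \<omega> \<in> space M \<Longrightarrow> integrable \<U> (\<lambda>s. \<phi> s \<omega> * \<psi>' s \<omega>)"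
    unfolding isometric_def by blast
  have "has_bochner_integral M (\<lambda>\<omega>. \<integral>s. \<phi> s \<omega> * (\<psi> s \<omega> + \<psi>' s \<omega>) \<partial>\<U>) (v + v')"
    using has_bochner_integral_add[OF v(2,4)] i
    by (rule_tac has_bochner_integral_cong[THEN iffD1, rotated -1]) (auto simp: distrib_left)
  moreover have "has_bochner_integral M (\<lambda>\<omega>. \<Phi> \<omega> * (\<Psi> \<omega> + \<Psi>' \<omega>)) (v + v')"
    using has_bochner_integral_add[OF v(1,3)] by (simp add: distrib_left)
  ultimately show ?thesis unfolding isometric_def using i by (auto simp: distrib_left)
qed

lemma isometric_cong:
  assumes "isometric \<Phi> \<phi> \<Psi> \<psi>" and eq: "\<And>s \<omega>. 0 \<le> s \<Longrightarrow> s < 1 \<Longrightarrow> \<omega> \<in> space M \<Longrightarrow> \<psi>' s \<omega> = \<psi> s \<omega>"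
  shows "isometric \<Phi> \<phi> \<Psi> \<psi>'"
proof -
  have "integrable \<U> (\<lambda>s. \<phi> s \<omega> * \<psi>' s \<omega>) \<longleftrightarrow> integrable \<U> (\<lambda>s. \<phi> s \<omega> * \<psi> s \<omega>)"
    "(\<integral>s. \<phi> s \<omega> * \<psi>' s \<omega> \<partial>\<U>) = (\<integral>s. \<phi> s \<omega> * \<psi> s \<omega> \<partial>\<U>)" if "\<omega> \<in> space M" for \<omega>
    by (intro Bochner_Integration.integrable_cong Bochner_Integration.integral_cong; use eq that in simp)+
  then show ?thesis using assms(1) unfolding isometric_def
    by (simp cong: has_bochner_integral_cong)
qed

lemma isometric_commute: "isometric \<Phi> \<phi> \<Psi> \<psi> \<Longrightarrow> isometric \<Psi> \<psi> \<Phi> \<phi>"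
  unfolding isometric_def by (simp add: mult.commute)

lemma isometric_piece:
  assumes r: "r \<in> {1..d}" and ab: "0 \<le> a" "a \<le> b" "b \<le> 1"
    and \<xi>: "\<xi> \<in> borel_measurable (F a)" "\<And>\<omega>. \<omega> \<in> space M \<Longrightarrow> \<bar>\<xi> \<omega>\<bar> \<le> C"
    and \<Psi>: "ito_simple r \<Psi> \<psi>"
  shows "isometric (\<lambda>\<omega>. \<xi> \<omega> * (W r b \<omega> - W r a \<omega>)) (\<lambda>s \<omega>. \<xi> \<omega> * indicator {a..<b} s) \<Psi> \<psi>"
  using \<Psi>
proof (induction rule: ito_simple.induct)
  case (piece a' b' \<xi>' C')
  have \<xi>M: "\<xi> \<in> borel_measurable M" "\<xi>' \<in> borel_measurable M"
    using ab piece(1-3) by (auto intro: measurable_F[OF \<xi>(1)] measurable_F[OF piece(4)])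
  have eq: "(\<xi> \<omega> * indicator {a..<b} s) * (\<xi>' \<omega> * indicator {a'..<b'} s) =
      \<xi> \<omega> * \<xi>' \<omega> * indicator {max a a'..<min b b'} s" for s :: real and \<omega>
    by (auto split: split_indicator)
  have \<xi>'i: "integrable M \<xi>'"
    using integrable_bounded_mult[OF \<xi>M(2) piece(5), of "\<lambda>_. 1"] by simp
  have "integrable M (\<lambda>\<omega>. \<xi> \<omega> * \<xi>' \<omega>)"
    by (rule integrable_bounded_mult[OF \<xi>M(1) \<xi>(2) \<xi>'i])
  moreover have "(\<integral>s. (\<xi> \<omega> * indicator {a..<b} s) * (\<xi>' \<omega> * indicator {a'..<b'} s) \<partial>\<U>) =
      \<xi> \<omega> * \<xi>' \<omega> * max 0 (min b b' - max a a')" for \<omega>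
  proof -
    have "(\<integral>s. indicator {max a a'..<min b b'} s \<partial>\<U>) = max 0 (min b b' - max a a')"
      by (rule integral_unit_interval_indicator) (use ab piece(1-3) in auto)
    then show ?thesis unfolding eq by (simp only: integral_mult_right_zero)
  qed
  ultimately have "has_bochner_integral M
      (\<lambda>\<omega>. \<integral>s. (\<xi> \<omega> * indicator {a..<b} s) * (\<xi>' \<omega> * indicator {a'..<b'} s) \<partial>\<U>)
      (expectation (\<lambda>\<omega>. \<xi> \<omega> * \<xi>' \<omega>) * max 0 (min b b' - max a a'))"
    by (simp add: has_bochner_integral_iff)
  moreover have "has_bochner_integral M (\<lambda>\<omega>. (\<xi> \<omega> * (W r b \<omega> - W r a \<omega>)) * (\<xi>' \<omega> * (W r b' \<omega> - W r a' \<omega>)))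
      (expectation (\<lambda>\<omega>. \<xi> \<omega> * \<xi>' \<omega>) * max 0 (min b b' - max a a'))"
    by (rule increment_product[OF ab piece(1-3) r \<xi> piece(4,5)])
  moreover have "integrable \<U> (\<lambda>s. (\<xi> \<omega> * indicator {a..<b} s) * (\<xi>' \<omega> * indicator {a'..<b'} s))" for \<omega>
    unfolding eq by (intro integrable_mult_right impI unit_interval.integrable_const_bound[where B=1]
        AE_I2 indicator_measurable_unit_interval) (simp add: indicator_def)
  ultimately show ?case unfolding isometric_def by (intro conjI ballI exI)
next
  case (add \<Phi> \<phi> \<Psi> \<psi>)
  show ?case by (rule isometric_add[OF add(3,4)])
next
  case (eq_on \<Phi> \<phi> \<psi>)
  show ?case by (rule isometric_cong[OF eq_on(3,2)])
qed

lemma isometric_ito_simple: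
  assumes r: "r \<in> {1..d}" and "ito_simple r \<Phi> \<phi>" "ito_simple r \<Psi> \<psi>"
  shows "isometric \<Phi> \<phi> \<Psi> \<psi>"
  using assms(2)
proof (induction rule: ito_simple.induct)
  case (piece a b \<xi> C)
  then show ?case using r assms(3) by (intro isometric_piece)
next
  case (add \<Phi> \<phi> \<Psi> \<psi>)
  show ?case by (rule isometric_commute[OF isometric_add[OF add(3,4)[THEN isometric_commute]]])
next
  case (eq_on \<Phi> \<phi> \<psi>)
  show ?case by (rule isometric_commute[OF isometric_cong[OF isometric_commute[OF eq_on(3)] eq_on(2)]])
qed

theorem ito_isometry:
  assumes r: "r \<in> {1..d}" and \<Phi>: "ito_simple r \<Phi> \<phi>"
  shows "(\<integral>\<^sup>+ \<omega>. ennreal ((\<Phi> \<omega>)\<^sup>2) \<partial>M) = (\<integral>\<^sup>+ \<omega>. (\<integral>\<^sup>+ s. ennreal ((\<phi> s \<omega>)\<^sup>2) \<partial>\<U>) \<partial>M)"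
proof -
  from isometric_ito_simple[OF r \<Phi> \<Phi>] obtain v where v: "has_bochner_integral M (\<lambda>\<omega>. (\<Phi> \<omega>)\<^sup>2) v"
      "has_bochner_integral M (\<lambda>\<omega>. \<integral>s. (\<phi> s \<omega>)\<^sup>2 \<partial>\<U>) v"
    and i: "\<And>\<omega>. \<omega> \<in> space M \<Longrightarrow> integrable \<U> (\<lambda>s. (\<phi> s \<omega>)\<^sup>2)"
    unfolding isometric_def power2_eq_square by blast
  have "(\<integral>\<^sup>+ \<omega>. ennreal ((\<Phi> \<omega>)\<^sup>2) \<partial>M) = ennreal v"
    using v(1) by (simp add: has_bochner_integral_iff nn_integral_eq_integral)
  also have "\<dots> = (\<integral>\<^sup>+ \<omega>. ennreal (\<integral>s. (\<phi> s \<omega>)\<^sup>2 \<partial>\<U>) \<partial>M)"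
    using v(2) by (simp add: has_bochner_integral_iff nn_integral_eq_integral)
  also have "\<dots> = (\<integral>\<^sup>+ \<omega>. (\<integral>\<^sup>+ s. ennreal ((\<phi> s \<omega>)\<^sup>2) \<partial>\<U>) \<partial>M)"
    using i by (intro nn_integral_cong) (simp add: nn_integral_eq_integral)
  finally show ?thesis .
qed

end

section \<open>Approximating Ito integrals by integrals of simple processes\<close>

definition partition :: "(nat \<Rightarrow> real) \<Rightarrow> nat \<Rightarrow> bool" where
  "partition \<tau> n \<longleftrightarrow> \<tau> 0 = 0 \<and> \<tau> n = 1 \<and> strict_mono_on {0..n} \<tau>"

lemma partition_less_iff: "partition \<tau> n \<Longrightarrow> i \<le> n \<Longrightarrow> j \<le> n \<Longrightarrow> \<tau> i < \<tau> j \<longleftrightarrow> i < j"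
  unfolding partition_def
  by (metis atLeastAtMost_iff less_asym linorder_neqE_nat zero_le order_less_irrefl strict_mono_onD)

lemma partition_le_iff: "partition \<tau> n \<Longrightarrow> i \<le> n \<Longrightarrow> j \<le> n \<Longrightarrow> \<tau> i \<le> \<tau> j \<longleftrightarrow> i \<le> j"
  using partition_less_iff[of \<tau> n j i] by (simp add: linorder_not_less[symmetric])

lemma partition_bounds: "partition \<tau> n \<Longrightarrow> i \<le> n \<Longrightarrow> 0 \<le> \<tau> i \<and> \<tau> i \<le> 1"
  using partition_le_iff[of \<tau> n 0 i] partition_le_iff[of \<tau> n i n] by (simp add: partition_def)

lemma partition_cell:
  assumes \<tau>: "partition \<tau> n" and s: "0 \<le> s" "s < 1"
  obtains k where "k < n" "\<tau> k \<le> s" "s < \<tau> (Suc k)"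
proof -
  define k where "k = (GREATEST k. k \<le> n \<and> \<tau> k \<le> s)"
  have 0: "0 \<le> n \<and> \<tau> 0 \<le> s" using \<tau> s by (simp add: partition_def)
  have k: "k \<le> n \<and> \<tau> k \<le> s" unfolding k_def
    by (rule GreatestI_nat[where P="\<lambda>k. k \<le> n \<and> \<tau> k \<le> s" and b=n, OF 0]) simp
  have "k \<noteq> n" using k \<tau> s by (auto simp: partition_def)
  with k have kn: "k < n" by simp
  have "\<not> \<tau> (Suc k) \<le> s"
  proof
    assume "\<tau> (Suc k) \<le> s"
    then have "Suc k \<le> k" unfolding k_def
      using kn by (intro Greatest_le_nat[where b=n]) (auto simp: k_def)
    then show False by simp
  qed
  with kn k show ?thesis by (intro that[of k]) auto
qed

lemma partition_sum_cell:
  fixes f :: "nat \<Rightarrow> real"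
  assumes \<tau>: "partition \<tau> n" and k: "k < n" "\<tau> k \<le> s" "s < \<tau> (Suc k)"
  shows "(\<Sum>i<n. f i * indicator {\<tau> i..<\<tau> (Suc i)} s) = f k"
proof -
  have "(\<Sum>i<n. f i * indicator {\<tau> i..<\<tau> (Suc i)} s) = (\<Sum>i<n. if i = k then f k else 0)"
  proof (rule sum.cong)
    fix i assume i: "i \<in> {..<n}"
    have "s \<notin> {\<tau> i..<\<tau> (Suc i)}" if "i \<noteq> k"
    proof (cases "i < k")
      case True
      then have "\<tau> (Suc i) \<le> \<tau> k" using partition_le_iff[OF \<tau>, of "Suc i" k] k i by simp
      then show ?thesis using k by simp
    next
      case False
      then have "\<tau> (Suc k) \<le> \<tau> i" using partition_le_iff[OF \<tau>, of "Suc k" i] k i that by simp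
      then show ?thesis using k by simp
    qed
    then show "f i * indicator {\<tau> i..<\<tau> (Suc i)} s = (if i = k then f k else 0)"
      using k by (cases "i = k") auto
  qed simp
  then show ?thesis using k by simp
qed

definition step_on :: "(nat \<Rightarrow> real) \<Rightarrow> nat \<Rightarrow> (real \<Rightarrow> 'b) \<Rightarrow> bool" where
  "step_on \<tau> n c \<longleftrightarrow> (\<forall>k<n. \<forall>s\<in>{\<tau> k..<\<tau> (Suc k)}. c s = c (\<tau> k))"

lemma step_on_eq_sum:
  fixes c :: "real \<Rightarrow> real"
  assumes \<tau>: "partition \<tau> n" and c: "step_on \<tau> n c" and s: "0 \<le> s" "s < 1"
  shows "c s = (\<Sum>k<n. c (\<tau> k) * indicator {\<tau> k..<\<tau> (Suc k)} s)"
proof -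
  from partition_cell[OF \<tau> s] obtain k where k: "k < n" "\<tau> k \<le> s" "s < \<tau> (Suc k)" .
  have "c s = c (\<tau> k)"
    by (rule c[unfolded step_on_def, rule_format, OF k(1)]) (use k in simp)
  then show ?thesis using partition_sum_cell[OF \<tau> k, of "\<lambda>k. c (\<tau> k)"] by simp
qed

text \<open>
  The elementary integral of the step function \<open>c\<close> with respect to \<open>Y\<close> over the whole of \<open>[0,1]\<close>,
  freed from the truncation of times at the upper limit.
\<close>

definition weighted_increments :: "(nat \<Rightarrow> real) \<Rightarrow> nat \<Rightarrow> (real \<Rightarrow> real) \<Rightarrow> (real \<Rightarrow> 'a \<Rightarrow> real) \<Rightarrow> 'a \<Rightarrow> real" where
  "weighted_increments t n c Y \<omega> = (\<Sum>q<n. c (t q) * (Y (t (Suc q)) \<omega> - Y (t q) \<omega>))"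

lemma elementary_integral_eq_weighted_increments:
  assumes "partition t n"
  shows "elementary_integral t n (\<lambda>s _. c s) Y 1 \<omega> = weighted_increments t n c Y \<omega>"
  unfolding elementary_integral_def weighted_increments_def
  by (intro sum.cong refl) (use partition_bounds[OF assms] in \<open>auto simp: min_def\<close>)

lemma weighted_increments_add:
  "weighted_increments t n c (\<lambda>u \<omega>. Y u \<omega> + Z u \<omega>) \<omega> = weighted_increments t n c Y \<omega> + weighted_increments t n c Z \<omega>"
  unfolding weighted_increments_def sum.distrib[symmetric] by (intro sum.cong refl) (simp add: algebra_simps)

lemma weighted_increments_diff:
  "weighted_increments t n c (\<lambda>u \<omega>. Y u \<omega> - Z u \<omega>) \<omega> = weighted_increments t n c Y \<omega> - weighted_increments t n c Z \<omega>"
  unfolding weighted_increments_def sum_subtractf[symmetric] by (intro sum.cong refl) (simp add: algebra_simps)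

lemma weighted_increments_cmult:
  "weighted_increments t n c (\<lambda>u \<omega>. \<xi> \<omega> * Y u \<omega>) \<omega> = \<xi> \<omega> * weighted_increments t n c Y \<omega>"
  unfolding weighted_increments_def sum_distrib_left by (intro sum.cong refl) (simp add: algebra_simps)

lemma weighted_increments_sum:
  "weighted_increments t n c (\<lambda>u \<omega>. \<Sum>k\<in>K. Y k u \<omega>) \<omega> = (\<Sum>k\<in>K. weighted_increments t n c (Y k) \<omega>)"
  unfolding weighted_increments_def sum_subtractf[symmetric] sum_distrib_left by (rule sum.swap)

lemma weighted_increments_measurable [measurable (raw)]:
  assumes "partition t n" "\<And>u. 0 \<le> u \<Longrightarrow> u \<le> 1 \<Longrightarrow> Y u \<in> borel_measurable M"
  shows "weighted_increments t n c Y \<in> borel_measurable M"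
  unfolding weighted_increments_def[abs_def]
  by (intro borel_measurable_sum borel_measurable_times borel_measurable_diff borel_measurable_const assms(2))
     (use partition_bounds[OF assms(1)] in auto)

lemma square_add_le: "(x + y)\<^sup>2 \<le> 2 * x\<^sup>2 + 2 * (y::real)\<^sup>2"
  using sum_squares_bound[of x y] by (simp add: power2_sum)

lemma nn_integral_unit_interval:
  "(\<integral>\<^sup>+ s\<in>{0..1}. f s \<partial>lborel) = (\<integral>\<^sup>+ s. f s \<partial>\<U>)"
proof -
  have "(\<integral>\<^sup>+ s. f s \<partial>\<U>) = (\<integral>\<^sup>+ s. f s * indicator {0..<1} s \<partial>lborel)"
    by (rule nn_integral_restrict_space) simp
  also have "\<dots> = (\<integral>\<^sup>+ s\<in>{0..1}. f s \<partial>lborel)"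
    by (rule nn_integral_cong_AE, rule AE_mp[OF AE_lborel_singleton[of 1]]) (auto split: split_indicator)
  finally show ?thesis by simp
qed

lemma tendsto_0_bound_ennreal:
  fixes A B :: ennreal
  assumes le: "\<And>i. A \<le> B + c * x i + e * y i" and x: "x \<longlonglongrightarrow> 0" and y: "y \<longlonglongrightarrow> 0"
    and c: "c < top" "e < top"
  shows "A \<le> B"
proof (rule LIMSEQ_le_const)
  have "(\<lambda>i. B + c * x i + e * y i) \<longlonglongrightarrow> B + c * 0 + e * 0"
    by (intro tendsto_add tendsto_const ennreal_tendsto_cmult c x y)
  then show "(\<lambda>i. B + c * x i + e * y i) \<longlonglongrightarrow> B" by simp
qed (use le in auto)

context wiener begin

abbreviation jointly_measurable :: "(real \<Rightarrow> 'a \<Rightarrow> real) \<Rightarrow> bool" where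
  "jointly_measurable \<phi> \<equiv> (\<lambda>(s, \<omega>). \<phi> s \<omega>) \<in> borel_measurable (\<U> \<Otimes>\<^sub>M M)"

text \<open>
  The squared norms of \<open>L\<^sup>2(P)\<close> and \<open>L\<^sup>2(ds \<otimes> P)\<close>, with values in \<^typ>\<open>ennreal\<close> so that they make
  sense for every function and estimates need no integrability conditions.
\<close>

definition l2 :: "('a \<Rightarrow> real) \<Rightarrow> ennreal" where
  "l2 f = (\<integral>\<^sup>+ \<omega>. ennreal ((f \<omega>)\<^sup>2) \<partial>M)"

definition l2p :: "(real \<Rightarrow> 'a \<Rightarrow> real) \<Rightarrow> ennreal" where
  "l2p \<phi> = (\<integral>\<^sup>+ \<omega>. (\<integral>\<^sup>+ s. ennreal ((\<phi> s \<omega>)\<^sup>2) \<partial>\<U>) \<partial>M)"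

lemma l2_add_le:
  assumes [measurable]: "f \<in> borel_measurable M" "g \<in> borel_measurable M"
  shows "l2 (\<lambda>\<omega>. f \<omega> + g \<omega>) \<le> 2 * l2 f + 2 * l2 g"
proof -
  have "l2 (\<lambda>\<omega>. f \<omega> + g \<omega>) \<le> (\<integral>\<^sup>+ \<omega>. 2 * ennreal ((f \<omega>)\<^sup>2) + 2 * ennreal ((g \<omega>)\<^sup>2) \<partial>M)"
    unfolding l2_def
  proof (rule nn_integral_mono)
    fix \<omega>
    have "ennreal ((f \<omega> + g \<omega>)\<^sup>2) \<le> ennreal (2 * (f \<omega>)\<^sup>2 + 2 * (g \<omega>)\<^sup>2)"
      by (rule ennreal_leI[OF square_add_le])
    also have "\<dots> = 2 * ennreal ((f \<omega>)\<^sup>2) + 2 * ennreal ((g \<omega>)\<^sup>2)" by (simp add: ennreal_mult)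
    finally show "ennreal ((f \<omega> + g \<omega>)\<^sup>2) \<le> 2 * ennreal ((f \<omega>)\<^sup>2) + 2 * ennreal ((g \<omega>)\<^sup>2)" .
  qed
  also have "\<dots> = 2 * l2 f + 2 * l2 g" unfolding l2_def
    by (subst nn_integral_add) (auto simp: nn_integral_cmult)
  finally show ?thesis .
qed

lemma measurable_inner_l2p [measurable]:
  assumes [measurable]: "jointly_measurable \<phi>"
  shows "(\<lambda>\<omega>. \<integral>\<^sup>+ s. ennreal ((\<phi> s \<omega>)\<^sup>2) \<partial>\<U>) \<in> borel_measurable M"
  by (rule unit_interval.borel_measurable_nn_integral) measurable

lemma l2p_add_le:
  assumes [measurable]: "jointly_measurable \<phi>" "jointly_measurable \<psi>"
  shows "l2p (\<lambda>s \<omega>. \<phi> s \<omega> + \<psi> s \<omega>) \<le> 2 * l2p \<phi> + 2 * l2p \<psi>"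
proof -
  have "l2p (\<lambda>s \<omega>. \<phi> s \<omega> + \<psi> s \<omega>) \<le>
     (\<integral>\<^sup>+ \<omega>. 2 * (\<integral>\<^sup>+ s. ennreal ((\<phi> s \<omega>)\<^sup>2) \<partial>\<U>) + 2 * (\<integral>\<^sup>+ s. ennreal ((\<psi> s \<omega>)\<^sup>2) \<partial>\<U>) \<partial>M)"
    unfolding l2p_def
  proof (rule nn_integral_mono)
    fix \<omega> assume \<omega>[measurable]: "\<omega> \<in> space M"
    have "(\<integral>\<^sup>+ s. ennreal ((\<phi> s \<omega> + \<psi> s \<omega>)\<^sup>2) \<partial>\<U>) \<le>
        (\<integral>\<^sup>+ s. 2 * ennreal ((\<phi> s \<omega>)\<^sup>2) + 2 * ennreal ((\<psi> s \<omega>)\<^sup>2) \<partial>\<U>)"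
    proof (rule nn_integral_mono)
      fix s
      have "ennreal ((\<phi> s \<omega> + \<psi> s \<omega>)\<^sup>2) \<le> ennreal (2 * (\<phi> s \<omega>)\<^sup>2 + 2 * (\<psi> s \<omega>)\<^sup>2)"
        by (rule ennreal_leI[OF square_add_le])
      also have "\<dots> = 2 * ennreal ((\<phi> s \<omega>)\<^sup>2) + 2 * ennreal ((\<psi> s \<omega>)\<^sup>2)" by (simp add: ennreal_mult)
      finally show "ennreal ((\<phi> s \<omega> + \<psi> s \<omega>)\<^sup>2) \<le> 2 * ennreal ((\<phi> s \<omega>)\<^sup>2) + 2 * ennreal ((\<psi> s \<omega>)\<^sup>2)" .
    qed
    also have "\<dots> = 2 * (\<integral>\<^sup>+ s. ennreal ((\<phi> s \<omega>)\<^sup>2) \<partial>\<U>) + 2 * (\<integral>\<^sup>+ s. ennreal ((\<psi> s \<omega>)\<^sup>2) \<partial>\<U>)"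
      by (subst nn_integral_add) (auto simp: nn_integral_cmult)
    finally show "(\<integral>\<^sup>+ s. ennreal ((\<phi> s \<omega> + \<psi> s \<omega>)\<^sup>2) \<partial>\<U>) \<le>
      2 * (\<integral>\<^sup>+ s. ennreal ((\<phi> s \<omega>)\<^sup>2) \<partial>\<U>) + 2 * (\<integral>\<^sup>+ s. ennreal ((\<psi> s \<omega>)\<^sup>2) \<partial>\<U>)" .
  qed
  also have "\<dots> = 2 * l2p \<phi> + 2 * l2p \<psi>" unfolding l2p_def
    by (subst nn_integral_add) (auto simp: nn_integral_cmult)
  finally show ?thesis .
qed

lemma l2_minus_commute: "l2 (\<lambda>\<omega>. f \<omega> - g \<omega>) = l2 (\<lambda>\<omega>. g \<omega> - f \<omega>)"
  unfolding l2_def by (simp add: power2_commute)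

lemma l2p_minus_commute: "l2p (\<lambda>s \<omega>. f s \<omega> - g s \<omega>) = l2p (\<lambda>s \<omega>. g s \<omega> - f s \<omega>)"
  unfolding l2p_def by (simp add: power2_commute)

lemma l2_triangle:
  assumes "f \<in> borel_measurable M" "g \<in> borel_measurable M" "h \<in> borel_measurable M"
  shows "l2 (\<lambda>\<omega>. f \<omega> - h \<omega>) \<le> 2 * l2 (\<lambda>\<omega>. f \<omega> - g \<omega>) + 2 * l2 (\<lambda>\<omega>. g \<omega> - h \<omega>)"
  using l2_add_le[of "\<lambda>\<omega>. f \<omega> - g \<omega>" "\<lambda>\<omega>. g \<omega> - h \<omega>"] assms by simp

lemma l2_diff_le:
  assumes "f \<in> borel_measurable M" "g \<in> borel_measurable M"
  shows "l2 (\<lambda>\<omega>. f \<omega> - g \<omega>) \<le> 2 * l2 f + 2 * l2 g"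
proof -
  have "l2 (\<lambda>\<omega>. f \<omega> - g \<omega>) \<le> 2 * l2 (\<lambda>\<omega>. f \<omega> - 0) + 2 * l2 (\<lambda>\<omega>. 0 - g \<omega>)"
    by (rule l2_triangle[OF assms(1) _ assms(2)]) simp
  then show ?thesis by (simp add: l2_def)
qed

lemma l2p_triangle:
  assumes [measurable]: "jointly_measurable f" "jointly_measurable g" "jointly_measurable h"
  shows "l2p (\<lambda>s \<omega>. f s \<omega> - h s \<omega>) \<le> 2 * l2p (\<lambda>s \<omega>. f s \<omega> - g s \<omega>) + 2 * l2p (\<lambda>s \<omega>. g s \<omega> - h s \<omega>)"
  using l2p_add_le[of "\<lambda>s \<omega>. f s \<omega> - g s \<omega>" "\<lambda>s \<omega>. g s \<omega> - h s \<omega>"] by simp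

lemma l2_sum_tendsto_0:
  assumes "\<And>q i. q \<in> Q \<Longrightarrow> z q i \<in> borel_measurable M" "\<And>q. q \<in> Q \<Longrightarrow> (\<lambda>i. l2 (z q i)) \<longlonglongrightarrow> 0"
  shows "(\<lambda>i. l2 (\<lambda>\<omega>. \<Sum>q\<in>Q. z q i \<omega>)) \<longlonglongrightarrow> 0"
  using assms
proof (induction Q rule: infinite_finite_induct)
  case (insert q Q)
  have "(\<lambda>i. 2 * l2 (z q i) + 2 * l2 (\<lambda>\<omega>. \<Sum>q\<in>Q. z q i \<omega>)) \<longlonglongrightarrow> 2 * 0 + 2 * 0"
    using insert by (intro tendsto_add ennreal_tendsto_cmult) auto
  moreover have "l2 (\<lambda>\<omega>. \<Sum>q\<in>insert q Q. z q i \<omega>) \<le> 2 * l2 (z q i) + 2 * l2 (\<lambda>\<omega>. \<Sum>q\<in>Q. z q i \<omega>)" for i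
    using insert(1,2) l2_add_le[of "z q i" "\<lambda>\<omega>. \<Sum>q\<in>Q. z q i \<omega>"] insert.prems(1) by simp
  ultimately show ?case
    by (intro tendsto_sandwich[OF _ _ tendsto_const[of "0::ennreal"], of "\<lambda>i. l2 (\<lambda>\<omega>. \<Sum>q\<in>insert q Q. z q i \<omega>)"
        _ "\<lambda>i. 2 * l2 (z q i) + 2 * l2 (\<lambda>\<omega>. \<Sum>q\<in>Q. z q i \<omega>)"]) (simp_all add: always_eventually)
qed (simp_all add: l2_def)

lemma l2_cmult: "f \<in> borel_measurable M \<Longrightarrow> l2 (\<lambda>\<omega>. c * f \<omega>) = ennreal (c\<^sup>2) * l2 f"
  unfolding l2_def by (simp add: power_mult_distrib ennreal_mult nn_integral_cmult)

lemma simple_process_partition: "simple_process M F \<tau> n H \<Longrightarrow> partition \<tau> n"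
  unfolding simple_process_def partition_def by blast

lemma simple_process_adapted: "simple_process M F \<tau> n H \<Longrightarrow> k < n \<Longrightarrow> H (\<tau> k) \<in> borel_measurable (F (\<tau> k))"
  unfolding simple_process_def by blast

lemma simple_process_eq_sum:
  assumes H: "simple_process M F \<tau> n H" and s: "0 \<le> s" "s < 1" and \<omega>: "\<omega> \<in> space M"
  shows "H s \<omega> = (\<Sum>k<n. H (\<tau> k) \<omega> * indicator {\<tau> k..<\<tau> (Suc k)} s)"
  by (rule step_on_eq_sum[OF simple_process_partition[OF H] _ s, of "\<lambda>s. H s \<omega>"])
     (use H \<omega> in \<open>unfold simple_process_def step_on_def, blast\<close>)

lemma simple_process_measurable:
  assumes H: "simple_process M F \<tau> n H" and "k < n"
  shows "H (\<tau> k) \<in> borel_measurable M"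
  using partition_bounds[OF simple_process_partition[OF H], of k] assms(2)
  by (intro measurable_F[OF simple_process_adapted[OF H]]) auto

lemma simple_process_jointly_measurable:
  assumes H: "simple_process M F \<tau> n H"
  shows "jointly_measurable H"
proof -
  have "(\<lambda>(s, \<omega>). \<Sum>k<n. H (\<tau> k) \<omega> * indicator {\<tau> k..<\<tau> (Suc k)} s) \<in> borel_measurable (\<U> \<Otimes>\<^sub>M M)"
    unfolding split_beta
    by (intro borel_measurable_sum borel_measurable_times
        measurable_compose[OF measurable_snd simple_process_measurable[OF H]]
        measurable_compose[OF measurable_fst indicator_measurable_unit_interval]) auto
  then show ?thesis
    by (rule measurable_cong[THEN iffD1, rotated])
       (auto simp: space_pair_measure simple_process_eq_sum[OF H])
qed

lemma elementary_integral_measurable: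
  assumes H: "simple_process M F \<tau> n H" and u: "0 \<le> u" "u \<le> 1" and r: "r \<in> {1..d}"
  shows "elementary_integral \<tau> n H (W r) u \<in> borel_measurable M"
  unfolding elementary_integral_def[abs_def]
  by (intro borel_measurable_sum borel_measurable_times borel_measurable_diff simple_process_measurable[OF H] W_measurable r)
     (use partition_bounds[OF simple_process_partition[OF H]] u in auto)

text \<open>
  An integrator stopped at \<open>v\<close> minus the integrator stopped at \<open>u\<close> sees of the cell \<open>[x,y)\<close> only
  its intersection with \<open>[u,v)\<close>.
\<close>

lemma increment_min:
  fixes f :: "real \<Rightarrow> real"
  assumes "x < y" "u \<le> v"
  shows "f (min y v) - f (min x v) - (f (min y u) - f (min x u)) =
    (if max x u < min y v then f (min y v) - f (max x u) else 0)"
  using assms by (auto simp: min_def max_def)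

lemma ito_simple_elementary_integral:
  assumes H: "simple_process M F \<tau> n H" and uv: "0 \<le> u" "u \<le> v" "v \<le> 1"
  shows "ito_simple r (\<lambda>\<omega>. elementary_integral \<tau> n H (W r) v \<omega> - elementary_integral \<tau> n H (W r) u \<omega>)
    (\<lambda>s \<omega>. indicator {u..<v} s * H s \<omega>)"
proof -
  note \<tau> = simple_process_partition[OF H]
  from H obtain C where C: "\<And>k \<omega>. k < n \<Longrightarrow> \<omega> \<in> space M \<Longrightarrow> \<bar>H (\<tau> k) \<omega>\<bar> \<le> C" unfolding simple_process_def by blast
  have piece: "ito_simple r (\<lambda>\<omega>. H (\<tau> k) \<omega> * (W r (min (\<tau> (Suc k)) v) \<omega> - W r (min (\<tau> k) v) \<omega> - (W r (min (\<tau> (Suc k)) u) \<omega> - W r (min (\<tau> k) u) \<omega>)))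
     (\<lambda>s \<omega>. H (\<tau> k) \<omega> * indicator {max (\<tau> k) u..<min (\<tau> (Suc k)) v} s)" if k: "k < n" for k
  proof -
    have lt: "\<tau> k < \<tau> (Suc k)" using partition_less_iff[OF \<tau>, of k "Suc k"] k by simp
    note inc = increment_min[OF lt uv(2), of "\<lambda>x. W r x \<omega>" for \<omega>]
    show ?thesis
    proof (cases "max (\<tau> k) u < min (\<tau> (Suc k)) v")
      case True
      have "ito_simple r (\<lambda>\<omega>. H (\<tau> k) \<omega> * (W r (min (\<tau> (Suc k)) v) \<omega> - W r (max (\<tau> k) u) \<omega>))
         (\<lambda>s \<omega>. H (\<tau> k) \<omega> * indicator {max (\<tau> k) u..<min (\<tau> (Suc k)) v} s)"
      proof (rule ito_simple.piece)
        show "H (\<tau> k) \<in> borel_measurable (F (max (\<tau> k) u))"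
          by (rule measurable_F_mono[OF simple_process_adapted[OF H k]]) simp
        show "\<bar>H (\<tau> k) \<omega>\<bar> \<le> C" if "\<omega> \<in> space M" for \<omega> by (rule C[OF k that])
        show "max (\<tau> k) u \<le> min (\<tau> (Suc k)) v" using True by simp
      qed (use uv in auto)
      then show ?thesis unfolding inc using True by simp
    next
      case False
      then have "{max (\<tau> k) u..<min (\<tau> (Suc k)) v} = {}" by auto
      then show ?thesis unfolding inc if_not_P[OF False] \<open>_ = {}\<close> by (simp add: ito_simple_zero)
    qed
  qed
  have "ito_simple r (\<lambda>\<omega>. \<Sum>k<n. H (\<tau> k) \<omega> * (W r (min (\<tau> (Suc k)) v) \<omega> - W r (min (\<tau> k) v) \<omega> - (W r (min (\<tau> (Suc k)) u) \<omega> - W r (min (\<tau> k) u) \<omega>)))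
     (\<lambda>s \<omega>. \<Sum>k<n. H (\<tau> k) \<omega> * indicator {max (\<tau> k) u..<min (\<tau> (Suc k)) v} s)"
    by (rule ito_simple_sum) (use piece in auto)
  moreover have "(\<Sum>k<n. H (\<tau> k) \<omega> * (W r (min (\<tau> (Suc k)) v) \<omega> - W r (min (\<tau> k) v) \<omega> - (W r (min (\<tau> (Suc k)) u) \<omega> - W r (min (\<tau> k) u) \<omega>))) =
     elementary_integral \<tau> n H (W r) v \<omega> - elementary_integral \<tau> n H (W r) u \<omega>" for \<omega>
    unfolding elementary_integral_def sum_subtractf[symmetric] by (intro sum.cong refl) (simp add: algebra_simps)
  ultimately have "ito_simple r (\<lambda>\<omega>. elementary_integral \<tau> n H (W r) v \<omega> - elementary_integral \<tau> n H (W r) u \<omega>)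
     (\<lambda>s \<omega>. \<Sum>k<n. H (\<tau> k) \<omega> * indicator {max (\<tau> k) u..<min (\<tau> (Suc k)) v} s)" by simp
  then show ?thesis
  proof (rule ito_simple.eq_on)
    fix s \<omega> assume s: "0 \<le> s" "s < (1::real)" and \<omega>: "\<omega> \<in> space M"
    have "(indicator {max (\<tau> k) u..<min (\<tau> (Suc k)) v} s :: real) = indicator {u..<v} s * indicator {\<tau> k..<\<tau> (Suc k)} s" for k
      by (auto split: split_indicator)
    then show "indicator {u..<v} s * H s \<omega> = (\<Sum>k<n. H (\<tau> k) \<omega> * indicator {max (\<tau> k) u..<min (\<tau> (Suc k)) v} s)"
      unfolding simple_process_eq_sum[OF H s \<omega>] sum_distrib_left by (intro sum.cong refl) (simp only: mult_ac)
  qed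
qed

text \<open>
  Associativity of integration: the increments of \<open>\<integral> H dW\<close> over the cell of \<open>t q\<close> have integrand
  \<open>H\<close> on that cell, and \<open>c\<close> is constant there.
\<close>

lemma ito_simple_weighted_increments:
  assumes H: "simple_process M F \<tau> n H" and t: "partition t N" and c: "step_on t N c"
  shows "ito_simple r (weighted_increments t N c (elementary_integral \<tau> n H (W r))) (\<lambda>s \<omega>. c s * H s \<omega>)"
proof -
  have "ito_simple r (\<lambda>\<omega>. \<Sum>q<N. c (t q) * (elementary_integral \<tau> n H (W r) (t (Suc q)) \<omega> - elementary_integral \<tau> n H (W r) (t q) \<omega>))
     (\<lambda>s \<omega>. \<Sum>q<N. c (t q) * (indicator {t q..<t (Suc q)} s * H s \<omega>))"
  proof (intro ito_simple_sum ito_simple_cmult ito_simple_elementary_integral[OF H])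
    fix q assume "q \<in> {..<N}"
    then show "0 \<le> t q" "t q \<le> t (Suc q)" "t (Suc q) \<le> 1"
      using partition_bounds[OF t] partition_le_iff[OF t, of q "Suc q"] by auto
  qed
  then have "ito_simple r (weighted_increments t N c (elementary_integral \<tau> n H (W r)))
     (\<lambda>s \<omega>. \<Sum>q<N. c (t q) * (indicator {t q..<t (Suc q)} s * H s \<omega>))"
    unfolding weighted_increments_def[abs_def] .
  then show ?thesis
  proof (rule ito_simple.eq_on)
    fix s \<omega> assume s: "0 \<le> s" "s < (1::real)"
    show "c s * H s \<omega> = (\<Sum>q<N. c (t q) * (indicator {t q..<t (Suc q)} s * H s \<omega>))"
      unfolding step_on_eq_sum[OF t c s] sum_distrib_right by (simp only: mult.assoc)
  qed
qed

lemma l2_ito_simple: "r \<in> {1..d} \<Longrightarrow> ito_simple r \<Phi> \<phi> \<Longrightarrow> l2 \<Phi> = l2p \<phi>"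
  unfolding l2_def l2p_def by (rule ito_isometry)

lemma l2p_mult_le:
  assumes "\<And>s \<omega>. 0 \<le> s \<Longrightarrow> s < 1 \<Longrightarrow> \<bar>c s\<bar> \<le> 1" "\<And>s \<omega>. 0 \<le> s \<Longrightarrow> s < 1 \<Longrightarrow> \<omega> \<in> space M \<Longrightarrow> \<psi> s \<omega> = c s * \<phi> s \<omega>"
  shows "l2p \<psi> \<le> l2p \<phi>"
  unfolding l2p_def
proof (intro nn_integral_mono ennreal_leI)
  fix \<omega> s assume "\<omega> \<in> space M" "s \<in> space \<U>"
  then have s: "0 \<le> s" "s < 1" and eq: "\<psi> s \<omega> = c s * \<phi> s \<omega>" using assms(2) by auto
  have "(c s)\<^sup>2 * (\<phi> s \<omega>)\<^sup>2 \<le> 1 * (\<phi> s \<omega>)\<^sup>2"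
    by (intro mult_right_mono) (use assms(1)[OF s] in \<open>auto simp: abs_square_le_1\<close>)
  then show "(\<psi> s \<omega>)\<^sup>2 \<le> (\<phi> s \<omega>)\<^sup>2" by (simp add: eq power_mult_distrib)
qed

lemma l2_elementary_integral_diff:
  assumes H: "simple_process M F \<tau> n H" and G: "simple_process M F \<tau>' n' G" and u: "0 \<le> u" "u \<le> 1" and r: "r \<in> {1..d}"
  shows "l2 (\<lambda>\<omega>. elementary_integral \<tau> n H (W r) u \<omega> - elementary_integral \<tau>' n' G (W r) u \<omega>) \<le> l2p (\<lambda>s \<omega>. H s \<omega> - G s \<omega>)"
proof -
  have 0: "elementary_integral \<tau> n H (W r) 0 \<omega> = 0" if "simple_process M F \<tau> n H" for \<tau> n H \<omega>
    unfolding elementary_integral_def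
  proof (rule sum.neutral, rule ballI)
    fix k assume "k \<in> {..<n}"
    then have "min (\<tau> (Suc k)) 0 = 0" "min (\<tau> k) 0 = 0"
      using partition_bounds[OF simple_process_partition[OF that]] by simp_all
    then show "H (\<tau> k) \<omega> * (W r (min (\<tau> (Suc k)) 0) \<omega> - W r (min (\<tau> k) 0) \<omega>) = 0" by simp
  qed
  have "ito_simple r (\<lambda>\<omega>. (elementary_integral \<tau> n H (W r) u \<omega> - elementary_integral \<tau> n H (W r) 0 \<omega>)
      - (elementary_integral \<tau>' n' G (W r) u \<omega> - elementary_integral \<tau>' n' G (W r) 0 \<omega>))
     (\<lambda>s \<omega>. indicator {0..<u} s * H s \<omega> - indicator {0..<u} s * G s \<omega>)"
    using u by (intro ito_simple_diff ito_simple_elementary_integral H G) auto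
  from l2_ito_simple[OF r this]
  have "l2 (\<lambda>\<omega>. elementary_integral \<tau> n H (W r) u \<omega> - elementary_integral \<tau>' n' G (W r) u \<omega>) =
      l2p (\<lambda>s \<omega>. indicator {0..<u} s * H s \<omega> - indicator {0..<u} s * G s \<omega>)"
    by (simp add: 0[OF H] 0[OF G])
  also have "\<dots> \<le> l2p (\<lambda>s \<omega>. H s \<omega> - G s \<omega>)"
    by (rule l2p_mult_le[where c="indicator {0..<u}"]) (auto split: split_indicator)
  finally show ?thesis .
qed

lemma l2_weighted_increments_diff:
  assumes H: "simple_process M F \<tau> n H" and G: "simple_process M F \<tau>' n' G" and r: "r \<in> {1..d}"
    and t: "partition t N" and c: "step_on t N c" "\<And>s. \<bar>c s\<bar> \<le> 1"
  shows "l2 (\<lambda>\<omega>. weighted_increments t N c (elementary_integral \<tau> n H (W r)) \<omega>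
    - weighted_increments t N c (elementary_integral \<tau>' n' G (W r)) \<omega>) \<le> l2p (\<lambda>s \<omega>. H s \<omega> - G s \<omega>)"
proof -
  have "ito_simple r (\<lambda>\<omega>. weighted_increments t N c (elementary_integral \<tau> n H (W r)) \<omega>
    - weighted_increments t N c (elementary_integral \<tau>' n' G (W r)) \<omega>) (\<lambda>s \<omega>. c s * H s \<omega> - c s * G s \<omega>)"
    by (intro ito_simple_diff ito_simple_weighted_increments H G t c)
  from l2_ito_simple[OF r this] show ?thesis
    by (simp, intro l2p_mult_le[where c=c]) (auto simp: c right_diff_distrib)
qed

lemma l2_weighted_increments_simple:
  assumes H: "simple_process M F \<tau> n H" and r: "r \<in> {1..d}"
    and t: "partition t N" and c: "step_on t N c" "\<And>s. \<bar>c s\<bar> \<le> 1"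
  shows "l2 (weighted_increments t N c (elementary_integral \<tau> n H (W r))) \<le> l2p H"
  unfolding l2_ito_simple[OF r ito_simple_weighted_increments[OF H t c(1)]]
  by (rule l2p_mult_le[where c=c]) (auto simp: c)

lemma L2a_jointly_measurable:
  assumes "\<theta> \<in> L2a M F"
  shows "jointly_measurable \<theta>"
proof -
  have \<theta>: "(\<lambda>(s, \<omega>). \<theta> s \<omega>) \<in> borel_measurable (restrict_space borel {0..1} \<Otimes>\<^sub>M M)"
    using assms by (simp add: L2a_def)
  have "(\<lambda>s. s) \<in> \<U> \<rightarrow>\<^sub>M restrict_space borel {0..1}"
    by (intro measurable_restrict_space2 measurable_restrict_space1) auto
  then have "(\<lambda>x. (fst x, snd x)) \<in> \<U> \<Otimes>\<^sub>M M \<rightarrow>\<^sub>M restrict_space borel {0..1} \<Otimes>\<^sub>M M"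
    by (intro measurable_Pair measurable_compose[OF measurable_fst] measurable_snd)
  from measurable_compose[OF this \<theta>] show ?thesis by (simp add: split_beta)
qed

lemma L2a_l2p_finite: "\<theta> \<in> L2a M F \<Longrightarrow> l2p \<theta> < \<infinity>"
  unfolding L2a_def l2p_def nn_integral_unit_interval by simp

lemma has_ito_integral_approximation:
  assumes "has_ito_integral M F B \<theta> u Y"
  obtains \<tau> n H where "\<And>i::nat. simple_process M F (\<tau> i) (n i) (H i)"
    "(\<lambda>i. l2p (\<lambda>s \<omega>. H i s \<omega> - \<theta> s \<omega>)) \<longlonglongrightarrow> 0"
    "(\<lambda>i. l2 (\<lambda>\<omega>. elementary_integral (\<tau> i) (n i) (H i) B u \<omega> - Y \<omega>)) \<longlonglongrightarrow> 0"
  using assms unfolding has_ito_integral_def nn_integral_unit_interval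
  by (elim conjE exE) (rule that, erule spec, unfold l2_def l2p_def)

text \<open>
  The approximating sequence in the definition of the Ito integral may be a different one at each
  time \<open>u\<close>. Comparing it with \<open>H\<close> by the isometry shows that one and the same simple process \<open>H\<close>
  works at all times.
\<close>

lemma ito_integral_simple_approximation:
  assumes Y: "has_ito_integral M F (W r) \<theta> u Y" and u: "0 \<le> u" "u \<le> 1" and r: "r \<in> {1..d}"
    and \<theta>: "jointly_measurable \<theta>" and H: "simple_process M F \<tau> n H"
  shows "l2 (\<lambda>\<omega>. elementary_integral \<tau> n H (W r) u \<omega> - Y \<omega>) \<le> 4 * l2p (\<lambda>s \<omega>. H s \<omega> - \<theta> s \<omega>)"
proof -
  obtain \<tau>' n' G where
    G: "\<And>i::nat. simple_process M F (\<tau>' i) (n' i) (G i)"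
      "(\<lambda>i. l2p (\<lambda>s \<omega>. G i s \<omega> - \<theta> s \<omega>)) \<longlonglongrightarrow> 0"
      "(\<lambda>i. l2 (\<lambda>\<omega>. elementary_integral (\<tau>' i) (n' i) (G i) (W r) u \<omega> - Y \<omega>)) \<longlonglongrightarrow> 0"
    using has_ito_integral_approximation[OF Y] by blast
  have YM: "Y \<in> borel_measurable M" using Y by (simp add: has_ito_integral_def)
  show ?thesis
  proof (rule tendsto_0_bound_ennreal[OF _ G(2,3)])
    fix i
    have "l2 (\<lambda>\<omega>. elementary_integral \<tau> n H (W r) u \<omega> - Y \<omega>) \<le>
      2 * l2 (\<lambda>\<omega>. elementary_integral \<tau> n H (W r) u \<omega> - elementary_integral (\<tau>' i) (n' i) (G i) (W r) u \<omega>)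
      + 2 * l2 (\<lambda>\<omega>. elementary_integral (\<tau>' i) (n' i) (G i) (W r) u \<omega> - Y \<omega>)" (is "_ \<le> 2 * ?a + 2 * ?b")
      by (intro l2_triangle elementary_integral_measurable[OF _ u r] H G YM)
    also have "?a \<le> l2p (\<lambda>s \<omega>. H s \<omega> - G i s \<omega>)"
      by (rule l2_elementary_integral_diff[OF H G(1) u r])
    also have "\<dots> \<le> 2 * l2p (\<lambda>s \<omega>. H s \<omega> - \<theta> s \<omega>) + 2 * l2p (\<lambda>s \<omega>. \<theta> s \<omega> - G i s \<omega>)"
      by (rule l2p_triangle[OF simple_process_jointly_measurable[OF H] \<theta> simple_process_jointly_measurable[OF G(1)]])
    also have "l2p (\<lambda>s \<omega>. \<theta> s \<omega> - G i s \<omega>) = l2p (\<lambda>s \<omega>. G i s \<omega> - \<theta> s \<omega>)" by (rule l2p_minus_commute)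
    finally show "l2 (\<lambda>\<omega>. elementary_integral \<tau> n H (W r) u \<omega> - Y \<omega>) \<le>
      4 * l2p (\<lambda>s \<omega>. H s \<omega> - \<theta> s \<omega>) + 4 * l2p (\<lambda>s \<omega>. G i s \<omega> - \<theta> s \<omega>) + 2 * ?b"
      by (simp add: distrib_left mult.assoc[symmetric] mult_left_mono add_mono)
  qed auto
qed

text \<open>
  The bound depends neither on the grid nor on \<open>c\<close>. A term by term estimate would produce the
  number of grid points; instead, \<open>H\<close> is compared with simple processes \<open>G i\<close> that approximate
  \<open>\<theta>\<close>, where the isometry applies to the whole weighted sum, and then \<open>i\<close> tends to infinity for
  the fixed grid.
\<close>

lemma ito_integral_weighted_approximation:
  assumes Y: "\<And>u. 0 \<le> u \<Longrightarrow> u \<le> 1 \<Longrightarrow> has_ito_integral M F (W r) \<theta> u (Y u)" and r: "r \<in> {1..d}"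
    and \<theta>: "jointly_measurable \<theta>" and H: "simple_process M F \<tau> n H"
    and t: "partition t N" and c: "step_on t N c" "\<And>s. \<bar>c s\<bar> \<le> 1"
  shows "l2 (\<lambda>\<omega>. weighted_increments t N c (elementary_integral \<tau> n H (W r)) \<omega> - weighted_increments t N c Y \<omega>)
    \<le> 4 * l2p (\<lambda>s \<omega>. H s \<omega> - \<theta> s \<omega>)"
proof -
  have Y1: "has_ito_integral M F (W r) \<theta> 1 (Y 1)" by (rule Y) auto
  obtain \<tau>' n' G where
    G: "\<And>i::nat. simple_process M F (\<tau>' i) (n' i) (G i)"
      "(\<lambda>i. l2p (\<lambda>s \<omega>. G i s \<omega> - \<theta> s \<omega>)) \<longlonglongrightarrow> 0"
    by (rule has_ito_integral_approximation[OF Y1]) (rule that, assumption, assumption)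
  have YM: "Y u \<in> borel_measurable M" if "0 \<le> u" "u \<le> 1" for u
    using Y[OF that] by (simp add: has_ito_integral_def)
  let ?E = "\<lambda>i. elementary_integral (\<tau>' i) (n' i) (G i) (W r)"
  have EM: "?E i u \<in> borel_measurable M" if "0 \<le> u" "u \<le> 1" for i u
    by (rule elementary_integral_measurable[OF G(1) that r])
  have lim_u: "(\<lambda>i. l2 (\<lambda>\<omega>. ?E i u \<omega> - Y u \<omega>)) \<longlonglongrightarrow> 0" if u: "0 \<le> u" "u \<le> 1" for u
  proof (rule tendsto_sandwich[OF _ _ tendsto_const])
    show "\<forall>\<^sub>F i in sequentially. l2 (\<lambda>\<omega>. ?E i u \<omega> - Y u \<omega>) \<le> 4 * l2p (\<lambda>s \<omega>. G i s \<omega> - \<theta> s \<omega>)"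
      by (intro always_eventually allI ito_integral_simple_approximation Y u r \<theta> G(1))
    show "(\<lambda>i. 4 * l2p (\<lambda>s \<omega>. G i s \<omega> - \<theta> s \<omega>)) \<longlonglongrightarrow> 0"
      using ennreal_tendsto_cmult[OF _ G(2), of 4] by simp
  qed simp
  have lim: "(\<lambda>i. l2 (\<lambda>\<omega>. weighted_increments t N c (?E i) \<omega> - weighted_increments t N c Y \<omega>)) \<longlonglongrightarrow> 0"
  proof -
    have "(\<lambda>i. l2 (\<lambda>\<omega>. \<Sum>q<N. c (t q) * ((?E i (t (Suc q)) \<omega> - Y (t (Suc q)) \<omega>) - (?E i (t q) \<omega> - Y (t q) \<omega>)))) \<longlonglongrightarrow> 0"
    proof (rule l2_sum_tendsto_0)
      fix q assume "q \<in> {..<N}"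
      then have q: "0 \<le> t q" "t q \<le> 1" "0 \<le> t (Suc q)" "t (Suc q) \<le> 1"
        using partition_bounds[OF t] by auto
      have m: "(\<lambda>\<omega>. ?E i (t (Suc q)) \<omega> - Y (t (Suc q)) \<omega>) \<in> borel_measurable M"
        "(\<lambda>\<omega>. ?E i (t q) \<omega> - Y (t q) \<omega>) \<in> borel_measurable M" for i
        by (intro borel_measurable_diff EM YM q)+
      show "(\<lambda>\<omega>. c (t q) * ((?E i (t (Suc q)) \<omega> - Y (t (Suc q)) \<omega>) - (?E i (t q) \<omega> - Y (t q) \<omega>))) \<in> borel_measurable M" for i
        by (intro borel_measurable_times borel_measurable_diff borel_measurable_const m)
      let ?b = "\<lambda>i. ennreal ((c (t q))\<^sup>2) * (2 * l2 (\<lambda>\<omega>. ?E i (t (Suc q)) \<omega> - Y (t (Suc q)) \<omega>) + 2 * l2 (\<lambda>\<omega>. ?E i (t q) \<omega> - Y (t q) \<omega>))"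
      show "(\<lambda>i. l2 (\<lambda>\<omega>. c (t q) * ((?E i (t (Suc q)) \<omega> - Y (t (Suc q)) \<omega>) - (?E i (t q) \<omega> - Y (t q) \<omega>)))) \<longlonglongrightarrow> 0"
      proof (rule tendsto_sandwich[OF _ _ tendsto_const])
        have "?b \<longlonglongrightarrow> ennreal ((c (t q))\<^sup>2) * (2 * 0 + 2 * 0)"
          by (intro ennreal_tendsto_cmult tendsto_add lim_u q) auto
        then show "?b \<longlonglongrightarrow> 0" by simp
        have "l2 (\<lambda>\<omega>. c (t q) * ((?E i (t (Suc q)) \<omega> - Y (t (Suc q)) \<omega>) - (?E i (t q) \<omega> - Y (t q) \<omega>))) \<le> ?b i" for i
          unfolding l2_cmult[OF borel_measurable_diff[OF m(1)[of i] m(2)[of i]]]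
          by (rule mult_left_mono[OF l2_diff_le[OF m(1)[of i] m(2)[of i]]]) simp
        then show "\<forall>\<^sub>F i in sequentially. l2 (\<lambda>\<omega>. c (t q) * ((?E i (t (Suc q)) \<omega> - Y (t (Suc q)) \<omega>) - (?E i (t q) \<omega> - Y (t q) \<omega>))) \<le> ?b i"
          by (intro always_eventually allI)
      qed simp
    qed
    moreover have "(\<Sum>q<N. c (t q) * ((?E i (t (Suc q)) \<omega> - Y (t (Suc q)) \<omega>) - (?E i (t q) \<omega> - Y (t q) \<omega>))) =
       weighted_increments t N c (?E i) \<omega> - weighted_increments t N c Y \<omega>" for i \<omega>
      unfolding weighted_increments_def sum_subtractf[symmetric] by (intro sum.cong refl) (simp add: algebra_simps)
    ultimately show ?thesis by simp
  qed
  show ?thesis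
  proof (rule tendsto_0_bound_ennreal[OF _ G(2) lim])
    fix i
    let ?w = "weighted_increments t N c"
    let ?H = "elementary_integral \<tau> n H (W r)"
    have "l2 (\<lambda>\<omega>. ?w ?H \<omega> - ?w Y \<omega>) \<le> 2 * l2 (\<lambda>\<omega>. ?w ?H \<omega> - ?w (?E i) \<omega>) + 2 * l2 (\<lambda>\<omega>. ?w (?E i) \<omega> - ?w Y \<omega>)" (is "_ \<le> 2 * ?a + 2 * ?b")
      by (intro l2_triangle weighted_increments_measurable[OF t] elementary_integral_measurable[OF H _ _ r] EM YM)
    also have "?a \<le> l2p (\<lambda>s \<omega>. H s \<omega> - G i s \<omega>)"
      by (rule l2_weighted_increments_diff[OF H G(1) r t c])
    also have "\<dots> \<le> 2 * l2p (\<lambda>s \<omega>. H s \<omega> - \<theta> s \<omega>) + 2 * l2p (\<lambda>s \<omega>. \<theta> s \<omega> - G i s \<omega>)"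
      by (rule l2p_triangle[OF simple_process_jointly_measurable[OF H] \<theta> simple_process_jointly_measurable[OF G(1)]])
    also have "l2p (\<lambda>s \<omega>. \<theta> s \<omega> - G i s \<omega>) = l2p (\<lambda>s \<omega>. G i s \<omega> - \<theta> s \<omega>)" by (rule l2p_minus_commute)
    finally show "l2 (\<lambda>\<omega>. ?w ?H \<omega> - ?w Y \<omega>) \<le>
      4 * l2p (\<lambda>s \<omega>. H s \<omega> - \<theta> s \<omega>) + 4 * l2p (\<lambda>s \<omega>. G i s \<omega> - \<theta> s \<omega>) + 2 * ?b"
      by (simp add: distrib_left mult.assoc[symmetric] mult_left_mono add_mono)
  qed auto
qed

end

section \<open>Quadratic forms in independent Gaussian increments\<close>

text \<open>
  Wick's formula. By independence the expectation of the product is the product of the moments \<open>E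
  Z\<^sub>x\<^sup>e\<close>, where \<open>e\<close> counts how often \<open>x\<close> occurs among \<open>i\<close>, \<open>j\<close>, \<open>k\<close>, \<open>l\<close>. An odd multiplicity
  gives 0; the fourth moment \<open>3 v\<^sup>2\<close> of the normal distribution matches the three pairings that
  coincide when all indices agree.
\<close>

lemma (in prob_space) fourth_moment_indep:
  fixes Z :: "'i \<Rightarrow> 'a \<Rightarrow> real"
  assumes I: "finite I" and ind: "indep_vars (\<lambda>_. borel) Z I"
    and int: "\<And>x n. x \<in> I \<Longrightarrow> integrable M (\<lambda>\<omega>. Z x \<omega> ^ n)"
    and m: "\<And>x. x \<in> I \<Longrightarrow> expectation (Z x) = 0" "\<And>x. x \<in> I \<Longrightarrow> expectation (\<lambda>\<omega>. (Z x \<omega>)\<^sup>2) = v x"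
      "\<And>x. x \<in> I \<Longrightarrow> expectation (\<lambda>\<omega>. Z x \<omega> ^ 3) = 0" "\<And>x. x \<in> I \<Longrightarrow> expectation (\<lambda>\<omega>. Z x \<omega> ^ 4) = 3 * (v x)\<^sup>2"
    and ijkl: "i \<in> I" "j \<in> I" "k \<in> I" "l \<in> I"
  shows "has_bochner_integral M (\<lambda>\<omega>. Z i \<omega> * Z j \<omega> * (Z k \<omega> * Z l \<omega>))
    (v i * v k * of_bool (i = j \<and> k = l) + v i * v j * of_bool (i = k \<and> j = l) + v i * v j * of_bool (i = l \<and> j = k))"
proof -
  define e :: "'i \<Rightarrow> nat" where "e x = of_bool (x = i) + of_bool (x = j) + of_bool (x = k) + of_bool (x = l)" for x
  define \<mu> where "\<mu> x n = expectation (\<lambda>\<omega>. Z x \<omega> ^ n)" for x n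
  have single: "(\<Prod>x\<in>I. Z x \<omega> ^ of_bool (x = y)) = Z y \<omega>" if "y \<in> I" for y \<omega>
  proof -
    have "(\<Prod>x\<in>I. Z x \<omega> ^ of_bool (x = y)) = (\<Prod>x\<in>I. if x = y then Z x \<omega> else 1)"
      by (intro prod.cong) auto
    then show ?thesis using I that by simp
  qed
  have prod: "(\<Prod>x\<in>I. Z x \<omega> ^ e x) = Z i \<omega> * Z j \<omega> * (Z k \<omega> * Z l \<omega>)" for \<omega>
    unfolding e_def power_add prod.distrib using single[OF ijkl(1)] single[OF ijkl(2)] single[OF ijkl(3)] single[OF ijkl(4)]
    by (simp add: mult.assoc)
  have ind': "indep_vars (\<lambda>_. borel) (\<lambda>x \<omega>. Z x \<omega> ^ e x) I"
    by (rule indep_vars_compose2[OF ind, of "\<lambda>x z. z ^ e x"]) auto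
  have 1: "integrable M (\<lambda>\<omega>. \<Prod>x\<in>I. Z x \<omega> ^ e x)" "expectation (\<lambda>\<omega>. \<Prod>x\<in>I. Z x \<omega> ^ e x) = (\<Prod>x\<in>I. \<mu> x (e x))"
    unfolding \<mu>_def by (rule indep_vars_integrable[OF I ind' int] indep_vars_lebesgue_integral[OF I ind' int]; simp)+
  have "(\<Prod>x\<in>I. \<mu> x (e x)) = (\<Prod>x\<in>{i, j, k, l}. \<mu> x (e x))"
    using I ijkl by (intro prod.mono_neutral_right) (auto simp: e_def \<mu>_def prob_space)
  also have "\<dots> = v i * v k * of_bool (i = j \<and> k = l) + v i * v j * of_bool (i = k \<and> j = l) + v i * v j * of_bool (i = l \<and> j = k)"
  proof -
    have \<mu>: "\<mu> x (Suc 0) = 0" "\<mu> x 2 = v x" "\<mu> x (Suc (Suc 0)) = v x" "\<mu> x 3 = 0" "\<mu> x (Suc (Suc (Suc 0))) = 0"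
      "\<mu> x 4 = 3 * v x * v x" "\<mu> x (Suc (Suc (Suc (Suc 0)))) = 3 * v x * v x" if "x \<in> {i, j, k, l}" for x
      using m(1)[of x] m(2)[of x] m(3)[of x] m(4)[of x] that ijkl
      by (auto simp: \<mu>_def numeral_eq_Suc)
    show ?thesis
      by (cases "i = j"; cases "i = k"; cases "i = l"; cases "j = k"; cases "j = l"; cases "k = l")
         (simp_all add: e_def \<mu> insert_commute)
  qed
  finally show ?thesis using 1 unfolding prod by (simp add: has_bochner_integral_iff)
qed

lemma (in prob_space) second_moment_indep:
  fixes Z :: "'i \<Rightarrow> 'a \<Rightarrow> real"
  assumes I: "finite I" and ind: "indep_vars (\<lambda>_. borel) Z I"
    and int: "\<And>x n. x \<in> I \<Longrightarrow> integrable M (\<lambda>\<omega>. Z x \<omega> ^ n)"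
    and m: "\<And>x. x \<in> I \<Longrightarrow> expectation (Z x) = 0" "\<And>x. x \<in> I \<Longrightarrow> expectation (\<lambda>\<omega>. (Z x \<omega>)\<^sup>2) = v x"
    and ij: "i \<in> I" "j \<in> I"
  shows "has_bochner_integral M (\<lambda>\<omega>. Z i \<omega> * Z j \<omega>) (v i * of_bool (i = j))"
proof (cases "i = j")
  case True
  then show ?thesis using int[OF ij(1), of 2] m(2)[OF ij(1)] by (simp add: power2_eq_square has_bochner_integral_iff)
next
  case False
  have ind': "indep_vars (\<lambda>_. borel) Z {i, j}"
    by (rule indep_vars_subset[OF ind]) (use ij in auto)
  have "integrable M (Z x)" if "x \<in> {i, j}" for x using int[of x 1] that ij by auto
  from indep_vars_integrable[OF _ ind' this] indep_vars_lebesgue_integral[OF _ ind' this] show ?thesis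
    using m(1)[OF ij(1)] False by (simp add: has_bochner_integral_iff)
qed

text \<open>
  The number \<open>\<delta>\<close> is 1 if \<open>X\<close> and \<open>Y\<close> are the same family and 0 if they are independent of each
  other. By Wick's formula the variance of the quadratic form is \<open>\<Sum> G\<^sub>p\<^sub>q\<^sup>2 v\<^sub>p v\<^sub>q + \<delta> \<Sum> G\<^sub>p\<^sub>q
  G\<^sub>q\<^sub>p v\<^sub>p v\<^sub>q\<close>, and the second sum is at most the first.
\<close>

lemma (in prob_space) quadratic_form_variance:
  fixes X Y :: "nat \<Rightarrow> 'a \<Rightarrow> real" and G :: "nat \<Rightarrow> nat \<Rightarrow> real" and v :: "nat \<Rightarrow> real" and \<delta> :: real
  assumes K: "finite K" and v: "\<And>p. p \<in> K \<Longrightarrow> 0 \<le> v p" and \<delta>: "0 \<le> \<delta>" "\<delta> \<le> 1" "\<delta> * \<delta> = \<delta>"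
    and m2: "\<And>p q. p \<in> K \<Longrightarrow> q \<in> K \<Longrightarrow> has_bochner_integral M (\<lambda>\<omega>. X p \<omega> * Y q \<omega>) (\<delta> * (v p * of_bool (p = q)))"
    and m4: "\<And>p q p' q'. p \<in> K \<Longrightarrow> q \<in> K \<Longrightarrow> p' \<in> K \<Longrightarrow> q' \<in> K \<Longrightarrow>
       has_bochner_integral M (\<lambda>\<omega>. X p \<omega> * Y q \<omega> * (X p' \<omega> * Y q' \<omega>))
        (\<delta> * (v p * v p' * of_bool (p = q \<and> p' = q')) + v p * v q * of_bool (p = p' \<and> q = q')
          + \<delta> * (v p * v q * of_bool (p = q' \<and> q = p')))"
  defines "Q \<equiv> \<lambda>\<omega>. \<Sum>p\<in>K. \<Sum>q\<in>K. G p q * (X p \<omega> * Y q \<omega>)"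
    and "c \<equiv> \<delta> * (\<Sum>p\<in>K. G p p * v p)"
  shows "(\<integral>\<^sup>+ \<omega>. ennreal ((Q \<omega> - c)\<^sup>2) \<partial>M) \<le> ennreal (2 * (\<Sum>p\<in>K. \<Sum>q\<in>K. (G p q)\<^sup>2 * v p * v q))"
proof -
  have EQ: "has_bochner_integral M Q c"
  proof -
    have "has_bochner_integral M Q (\<Sum>p\<in>K. \<Sum>q\<in>K. G p q * (\<delta> * (v p * of_bool (p = q))))"
      unfolding Q_def by (intro has_bochner_integral_sum has_bochner_integral_mult_right m2)
    also have "(\<Sum>p\<in>K. \<Sum>q\<in>K. G p q * (\<delta> * (v p * of_bool (p = q)))) = c"
      unfolding c_def sum_distrib_left
    proof (intro sum.cong refl)
      fix p assume p: "p \<in> K"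
      have "(\<Sum>q\<in>K. G p q * (\<delta> * (v p * of_bool (p = q)))) = (\<Sum>q\<in>K. if p = q then \<delta> * (G p p * v p) else 0)"
        by (intro sum.cong) auto
      then show "(\<Sum>q\<in>K. G p q * (\<delta> * (v p * of_bool (p = q)))) = \<delta> * (G p p * v p)" using K p by simp
    qed
    finally show ?thesis .
  qed
  let ?E = "\<lambda>p q p' q'. \<delta> * (v p * v p' * of_bool (p = q \<and> p' = q')) + v p * v q * of_bool (p = p' \<and> q = q')
          + \<delta> * (v p * v q * of_bool (p = q' \<and> q = p'))"
  have EQ2: "has_bochner_integral M (\<lambda>\<omega>. (Q \<omega>)\<^sup>2) (\<Sum>p\<in>K. \<Sum>q\<in>K. \<Sum>p'\<in>K. \<Sum>q'\<in>K. G p q * (G p' q' * ?E p q p' q'))"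
  proof -
    have "has_bochner_integral M (\<lambda>\<omega>. \<Sum>p\<in>K. \<Sum>q\<in>K. \<Sum>p'\<in>K. \<Sum>q'\<in>K. G p q * (G p' q' * (X p \<omega> * Y q \<omega> * (X p' \<omega> * Y q' \<omega>))))
       (\<Sum>p\<in>K. \<Sum>q\<in>K. \<Sum>p'\<in>K. \<Sum>q'\<in>K. G p q * (G p' q' * ?E p q p' q'))"
      by (intro has_bochner_integral_sum has_bochner_integral_mult_right m4)
    moreover have "(\<Sum>p\<in>K. \<Sum>q\<in>K. \<Sum>p'\<in>K. \<Sum>q'\<in>K. G p q * (G p' q' * (X p \<omega> * Y q \<omega> * (X p' \<omega> * Y q' \<omega>)))) = (Q \<omega>)\<^sup>2" for \<omega>
      unfolding Q_def power2_eq_square sum_distrib_right sum_distrib_left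
      by (intro sum.cong refl) (simp only: mult_ac)
    ultimately show ?thesis by simp
  qed
  have inner: "(\<Sum>p'\<in>K. \<Sum>q'\<in>K. G p q * (G p' q' * ?E p q p' q')) =
     of_bool (p = q) * (G p q * v p * c) + (G p q)\<^sup>2 * v p * v q + \<delta> * (G p q * G q p * v p * v q)" if pq: "p \<in> K" "q \<in> K" for p q
  proof -
    have "(\<Sum>q'\<in>K. G p q * (G p' q' * ?E p q p' q')) =
       of_bool (p = q) * (G p q * v p * (\<delta> * (G p' p' * v p'))) + of_bool (p = p') * (G p q * G p' q * v p * v q)
       + of_bool (q = p') * (\<delta> * (G p q * G p' p * v p * v q))" if p': "p' \<in> K" for p'
    proof -
      have "(\<Sum>q'\<in>K. G p q * (G p' q' * ?E p q p' q')) =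
         (\<Sum>q'\<in>K. (if q' = p' then of_bool (p = q) * (G p q * v p * (\<delta> * (G p' p' * v p'))) else 0)
          + (if q' = q then of_bool (p = p') * (G p q * G p' q * v p * v q) else 0)
          + (if q' = p then of_bool (q = p') * (\<delta> * (G p q * G p' p * v p * v q)) else 0))"
        by (intro sum.cong refl) (auto simp: algebra_simps)
      then show ?thesis using K pq p' by (simp add: sum.distrib)
    qed
    then have "(\<Sum>p'\<in>K. \<Sum>q'\<in>K. G p q * (G p' q' * ?E p q p' q')) =
      (\<Sum>p'\<in>K. of_bool (p = q) * (G p q * v p * (\<delta> * (G p' p' * v p'))) + (if p' = p then G p q * G p q * v p * v q else 0)
       + (if p' = q then \<delta> * (G p q * G q p * v p * v q) else 0))"
      by (intro sum.cong) auto
    also have "\<dots> = of_bool (p = q) * (G p q * v p * c) + (G p q)\<^sup>2 * v p * v q + \<delta> * (G p q * G q p * v p * v q)"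
      using K pq by (simp add: sum.distrib c_def sum_distrib_left power2_eq_square)
    finally show ?thesis .
  qed
  let ?S = "\<Sum>p\<in>K. \<Sum>q\<in>K. (G p q)\<^sup>2 * v p * v q"
  let ?T = "\<Sum>p\<in>K. \<Sum>q\<in>K. G p q * G q p * v p * v q"
  have "(\<Sum>p\<in>K. \<Sum>q\<in>K. \<Sum>p'\<in>K. \<Sum>q'\<in>K. G p q * (G p' q' * ?E p q p' q')) =
     (\<Sum>p\<in>K. \<Sum>q\<in>K. of_bool (p = q) * (G p q * v p * c) + (G p q)\<^sup>2 * v p * v q + \<delta> * (G p q * G q p * v p * v q))"
    by (intro sum.cong refl inner)
  also have "\<dots> = (\<Sum>p\<in>K. \<Sum>q\<in>K. of_bool (p = q) * (G p q * v p * c)) + ?S + \<delta> * ?T"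
    by (simp add: sum.distrib sum_distrib_left)
  also have "(\<Sum>p\<in>K. \<Sum>q\<in>K. of_bool (p = q) * (G p q * v p * c)) = (\<Sum>p\<in>K. G p p * v p) * c"
    unfolding sum_distrib_right
  proof (intro sum.cong refl)
    fix p assume p: "p \<in> K"
    have "(\<Sum>q\<in>K. of_bool (p = q) * (G p q * v p * c)) = (\<Sum>q\<in>K. if p = q then G p p * v p * c else 0)"
      by (intro sum.cong) auto
    then show "(\<Sum>q\<in>K. of_bool (p = q) * (G p q * v p * c)) = G p p * v p * c" using K p by simp
  qed
  finally have val: "(\<Sum>p\<in>K. \<Sum>q\<in>K. \<Sum>p'\<in>K. \<Sum>q'\<in>K. G p q * (G p' q' * ?E p q p' q')) =
     (\<Sum>p\<in>K. G p p * v p) * c + ?S + \<delta> * ?T" .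
  have \<delta>c: "(\<Sum>p\<in>K. G p p * v p) * c = c * c"
  proof -
    have "S * (\<delta> * S) = (\<delta> * S) * (\<delta> * S)" for S
    proof -
      have "(\<delta> * S) * (\<delta> * S) = (\<delta> * \<delta>) * (S * S)" by (simp only: mult_ac)
      also have "\<dots> = S * (\<delta> * S)" unfolding \<delta>(3) by (simp only: mult_ac)
      finally show ?thesis by simp
    qed
    then show ?thesis unfolding c_def .
  qed
  have TS: "?T \<le> ?S"
  proof -
    have "?T \<le> (\<Sum>p\<in>K. \<Sum>q\<in>K. ((G p q)\<^sup>2 * v p * v q + (G q p)\<^sup>2 * v q * v p) / 2)"
    proof (intro sum_mono)
      fix p q assume pq: "p \<in> K" "q \<in> K"
      have "G p q * G q p \<le> ((G p q)\<^sup>2 + (G q p)\<^sup>2) / 2" using sum_squares_bound[of "G p q" "G q p"] by simp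
      then have "G p q * G q p * (v p * v q) \<le> ((G p q)\<^sup>2 + (G q p)\<^sup>2) / 2 * (v p * v q)"
        by (rule mult_right_mono) (use v pq in auto)
      then show "G p q * G q p * v p * v q \<le> ((G p q)\<^sup>2 * v p * v q + (G q p)\<^sup>2 * v q * v p) / 2"
        by (simp add: algebra_simps)
    qed
    also have "\<dots> = (?S + (\<Sum>p\<in>K. \<Sum>q\<in>K. (G q p)\<^sup>2 * v q * v p)) / 2"
      by (simp add: sum.distrib sum_divide_distrib[symmetric] add_divide_distrib)
    also have "(\<Sum>p\<in>K. \<Sum>q\<in>K. (G q p)\<^sup>2 * v q * v p) = ?S" by (rule sum.swap)
    finally show ?thesis by simp
  qed
  have S0: "0 \<le> ?S" using v by (intro sum_nonneg mult_nonneg_nonneg) auto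
  have \<delta>T: "\<delta> * ?T \<le> ?S"
  proof (cases "?T \<ge> 0")
    case True
    then have "\<delta> * ?T \<le> 1 * ?T" using \<delta> by (intro mult_right_mono) auto
    with TS show ?thesis by simp
  next
    case False
    then have "\<delta> * ?T \<le> 0" using \<delta> by (simp add: mult_nonneg_nonpos)
    with S0 show ?thesis by simp
  qed
  have i: "integrable M Q" "integrable M (\<lambda>\<omega>. (Q \<omega>)\<^sup>2)" using EQ EQ2 by (auto simp: has_bochner_integral_iff)
  have "expectation (\<lambda>\<omega>. (Q \<omega> - c)\<^sup>2) = expectation (\<lambda>\<omega>. (Q \<omega>)\<^sup>2 - 2 * c * Q \<omega> + c\<^sup>2)"
    by (simp add: power2_diff algebra_simps)
  also have "\<dots> = expectation (\<lambda>\<omega>. (Q \<omega>)\<^sup>2) - 2 * c * expectation Q + c\<^sup>2"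
    using i by (simp add: prob_space)
  also have "\<dots> = ?S + \<delta> * ?T"
    using EQ EQ2 val \<delta>c by (simp add: has_bochner_integral_iff power2_eq_square)
  finally have "expectation (\<lambda>\<omega>. (Q \<omega> - c)\<^sup>2) \<le> 2 * ?S" using \<delta>T by simp
  moreover have "integrable M (\<lambda>\<omega>. (Q \<omega> - c)\<^sup>2)"
    unfolding power2_diff using i by auto
  ultimately show ?thesis
    by (subst nn_integral_eq_integral) (auto intro: ennreal_leI)
qed

context wiener begin

lemma increments_indep:
  assumes \<tau>: "partition \<tau> n"
  shows "indep_vars (\<lambda>_. borel) (\<lambda>(r, k) \<omega>. W r (\<tau> (Suc k)) \<omega> - W r (\<tau> k) \<omega>) ({1..d} \<times> {..<n})"
proof -
  have "strict_mono_on {0..n} \<tau>" using \<tau> by (simp add: partition_def)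
  moreover have "\<tau> ` {0..n} \<subseteq> {0..1}" using partition_bounds[OF \<tau>] by auto
  ultimately show ?thesis using wiener unfolding wiener_process_def by blast
qed

lemma increments_quadratic_form:
  fixes G :: "nat \<Rightarrow> nat \<Rightarrow> real"
  assumes \<tau>: "partition \<tau> n" and r: "r \<in> {1..d}" "r' \<in> {1..d}"
  defines "\<Delta> \<equiv> \<lambda>r k \<omega>. W r (\<tau> (Suc k)) \<omega> - W r (\<tau> k) \<omega>"
    and "v \<equiv> \<lambda>k. \<tau> (Suc k) - \<tau> k"
  shows "l2 (\<lambda>\<omega>. (\<Sum>p<n. \<Sum>q<n. G p q * (\<Delta> r p \<omega> * \<Delta> r' q \<omega>)) - of_bool (r = r') * (\<Sum>p<n. G p p * v p))
    \<le> ennreal (2 * (\<Sum>p<n. \<Sum>q<n. (G p q)\<^sup>2 * v p * v q))"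
  unfolding l2_def
proof (rule quadratic_form_variance)
  let ?I = "{1..d} \<times> {..<n}"
  let ?Z = "\<lambda>(r, k) \<omega>. W r (\<tau> (Suc k)) \<omega> - W r (\<tau> k) \<omega>"
  let ?v = "\<lambda>(r::nat, k). \<tau> (Suc k) - \<tau> k"
  have b: "0 \<le> \<tau> k" "\<tau> k \<le> \<tau> (Suc k)" "\<tau> (Suc k) \<le> 1" if "k < n" for k
    using partition_bounds[OF \<tau>] partition_le_iff[OF \<tau>, of k "Suc k"] that by auto
  have mom: "integrable M (\<lambda>\<omega>. ?Z x \<omega> ^ n')" "expectation (?Z x) = 0" "expectation (\<lambda>\<omega>. (?Z x \<omega>)\<^sup>2) = ?v x"
    "expectation (\<lambda>\<omega>. ?Z x \<omega> ^ 3) = 0" "expectation (\<lambda>\<omega>. ?Z x \<omega> ^ 4) = 3 * (?v x)\<^sup>2" if xI: "x \<in> ?I" for x n'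
  proof -
    obtain r k where x: "x = (r, k)" "r \<in> {1..d}" "k < n" using xI by auto
    note * = b[OF x(3)] x(2)
    show "integrable M (\<lambda>\<omega>. ?Z x \<omega> ^ n')" "expectation (?Z x) = 0" "expectation (\<lambda>\<omega>. (?Z x \<omega>)\<^sup>2) = ?v x"
      "expectation (\<lambda>\<omega>. ?Z x \<omega> ^ 3) = 0" "expectation (\<lambda>\<omega>. ?Z x \<omega> ^ 4) = 3 * (?v x)\<^sup>2"
      unfolding x(1) prod.case
      by (rule integrable_increment_power[OF *] expectation_increment[OF *] expectation_increment_power2[OF *]
          expectation_increment_power3[OF *] expectation_increment_power4[OF *])+
  qed
  note ind = increments_indep[OF \<tau>]
  show "finite {..<n}" by simp
  show "0 \<le> v p" if "p \<in> {..<n}" for p using b[of p] that by (simp add: v_def)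
  show "(0::real) \<le> of_bool (r = r')" "of_bool (r = r') \<le> (1::real)" "of_bool (r = r') * of_bool (r = r') = (of_bool (r = r') :: real)" by auto
  show "has_bochner_integral M (\<lambda>\<omega>. \<Delta> r p \<omega> * \<Delta> r' q \<omega>) (of_bool (r = r') * (v p * of_bool (p = q)))"
    if "p \<in> {..<n}" "q \<in> {..<n}" for p q
    using second_moment_indep[OF _ ind mom(1-3), of "(r, p)" "(r', q)"] that r
    by (simp add: \<Delta>_def v_def of_bool_conj mult_ac)
  show "has_bochner_integral M (\<lambda>\<omega>. \<Delta> r p \<omega> * \<Delta> r' q \<omega> * (\<Delta> r p' \<omega> * \<Delta> r' q' \<omega>))
        (of_bool (r = r') * (v p * v p' * of_bool (p = q \<and> p' = q')) + v p * v q * of_bool (p = p' \<and> q = q')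
          + of_bool (r = r') * (v p * v q * of_bool (p = q' \<and> q = p')))"
    if "p \<in> {..<n}" "q \<in> {..<n}" "p' \<in> {..<n}" "q' \<in> {..<n}" for p q p' q'
    using fourth_moment_indep[OF _ ind mom, of "(r, p)" "(r', q)" "(r, p')" "(r', q')"] that r
    by (cases "r = r'") (simp_all add: \<Delta>_def v_def)
qed

end

section \<open>Refinement of grids\<close>

lemma partition_exists:
  assumes "finite P" "P \<subseteq> {0..1}" "0 \<in> P" "1 \<in> P"
  obtains n \<tau> where "partition \<tau> n" "\<tau> ` {0..n} = P"
proof -
  obtain n \<tau> where \<tau>: "strict_mono_on {0..n::nat} \<tau>" "\<tau> ` {0..n} = P"
    using finite_set_enumeration[of P] assms by auto
  have mono: "i \<le> j \<Longrightarrow> j \<le> n \<Longrightarrow> \<tau> i \<le> \<tau> j" for i j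
    using strict_mono_onD[OF \<tau>(1), of i j] by (cases "i = j") auto
  have in01: "0 \<le> \<tau> i" "\<tau> i \<le> 1" if "i \<le> n" for i
  proof -
    have "\<tau> i \<in> P" unfolding \<tau>(2)[symmetric] using that by simp
    then show "0 \<le> \<tau> i" "\<tau> i \<le> 1" using assms(2) by auto
  qed
  from assms(3) obtain k where k: "k \<le> n" "\<tau> k = 0" unfolding \<tau>(2)[symmetric] by auto
  from assms(4) obtain l where l: "l \<le> n" "\<tau> l = 1" unfolding \<tau>(2)[symmetric] by auto
  have "\<tau> 0 = 0" using mono[of 0 k] k in01[of 0] by simp
  moreover have "\<tau> n = 1" using mono[of l n] l in01[of n] by simp
  ultimately show ?thesis using \<tau> by (intro that[of \<tau> n]) (auto simp: partition_def)
qed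

definition refines :: "(nat \<Rightarrow> real) \<Rightarrow> nat \<Rightarrow> (nat \<Rightarrow> real) \<Rightarrow> nat \<Rightarrow> bool" where
  "refines \<tau> n t N \<longleftrightarrow> t ` {0..N} \<subseteq> \<tau> ` {0..n}"

lemma step_on_refines:
  assumes \<tau>: "partition \<tau> n" and t: "partition t N" and ref: "refines \<tau> n t N" and c: "step_on t N c"
  shows "step_on \<tau> n c"
  unfolding step_on_def
proof (intro allI impI ballI)
  fix k s assume k: "k < n" and s: "s \<in> {\<tau> k..<\<tau> (Suc k)}"
  have "0 \<le> \<tau> k" "\<tau> k < 1"
    using partition_bounds[OF \<tau>, of k] partition_less_iff[OF \<tau>, of k n] k \<tau> by (auto simp: partition_def)
  from partition_cell[OF t this] obtain q where q: "q < N" "t q \<le> \<tau> k" "\<tau> k < t (Suc q)" .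
  then have "t (Suc q) \<in> \<tau> ` {0..n}" using ref by (auto simp: refines_def)
  then obtain l where l: "l \<le> n" "t (Suc q) = \<tau> l" by auto
  with q have "k < l" using partition_less_iff[OF \<tau>, of k l] k by simp
  then have "\<tau> (Suc k) \<le> t (Suc q)" using partition_le_iff[OF \<tau>, of "Suc k" l] k l by simp
  with s q have "s \<in> {t q..<t (Suc q)}" "\<tau> k \<in> {t q..<t (Suc q)}" by auto
  then have "c s = c (t q)" "c (\<tau> k) = c (t q)"
    using c[unfolded step_on_def, rule_format, OF q(1)] by blast+
  then show "c s = c (\<tau> k)" by simp
qed

lemma step_on_comp2: "step_on \<tau> n f \<Longrightarrow> step_on \<tau> n g \<Longrightarrow> step_on \<tau> n (\<lambda>s. h (f s) (g s))"
  unfolding step_on_def by metis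

lemma step_on_indicator:
  assumes \<tau>: "partition \<tau> n" and xy: "x \<in> \<tau> ` {0..n}" "y \<in> \<tau> ` {0..n}"
  shows "step_on \<tau> n (indicator {x..<y} :: real \<Rightarrow> real)"
  unfolding step_on_def
proof (intro allI impI ballI)
  fix k s assume k: "k < n" and s: "s \<in> {\<tau> k..<\<tau> (Suc k)}"
  have "z \<le> s \<longleftrightarrow> z \<le> \<tau> k" if "z \<in> \<tau> ` {0..n}" for z
  proof -
    from that obtain l where l: "l \<le> n" "z = \<tau> l" by auto
    have "z \<le> \<tau> k \<or> \<tau> (Suc k) \<le> z"
      using partition_le_iff[OF \<tau>, of l k] partition_le_iff[OF \<tau>, of "Suc k" l] l k by auto
    then show ?thesis using s by auto
  qed
  from this[OF xy(1)] this[OF xy(2)] show "indicator {x..<y} s = (indicator {x..<y} (\<tau> k) :: real)"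
    unfolding indicator_def by (auto simp: not_le[symmetric])
qed

lemma partition_telescope:
  fixes f :: "real \<Rightarrow> real"
  assumes \<tau>: "partition \<tau> n" and ij: "i \<le> j" "j \<le> n"
  shows "f (\<tau> j) - f (\<tau> i) = (\<Sum>p<n. (f (\<tau> (Suc p)) - f (\<tau> p)) * indicator {\<tau> i..<\<tau> j} (\<tau> p))"
proof -
  have "(\<Sum>p<n. (f (\<tau> (Suc p)) - f (\<tau> p)) * indicator {\<tau> i..<\<tau> j} (\<tau> p)) =
      (\<Sum>p\<in>{i..<j}. f (\<tau> (Suc p)) - f (\<tau> p))"
  proof (rule sum.mono_neutral_cong_right)
    show "\<forall>p\<in>{..<n} - {i..<j}. (f (\<tau> (Suc p)) - f (\<tau> p)) * indicator {\<tau> i..<\<tau> j} (\<tau> p) = 0"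
      using partition_less_iff[OF \<tau>, of _ j] partition_le_iff[OF \<tau>, of i] ij by auto
    show "(f (\<tau> (Suc p)) - f (\<tau> p)) * indicator {\<tau> i..<\<tau> j} (\<tau> p) = f (\<tau> (Suc p)) - f (\<tau> p)" if "p \<in> {i..<j}" for p
      using partition_less_iff[OF \<tau>, of p j] partition_le_iff[OF \<tau>, of i p] ij that by auto
  qed (use ij in auto)
  also have "\<dots> = f (\<tau> j) - f (\<tau> i)" using sum_Suc_diff'[OF ij(1), of "\<lambda>p. f (\<tau> p)"] by simp
  finally show ?thesis by simp
qed

text \<open>
  The increment over a coarse cell telescopes into the increments over the fine cells that start
  in it, and \<open>c\<close> takes the same value at all these starting points.
\<close>

lemma weighted_increments_refines:
  assumes \<tau>: "partition \<tau> n" and t: "partition t N" and ref: "refines \<tau> n t N" and c: "step_on t N c"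
  shows "weighted_increments t N c Y \<omega> = weighted_increments \<tau> n c Y \<omega>"
proof -
  have "weighted_increments t N c Y \<omega> =
    (\<Sum>q<N. c (t q) * (\<Sum>p<n. (Y (\<tau> (Suc p)) \<omega> - Y (\<tau> p) \<omega>) * indicator {t q..<t (Suc q)} (\<tau> p)))"
    unfolding weighted_increments_def
  proof (intro sum.cong refl)
    fix q assume q: "q \<in> {..<N}"
    then have "t q \<in> \<tau> ` {0..n}" "t (Suc q) \<in> \<tau> ` {0..n}" using ref by (auto simp: refines_def)
    then obtain i j where ij: "i \<le> n" "t q = \<tau> i" "j \<le> n" "t (Suc q) = \<tau> j" by auto
    have "\<tau> i \<le> \<tau> j" using partition_le_iff[OF t, of q "Suc q"] q ij by simp
    then have "i \<le> j" using partition_le_iff[OF \<tau>, of i j] ij by simp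
    from partition_telescope[OF \<tau> this ij(3), of "\<lambda>u. Y u \<omega>"]
    show "c (t q) * (Y (t (Suc q)) \<omega> - Y (t q) \<omega>) =
      c (t q) * (\<Sum>p<n. (Y (\<tau> (Suc p)) \<omega> - Y (\<tau> p) \<omega>) * indicator {t q..<t (Suc q)} (\<tau> p))"
      unfolding ij by simp
  qed
  also have "\<dots> = (\<Sum>p<n. \<Sum>q<N. c (t q) * indicator {t q..<t (Suc q)} (\<tau> p) * (Y (\<tau> (Suc p)) \<omega> - Y (\<tau> p) \<omega>))"
    unfolding sum_distrib_left by (subst sum.swap) (intro sum.cong refl, simp only: mult_ac)
  also have "\<dots> = weighted_increments \<tau> n c Y \<omega>"
    unfolding weighted_increments_def
  proof (intro sum.cong refl)
    fix p assume p: "p \<in> {..<n}"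
    have "0 \<le> \<tau> p" "\<tau> p < 1"
      using partition_bounds[OF \<tau>, of p] partition_less_iff[OF \<tau>, of p n] p \<tau> by (auto simp: partition_def)
    from step_on_eq_sum[OF t c this]
    show "(\<Sum>q<N. c (t q) * indicator {t q..<t (Suc q)} (\<tau> p) * (Y (\<tau> (Suc p)) \<omega> - Y (\<tau> p) \<omega>)) =
      c (\<tau> p) * (Y (\<tau> (Suc p)) \<omega> - Y (\<tau> p) \<omega>)"
      by (simp only: sum_distrib_right)
  qed
  finally show ?thesis .
qed

lemma step_on_measurable:
  fixes c :: "real \<Rightarrow> real"
  assumes "partition \<tau> n" "step_on \<tau> n c"
  shows "c \<in> borel_measurable \<U>"
proof -
  have "(\<lambda>s. \<Sum>k<n. c (\<tau> k) * indicator {\<tau> k..<\<tau> (Suc k)} s) \<in> borel_measurable \<U>" by measurable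
  then show ?thesis
    by (rule measurable_cong[THEN iffD2, rotated]) (simp only: space_unit_interval atLeastLessThan_iff, elim conjE, rule step_on_eq_sum[OF assms])
qed

lemma integral_step_on:
  fixes f :: "real \<Rightarrow> real"
  assumes \<tau>: "partition \<tau> n" and f: "step_on \<tau> n f"
  shows "(\<integral>s. f s \<partial>\<U>) = (\<Sum>k<n. f (\<tau> k) * (\<tau> (Suc k) - \<tau> k))"
proof -
  have "(\<integral>s. f s \<partial>\<U>) = (\<integral>s. (\<Sum>k<n. f (\<tau> k) * indicator {\<tau> k..<\<tau> (Suc k)} s) \<partial>\<U>)"
    by (rule Bochner_Integration.integral_cong[OF refl])
       (simp only: space_unit_interval atLeastLessThan_iff, elim conjE, rule step_on_eq_sum[OF assms])
  also have "\<dots> = (\<Sum>k<n. f (\<tau> k) * (\<integral>s. indicator {\<tau> k..<\<tau> (Suc k)} s \<partial>\<U>))"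
  proof -
    have "integrable \<U> (indicator {\<tau> k..<\<tau> (Suc k)} :: real \<Rightarrow> real)" for k
      by (intro unit_interval.integrable_const_bound[where B=1] AE_I2 indicator_measurable_unit_interval) (simp add: indicator_def)
    then show ?thesis by (subst Bochner_Integration.integral_sum) (simp_all only: integrable_mult_right integral_mult_right_zero)
  qed
  also have "\<dots> = (\<Sum>k<n. f (\<tau> k) * (\<tau> (Suc k) - \<tau> k))"
  proof (intro sum.cong refl arg_cong2[of _ _ _ _ "(*)"])
    fix k assume k: "k \<in> {..<n}"
    have "0 \<le> \<tau> k" "\<tau> (Suc k) \<le> 1" "\<tau> k \<le> \<tau> (Suc k)"
      using partition_bounds[OF \<tau>] partition_le_iff[OF \<tau>, of k "Suc k"] k by auto
    then show "(\<integral>s. indicator {\<tau> k..<\<tau> (Suc k)} s \<partial>\<U>) = \<tau> (Suc k) - \<tau> k"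
      by (subst integral_unit_interval_indicator) auto
  qed
  finally show ?thesis .
qed

lemma integral_unit_interval_closed:
  fixes f :: "real \<Rightarrow> real"
  assumes f: "f \<in> borel_measurable \<U>"
  shows "(LINT s:{0..1}|lborel. f s) = (\<integral>s. f s \<partial>\<U>)"
proof -
  have m: "(\<lambda>s. indicator {0..<1} s * f s) \<in> borel_measurable lborel"
    using f by (subst (asm) borel_measurable_restrict_space_iff) (simp_all add: mult.commute)
  have "(\<lambda>s. indicator {0..1} s * f s) = (\<lambda>s. indicator {0..<1} s * f s + indicator {1} s * f 1)"
    by (rule ext) (auto split: split_indicator)
  then have m': "(\<lambda>s. indicator {0..1} s * f s) \<in> borel_measurable lborel"
    using m by simp
  have "(\<integral>s. f s \<partial>\<U>) = (\<integral>s. indicator {0..<1} s * f s \<partial>lborel)"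
    by (subst integral_restrict_space) (simp_all add: set_lebesgue_integral_def)
  also have "\<dots> = (\<integral>s. indicator {0..1} s * f s \<partial>lborel)"
    by (rule integral_cong_AE[OF m m'], rule AE_mp[OF AE_lborel_singleton[of 1]]) (auto split: split_indicator)
  finally show ?thesis by (simp add: set_lebesgue_integral_def)
qed

section \<open>The SIML kernel\<close>

locale sampling =
  fixes J :: nat and N :: "nat \<Rightarrow> nat \<Rightarrow> nat" and t :: "nat \<Rightarrow> nat \<Rightarrow> nat \<Rightarrow> real"
    and \<phi> :: "nat \<Rightarrow> nat \<Rightarrow> real \<Rightarrow> real" and m :: "nat \<Rightarrow> nat"
  assumes grid: "\<And>i. sampling_grid J (N i) (t i)"
    and \<phi>: "\<And>i. \<phi> i \<in> Pi_star J (N i) (t i)"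
    and m_ge_1: "\<And>i. m i \<ge> 1"
    and mesh: "(\<lambda>i. grid_mesh J (N i) (t i)) \<longlonglongrightarrow> 0"
    and m_lim: "filterlim m at_top sequentially"
    and kernel_lim: "\<And>j j' g. j \<in> {1..J} \<Longrightarrow> j' \<in> {1..J} \<Longrightarrow> continuous_on {0..1} g \<Longrightarrow>
      (\<lambda>i. LINT s:{0..1}|lborel. siml_kernel (m i) (\<phi> i j) (\<phi> i j') s s * g s)
        \<longlonglongrightarrow> (LINT s:{0..1}|lborel. g s)"
begin

lemma partition_grid: "j \<in> {1..J} \<Longrightarrow> partition (t i j) (N i j)"
  using grid[of i] by (simp add: sampling_grid_def partition_def)

lemma \<phi>_cell:
  assumes "j \<in> {1..J}" "k < N i j"
  obtains c where "t i j k \<le> c" "c \<le> t i j (Suc k)" "\<And>s. t i j k \<le> s \<Longrightarrow> s < t i j (Suc k) \<Longrightarrow> \<phi> i j s = c"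
proof -
  have "\<forall>k\<in>{1..N i j}. \<exists>c\<in>{t i j (k - 1)..t i j k}. \<forall>s\<in>{t i j (k - 1)..<t i j k}. \<phi> i j s = c"
    using \<phi>[of i] assms(1) unfolding Pi_star_def by blast
  then have "\<exists>c\<in>{t i j (Suc k - 1)..t i j (Suc k)}. \<forall>s\<in>{t i j (Suc k - 1)..<t i j (Suc k)}. \<phi> i j s = c"
    using assms(2) by (rule_tac bspec) auto
  then show ?thesis using that by auto
qed

lemma step_on_\<phi>: "j \<in> {1..J} \<Longrightarrow> step_on (t i j) (N i j) (\<phi> i j)"
  unfolding step_on_def
proof (intro allI impI ballI)
  fix k s assume j: "j \<in> {1..J}" and k: "k < N i j" and s: "s \<in> {t i j k..<t i j (Suc k)}"
  obtain c where "\<And>s. t i j k \<le> s \<Longrightarrow> s < t i j (Suc k) \<Longrightarrow> \<phi> i j s = c" by (rule \<phi>_cell[OF j k]) blast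
  from this[of s] this[of "t i j k"] s show "\<phi> i j s = \<phi> i j (t i j k)" by simp
qed

lemma \<phi>_measurable [measurable (raw)]: "j \<in> {1..J} \<Longrightarrow> \<phi> i j \<in> borel_measurable \<U>"
  by (rule step_on_measurable[OF partition_grid step_on_\<phi>])

lemma grid_step_le_mesh:
  assumes "j \<in> {1..J}" "k < N i j"
  shows "t i j (Suc k) - t i j k \<le> grid_mesh J (N i) (t i)"
proof -
  let ?S = "{\<bar>t i j k - t i j (k - 1)\<bar> | j k. j \<in> {1..J} \<and> k \<in> {1..N i j}}"
  have "?S \<subseteq> (\<Union>j\<in>{1..J}. (\<lambda>k. \<bar>t i j k - t i j (k - 1)\<bar>) ` {1..N i j})" by blast
  then have fin: "finite ?S" by (rule finite_subset) simp
  have "Suc k \<in> {1..N i j}" using assms(2) by simp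
  with assms(1) have "\<bar>t i j (Suc k) - t i j (Suc k - 1)\<bar> \<in> ?S" by blast
  from Max_ge[OF fin this] show ?thesis unfolding grid_mesh_def by simp
qed

lemma \<phi>_near:
  assumes j: "j \<in> {1..J}" and s: "0 \<le> s" "s < 1"
  shows "\<bar>\<phi> i j s - s\<bar> \<le> grid_mesh J (N i) (t i)"
proof -
  obtain k where k: "k < N i j" "t i j k \<le> s" "s < t i j (Suc k)"
    by (rule partition_cell[OF partition_grid[OF j] s])
  obtain c where c: "t i j k \<le> c" "c \<le> t i j (Suc k)" "\<And>s. t i j k \<le> s \<Longrightarrow> s < t i j (Suc k) \<Longrightarrow> \<phi> i j s = c"
    by (rule \<phi>_cell[OF j k(1)]) blast
  have "\<phi> i j s = c" by (rule c(3)[OF k(2,3)])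
  with c(1,2) k grid_step_le_mesh[OF j k(1)] show ?thesis by linarith
qed

lemma \<phi>_tendsto:
  assumes "j \<in> {1..J}" "0 \<le> s" "s < 1"
  shows "(\<lambda>i. \<phi> i j s) \<longlonglongrightarrow> s"
proof -
  have "(\<lambda>i. \<phi> i j s - s) \<longlonglongrightarrow> 0"
    by (rule Lim_null_comparison[OF _ mesh]) (use \<phi>_near[OF assms] in \<open>auto intro: always_eventually\<close>)
  then show ?thesis by (simp add: LIM_zero_iff)
qed

abbreviation kernel :: "nat \<Rightarrow> nat \<Rightarrow> nat \<Rightarrow> real \<Rightarrow> real \<Rightarrow> real" where
  "kernel i j j' \<equiv> siml_kernel (m i) (\<phi> i j) (\<phi> i j')"

lemma kernel_bound: "\<bar>kernel i j j' u s\<bar> \<le> 2"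
proof -
  have "\<bar>\<Sum>l=1..m i. cos ((real l - 1/2) * pi * \<phi> i j u) * cos ((real l - 1/2) * pi * \<phi> i j' s)\<bar> \<le> (\<Sum>l=1..m i. 1)"
    by (rule order_trans[OF sum_abs sum_mono]) (auto simp: abs_mult intro!: mult_le_one)
  then show ?thesis unfolding siml_kernel_eq_sum using m_ge_1[of i]
    by (simp add: abs_mult field_simps)
qed

lemma kernel_measurable2 [measurable]:
  assumes "j \<in> {1..J}" "j' \<in> {1..J}"
  shows "(\<lambda>(u, s). kernel i j j' u s) \<in> borel_measurable (\<U> \<Otimes>\<^sub>M \<U>)"
  unfolding siml_kernel_eq_sum split_beta
  by (intro borel_measurable_times borel_measurable_const borel_measurable_sum
      borel_measurable_continuous_on[of cos, OF _ borel_measurable_times[OF borel_measurable_const]]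
      measurable_compose[OF measurable_fst \<phi>_measurable] measurable_compose[OF measurable_snd \<phi>_measurable]
      continuous_intros) (use assms in auto)

lemma kernel_measurable:
  assumes "j \<in> {1..J}" "j' \<in> {1..J}" "f \<in> \<U> \<rightarrow>\<^sub>M \<U>" "g \<in> \<U> \<rightarrow>\<^sub>M \<U>"
  shows "(\<lambda>s. kernel i j j' (f s) (g s)) \<in> borel_measurable \<U>"
  using measurable_compose[OF measurable_Pair[OF assms(3,4)] kernel_measurable2[OF assms(1,2)]] by simp

text \<open>
  Near \<open>y\<close> the denominator stays away from 0, so the quotient is bounded and the factor \<open>1/m\<close>
  decides.
\<close>

lemma sin_ratio_tendsto:
  assumes x: "x \<longlonglongrightarrow> y" and y: "sin (pi * y / 2) \<noteq> 0"
  shows "(\<lambda>i. 1 / (2 * real (m i)) * sin_ratio (m i) (x i)) \<longlonglongrightarrow> 0"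
proof (rule Lim_null_comparison)
  have lim: "(\<lambda>i. sin (pi * x i / 2)) \<longlonglongrightarrow> sin (pi * y / 2)" by (intro tendsto_intros x) simp
  then have ev: "\<forall>\<^sub>F i in sequentially. sin (pi * x i / 2) \<noteq> 0"
    by (rule tendsto_imp_eventually_ne[OF _ y])
  show "\<forall>\<^sub>F i in sequentially. norm (1 / (2 * real (m i)) * sin_ratio (m i) (x i)) \<le> 1 / (2 * real (m i)) * (1 / \<bar>sin (pi * x i / 2)\<bar>)"
    using ev
  proof eventually_elim
    case (elim i)
    have "\<bar>sin_ratio (m i) (x i)\<bar> \<le> 1 / \<bar>sin (pi * x i / 2)\<bar>"
      using elim by (simp add: sin_ratio_def abs_divide divide_right_mono)
    then have "1 / (2 * real (m i)) * \<bar>sin_ratio (m i) (x i)\<bar> \<le> 1 / (2 * real (m i)) * (1 / \<bar>sin (pi * x i / 2)\<bar>)"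
      by (rule mult_left_mono) simp
    then show ?case by (simp add: abs_mult)
  qed
  have "filterlim (\<lambda>i. 2 * real (m i)) at_top sequentially"
    by (intro filterlim_tendsto_pos_mult_at_top[OF tendsto_const] filterlim_compose[OF filterlim_real_sequentially m_lim]) simp
  then have "(\<lambda>i. 1 / (2 * real (m i))) \<longlonglongrightarrow> 0"
    by (rule tendsto_divide_0[OF tendsto_const filterlim_at_top_imp_at_infinity])
  moreover have "(\<lambda>i. 1 / \<bar>sin (pi * x i / 2)\<bar>) \<longlonglongrightarrow> 1 / \<bar>sin (pi * y / 2)\<bar>"
    by (intro tendsto_intros lim) (use y in simp)
  ultimately show "(\<lambda>i. 1 / (2 * real (m i)) * (1 / \<bar>sin (pi * x i / 2)\<bar>)) \<longlonglongrightarrow> 0"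
    using tendsto_mult by fastforce
qed

lemma kernel_tendsto_0:
  assumes j: "j \<in> {1..J}" "j' \<in> {1..J}" and us: "0 < u" "u < 1" "0 < s" "s < 1" "u \<noteq> s"
  shows "(\<lambda>i. kernel i j j' u s) \<longlonglongrightarrow> 0"
proof -
  have "pi * (u + s) < pi * 2" by (rule mult_strict_left_mono) (use us in auto)
  then have "sin (pi * (u + s) / 2) \<noteq> 0"
    using us by (intro less_imp_neq[THEN not_sym] sin_gt_zero) auto
  moreover have "sin (pi * (u - s) / 2) \<noteq> 0"
  proof
    assume 0: "sin (pi * (u - s) / 2) = 0"
    have "\<bar>pi * (u - s) / 2\<bar> < pi" using us by (simp add: abs_mult abs_less_iff)
    with 0 have "pi * (u - s) / 2 = 0" using sin_eq_0_pi[of "pi * (u - s) / 2"] by linarith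
    with us show False by simp
  qed
  ultimately show ?thesis unfolding siml_kernel_def
    using us by (intro tendsto_add_zero sin_ratio_tendsto[where y="u + s"] sin_ratio_tendsto[where y="u - s"]
      tendsto_add tendsto_diff \<phi>_tendsto j) auto
qed

lemma AE_unit_interval_neq: "AE s in \<U>. s \<noteq> a"
  using AE_lborel_singleton[of a] by (simp add: AE_restrict_space_iff) (erule eventually_mono, simp)

text \<open>
  The \<open>L\<^sup>1\<close> norm of a row of the kernel, as it occurs in Schur's test.
\<close>

definition kernel_mass :: "nat \<Rightarrow> nat \<Rightarrow> nat \<Rightarrow> real \<Rightarrow> real" where
  "kernel_mass i j j' u = (\<integral>s. \<bar>kernel i j j' u s\<bar> \<partial>\<U>)"

lemma kernel_section_measurable:
  assumes "j \<in> {1..J}" "j' \<in> {1..J}" "0 \<le> u" "u < 1"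
  shows "(\<lambda>s. kernel i j j' u s) \<in> borel_measurable \<U>"
  by (rule kernel_measurable[OF assms(1,2)]) (use assms in simp_all)

lemma kernel_section_integrable:
  assumes "j \<in> {1..J}" "j' \<in> {1..J}" "0 \<le> u" "u < 1"
  shows "integrable \<U> (\<lambda>s. \<bar>kernel i j j' u s\<bar>)"
  by (rule unit_interval.integrable_const_bound[where B=2])
     (use kernel_bound kernel_section_measurable[OF assms] in auto)

lemma kernel_mass_tendsto_0:
  assumes j: "j \<in> {1..J}" "j' \<in> {1..J}" and u: "0 < u" "u < 1"
  shows "(\<lambda>i. kernel_mass i j j' u) \<longlonglongrightarrow> 0"
proof -
  have "(\<lambda>i. \<integral>s. \<bar>kernel i j j' u s\<bar> \<partial>\<U>) \<longlonglongrightarrow> (\<integral>s. 0 \<partial>\<U>)"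
  proof (rule integral_dominated_convergence[where w="\<lambda>_. 2"])
    show "AE s in \<U>. (\<lambda>i. \<bar>kernel i j j' u s\<bar>) \<longlonglongrightarrow> 0"
      using AE_unit_interval_neq[of 0] AE_unit_interval_neq[of u] AE_space
    proof eventually_elim
      case (elim s)
      then have "(\<lambda>i. kernel i j j' u s) \<longlonglongrightarrow> 0" using u by (intro kernel_tendsto_0 j) auto
      then show ?case by (rule tendsto_rabs_zero)
    qed
    show "(\<lambda>s. \<bar>kernel i j j' u s\<bar>) \<in> borel_measurable \<U>" for i
      using kernel_section_measurable[OF j, of u i] u by simp
  qed (use kernel_bound in auto)
  then show ?thesis by (simp add: kernel_mass_def)
qed

lemma kernel_mass_measurable:
  assumes "j \<in> {1..J}" "j' \<in> {1..J}"
  shows "kernel_mass i j j' \<in> borel_measurable \<U>"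
  unfolding kernel_mass_def[abs_def]
  by (rule unit_interval.borel_measurable_lebesgue_integral)
     (use kernel_measurable2[OF assms, of i] in \<open>simp add: split_beta\<close>)

lemma kernel_mass_bounds:
  assumes "j \<in> {1..J}" "j' \<in> {1..J}" "0 \<le> u" "u < 1"
  shows "0 \<le> kernel_mass i j j' u" "kernel_mass i j j' u \<le> 2"
proof -
  show "0 \<le> kernel_mass i j j' u" unfolding kernel_mass_def by (rule Bochner_Integration.integral_nonneg) simp
  have "kernel_mass i j j' u \<le> (\<integral>s. 2 \<partial>\<U>)" unfolding kernel_mass_def
    by (rule integral_mono[OF kernel_section_integrable[OF assms]]) (use kernel_bound in auto)
  then show "kernel_mass i j j' u \<le> 2" using unit_interval.prob_space by simp
qed

text \<open>
  Since \<open>\<bar>D\<bar> \<le> 2\<close>, the square is at most \<open>2 \<bar>D\<bar>\<close>, and the row masses tend to 0 boundedly.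
\<close>

lemma kernel_square_tendsto_0:
  assumes j: "j \<in> {1..J}" "j' \<in> {1..J}"
  shows "(\<lambda>i. \<integral>u. (\<integral>s. (kernel i j j' u s)\<^sup>2 \<partial>\<U>) \<partial>\<U>) \<longlonglongrightarrow> 0"
proof -
  have lim: "(\<lambda>i. \<integral>u. 2 * kernel_mass i j j' u \<partial>\<U>) \<longlonglongrightarrow> (\<integral>u. 0 \<partial>\<U>)"
  proof (rule integral_dominated_convergence[where w="\<lambda>_. 4"])
    show "AE u in \<U>. (\<lambda>i. 2 * kernel_mass i j j' u) \<longlonglongrightarrow> 0"
      using AE_unit_interval_neq[of 0] AE_space
    proof eventually_elim
      case (elim u)
      then show ?case using tendsto_mult_right_zero[OF kernel_mass_tendsto_0[OF j, of u], of 2] by simp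
    qed
    show "AE u in \<U>. norm (2 * kernel_mass i j j' u) \<le> 4" for i
      using AE_space by eventually_elim (use kernel_mass_bounds[OF j] in auto)
  qed (use kernel_mass_measurable[OF j] in auto)
  have sq: "(kernel i j j' u s)\<^sup>2 \<le> 2 * \<bar>kernel i j j' u s\<bar>" for i u s
    using mult_right_mono[OF kernel_bound[of i j j' u s], of "\<bar>kernel i j j' u s\<bar>"] by (simp add: power2_eq_square)
  have sq4: "(kernel i j j' u s)\<^sup>2 \<le> 4" for i u s
    using sq[of i u s] kernel_bound[of i j j' u s] by linarith
  have inner: "(\<integral>s. (kernel i j j' u s)\<^sup>2 \<partial>\<U>) \<le> 2 * kernel_mass i j j' u" if u: "0 \<le> u" "u < 1" for i u
  proof -
    have "(\<integral>s. (kernel i j j' u s)\<^sup>2 \<partial>\<U>) \<le> (\<integral>s. 2 * \<bar>kernel i j j' u s\<bar> \<partial>\<U>)"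
    proof (rule integral_mono)
      show "integrable \<U> (\<lambda>s. (kernel i j j' u s)\<^sup>2)"
        by (rule unit_interval.integrable_const_bound[where B=4])
           (use sq4 kernel_section_measurable[OF j u] in auto)
    qed (use sq kernel_section_integrable[OF j u] in auto)
    then show ?thesis by (simp add: kernel_mass_def)
  qed
  show ?thesis
  proof (rule tendsto_sandwich[OF _ _ tendsto_const[of 0]])
    show "(\<lambda>i. \<integral>u. 2 * kernel_mass i j j' u \<partial>\<U>) \<longlonglongrightarrow> 0" using lim by simp
    have m: "(\<lambda>u. \<integral>s. (kernel i j j' u s)\<^sup>2 \<partial>\<U>) \<in> borel_measurable \<U>" for i
      by (rule unit_interval.borel_measurable_lebesgue_integral)
         (use kernel_measurable2[OF j, of i] in \<open>simp add: split_beta\<close>)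
    have nn: "0 \<le> (\<integral>s. (kernel i j j' u s)\<^sup>2 \<partial>\<U>)" for i u
      by (rule Bochner_Integration.integral_nonneg) simp
    show "\<forall>\<^sub>F i in sequentially. 0 \<le> (\<integral>u. (\<integral>s. (kernel i j j' u s)\<^sup>2 \<partial>\<U>) \<partial>\<U>)"
      by (intro always_eventually allI Bochner_Integration.integral_nonneg nn)
    have int_mass: "integrable \<U> (\<lambda>u. 2 * kernel_mass i j j' u)" for i
      by (rule unit_interval.integrable_const_bound[where B=4], rule AE_I2)
         (use kernel_mass_bounds[OF j] kernel_mass_measurable[OF j] in auto)
    have le4: "(\<integral>s. (kernel i j j' u s)\<^sup>2 \<partial>\<U>) \<le> 4" if "0 \<le> u" "u < 1" for i u
      using inner[OF that, of i] kernel_mass_bounds(2)[OF j that, of i] by linarith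
    show "\<forall>\<^sub>F i in sequentially. (\<integral>u. (\<integral>s. (kernel i j j' u s)\<^sup>2 \<partial>\<U>) \<partial>\<U>) \<le> (\<integral>u. 2 * kernel_mass i j j' u \<partial>\<U>)"
    proof (intro always_eventually allI integral_mono int_mass)
      show "integrable \<U> (\<lambda>u. \<integral>s. (kernel i j j' u s)\<^sup>2 \<partial>\<U>)" for i
        by (rule unit_interval.integrable_const_bound[where B=4], rule AE_I2) (use nn le4 m in auto)
    qed (use inner in auto)
  qed
qed

text \<open>
  Continuous trapezoids approximate the indicator in \<open>L\<^sup>1\<close>. As the kernel is bounded by 2 for all
  grids, the error is uniform along the sequence, and the assumption on continuous test functions
  carries over.
\<close>

lemma kernel_diagonal_tendsto:
  assumes j: "j \<in> {1..J}" "j' \<in> {1..J}" and ab: "0 \<le> a" "b \<le> 1"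
  shows "(\<lambda>i. \<integral>s. kernel i j j' s s * indicator {a..<b} s \<partial>\<U>) \<longlonglongrightarrow> max 0 (b - a)"
proof -
  (* A trapezoid: 0 outside [a, b], slopes k and -k at the end points and, for large k, 1
     in the middle. *)
  define g where "g k s = max 0 (min 1 (real k * min (s - a) (b - s)))" for k :: nat and s :: real
  have g01: "0 \<le> g k s" "g k s \<le> 1" for k s by (auto simp: g_def)
  have dist1: "\<bar>indicator {a..<b} s - g k s\<bar> \<le> 1" for k s
    using g01[of k s] by (auto simp: indicator_def abs_le_iff)
  have cont: "continuous_on {0..1} (g k)" for k unfolding g_def by (intro continuous_intros)
  have gm [measurable]: "g k \<in> borel_measurable \<U>" for k
    by (rule measurable_restrict_space1) (simp add: g_def[abs_def])
  have Km: "(\<lambda>s. kernel i j j' s s) \<in> borel_measurable \<U>" for i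
    by (rule kernel_measurable[OF j]) simp_all
  have L1: "(\<lambda>k. \<integral>s. \<bar>indicator {a..<b} s - g k s\<bar> \<partial>\<U>) \<longlonglongrightarrow> (\<integral>s. 0 \<partial>\<U>)"
  proof (rule integral_dominated_convergence[where w="\<lambda>_. 1"])
    show "AE s in \<U>. (\<lambda>k. \<bar>indicator {a..<b} s - g k s\<bar>) \<longlonglongrightarrow> 0"
      using AE_unit_interval_neq[of a]
    proof eventually_elim
      case (elim s)
      show ?case
      proof (cases "a < s \<and> s < b")
        case True
        define c where "c = min (s - a) (b - s)"
        have c: "c > 0" using True by (simp add: c_def)
        have "\<forall>\<^sub>F k in sequentially. real k \<ge> 1 / c"
          using filterlim_real_sequentially by (simp add: filterlim_at_top)
        then have "\<forall>\<^sub>F k in sequentially. \<bar>indicator {a..<b} s - g k s\<bar> = 0"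
        proof eventually_elim
          case (elim k)
          then have "1 \<le> real k * c" using c by (simp add: field_simps)
          then show ?case using True by (simp add: g_def c_def[symmetric])
        qed
        then show ?thesis by (rule tendsto_eventually)
      next
        case False
        have "g k s = 0" for k
        proof -
          have "min (s - a) (b - s) \<le> 0" using False elim by auto
          then have "real k * min (s - a) (b - s) \<le> 0" by (simp add: mult_nonneg_nonpos)
          then show ?thesis by (simp add: g_def)
        qed
        moreover have "indicator {a..<b} s = (0::real)" using False elim by auto
        ultimately show ?thesis by simp
      qed
    qed
    show "AE s in \<U>. norm \<bar>indicator {a..<b} s - g k s\<bar> \<le> 1" for k
      using dist1 by simp
  qed auto
  then have L1: "(\<lambda>k. \<integral>s. \<bar>indicator {a..<b} s - g k s\<bar> \<partial>\<U>) \<longlonglongrightarrow> 0" by simp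
  have int_diff: "integrable \<U> (\<lambda>s. \<bar>indicator {a..<b} s - g k s\<bar>)" for k
    by (rule unit_interval.integrable_const_bound[where B=1]) (use dist1 in auto)
  have int_g: "integrable \<U> (g k)" for k
    by (rule unit_interval.integrable_const_bound[where B=1]) (use g01[of k] in auto)
  have int_ind: "integrable \<U> (indicator {a..<b} :: real \<Rightarrow> real)"
    by (intro unit_interval.integrable_const_bound[where B=1] AE_I2 indicator_measurable_unit_interval) (simp add: indicator_def)
  have absg: "\<bar>g k s\<bar> \<le> 1" for k s using g01[of k s] by simp
  have int_K: "integrable \<U> (\<lambda>s. kernel i j j' s s * f s)"
    if "f \<in> borel_measurable \<U>" "\<And>s. \<bar>f s\<bar> \<le> 1" for i f
  proof (rule unit_interval.integrable_const_bound[where B="2 * 1"])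
    have "\<bar>kernel i j j' s s\<bar> * \<bar>f s\<bar> \<le> 2 * 1" for s
      by (intro mult_mono kernel_bound that) auto
    then show "AE s in \<U>. norm (kernel i j j' s s * f s) \<le> 2 * 1" by (simp add: abs_mult)
  qed (use Km that in auto)
  show ?thesis
  proof (rule LIMSEQ_I)
    fix e :: real assume e: "e > 0"
    have "\<forall>\<^sub>F k in sequentially. (\<integral>s. \<bar>indicator {a..<b} s - g k s\<bar> \<partial>\<U>) < e / 6"
      by (rule order_tendstoD(2)[OF L1]) (use e in simp)
    then obtain k where k: "(\<integral>s. \<bar>indicator {a..<b} s - g k s\<bar> \<partial>\<U>) < e / 6"
      by (auto simp: eventually_sequentially)
    have "(\<lambda>i. \<integral>s. kernel i j j' s s * g k s \<partial>\<U>) \<longlonglongrightarrow> (\<integral>s. g k s \<partial>\<U>)"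
      using kernel_lim[OF j cont[of k]] Km by (simp add: integral_unit_interval_closed)
    from LIMSEQ_D[OF this, of "e / 2"] e obtain i0 where
      i0: "\<And>i. i \<ge> i0 \<Longrightarrow> \<bar>(\<integral>s. kernel i j j' s s * g k s \<partial>\<U>) - (\<integral>s. g k s \<partial>\<U>)\<bar> < e / 2" by auto
    show "\<exists>i0. \<forall>i\<ge>i0. norm ((\<integral>s. kernel i j j' s s * indicator {a..<b} s \<partial>\<U>) - max 0 (b - a)) < e"
    proof (intro exI[of _ i0] allI impI)
      fix i assume "i \<ge> i0"
      note i0 = i0[OF this]
      have "\<bar>(\<integral>s. kernel i j j' s s * indicator {a..<b} s \<partial>\<U>) - (\<integral>s. kernel i j j' s s * g k s \<partial>\<U>)\<bar>
          \<le> (\<integral>s. 2 * \<bar>indicator {a..<b} s - g k s\<bar> \<partial>\<U>)"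
      proof -
        have eq: "(\<integral>s. kernel i j j' s s * indicator {a..<b} s \<partial>\<U>) - (\<integral>s. kernel i j j' s s * g k s \<partial>\<U>)
          = (\<integral>s. kernel i j j' s s * indicator {a..<b} s - kernel i j j' s s * g k s \<partial>\<U>)"
          by (rule Bochner_Integration.integral_diff[symmetric]; rule int_K) (use absg in \<open>auto split: split_indicator\<close>)
        have "\<bar>\<integral>s. kernel i j j' s s * indicator {a..<b} s - kernel i j j' s s * g k s \<partial>\<U>\<bar> \<le> (\<integral>s. \<bar>kernel i j j' s s * indicator {a..<b} s - kernel i j j' s s * g k s\<bar> \<partial>\<U>)"
          by (rule integral_abs_bound)
        also have "\<dots> \<le> (\<integral>s. 2 * \<bar>indicator {a..<b} s - g k s\<bar> \<partial>\<U>)"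
        proof (rule Bochner_Integration.integral_mono')
          show "integrable \<U> (\<lambda>s. 2 * \<bar>indicator {a..<b} s - g k s\<bar>)" by (intro integrable_mult_right int_diff)
          show "\<bar>kernel i j j' s s * indicator {a..<b} s - kernel i j j' s s * g k s\<bar> \<le> 2 * \<bar>indicator {a..<b} s - g k s\<bar>" for s
            using mult_right_mono[OF kernel_bound abs_ge_zero] by (simp only: right_diff_distrib[symmetric] abs_mult)
        qed simp
        finally show ?thesis unfolding eq .
      qed
      also have "\<dots> = 2 * (\<integral>s. \<bar>indicator {a..<b} s - g k s\<bar> \<partial>\<U>)" by (rule integral_mult_right_zero)
      also have "\<dots> < e / 3" using k by linarith
      finally have 1: "\<bar>(\<integral>s. kernel i j j' s s * indicator {a..<b} s \<partial>\<U>) - (\<integral>s. kernel i j j' s s * g k s \<partial>\<U>)\<bar> < e / 3" .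
      have "\<bar>max 0 (b - a) - (\<integral>s. g k s \<partial>\<U>)\<bar> = \<bar>\<integral>s. indicator {a..<b} s - g k s \<partial>\<U>\<bar>"
        by (simp only: Bochner_Integration.integral_diff[OF int_ind int_g] integral_unit_interval_indicator[OF ab])
      also have "\<dots> \<le> (\<integral>s. \<bar>indicator {a..<b} s - g k s\<bar> \<partial>\<U>)" by (rule integral_abs_bound)
      finally have "\<bar>max 0 (b - a) - (\<integral>s. g k s \<partial>\<U>)\<bar> < e / 6" using k by linarith
      with 1 i0 show "norm ((\<integral>s. kernel i j j' s s * indicator {a..<b} s \<partial>\<U>) - max 0 (b - a)) < e"
        unfolding real_norm_def by linarith
    qed
  qed
qed

end

section \<open>The bilinear form of the estimator\<close>

locale siml = wiener M d W + sampling J N t \<phi> m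
  for M :: "'a measure" and d W J N t \<phi> m
begin

definition weight :: "nat \<Rightarrow> nat \<Rightarrow> nat \<Rightarrow> real \<Rightarrow> real" where
  "weight i j l s = cos ((real l - 1/2) * pi * \<phi> i j s)"

definition coeff :: "nat \<Rightarrow> nat \<Rightarrow> nat \<Rightarrow> (real \<Rightarrow> 'a \<Rightarrow> real) \<Rightarrow> 'a \<Rightarrow> real" where
  "coeff i j l Y = weighted_increments (t i j) (N i j) (weight i j l) Y"

text \<open>
  For \<open>Y = X j\<close> and \<open>Y' = X j'\<close> this is the estimator without the factor \<open>n / (n + 1/2)\<close>.
  Bilinearity in arbitrary processes allows it to be analysed on drift and martingale parts
  separately.
\<close>

definition form :: "nat \<Rightarrow> nat \<Rightarrow> nat \<Rightarrow> (real \<Rightarrow> 'a \<Rightarrow> real) \<Rightarrow> (real \<Rightarrow> 'a \<Rightarrow> real) \<Rightarrow> 'a \<Rightarrow> real" where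
  "form i j j' Y Y' \<omega> = 2 / real (m i) * (\<Sum>l=1..m i. coeff i j l Y \<omega> * coeff i j' l Y' \<omega>)"

lemma step_on_weight: "j \<in> {1..J} \<Longrightarrow> step_on (t i j) (N i j) (weight i j l)"
  using step_on_\<phi>[of j i] unfolding step_on_def weight_def by metis

lemma weight_bound: "\<bar>weight i j l s\<bar> \<le> 1"
  by (simp add: weight_def)

lemma kernel_eq_weights: "kernel i j j' u s = 2 / real (m i) * (\<Sum>l=1..m i. weight i j l u * weight i j' l s)"
  by (simp add: siml_kernel_eq_sum weight_def)

abbreviation measurable_process :: "(real \<Rightarrow> 'a \<Rightarrow> real) \<Rightarrow> bool" where
  "measurable_process Y \<equiv> (\<forall>u. 0 \<le> u \<longrightarrow> u \<le> 1 \<longrightarrow> Y u \<in> borel_measurable M)"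

lemma coeff_measurable: "j \<in> {1..J} \<Longrightarrow> measurable_process Y \<Longrightarrow> coeff i j l Y \<in> borel_measurable M"
  unfolding coeff_def by (rule weighted_increments_measurable[OF partition_grid]) auto

lemma form_measurable:
  "j \<in> {1..J} \<Longrightarrow> j' \<in> {1..J} \<Longrightarrow> measurable_process Y \<Longrightarrow> measurable_process Y' \<Longrightarrow> form i j j' Y Y' \<in> borel_measurable M"
  unfolding form_def[abs_def]
  by (intro borel_measurable_times borel_measurable_const borel_measurable_sum coeff_measurable) 

lemma siml_estimator_eq_form:
  assumes "j \<in> {1..J}" "j' \<in> {1..J}"
  shows "siml_estimator J (N i) (t i) (\<phi> i) (m i) X j j' \<omega> =
    real (grid_size J (N i)) / (real (grid_size J (N i)) + 1/2) * form i j j' (X j) (X j') \<omega>"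
  unfolding siml_estimator_def form_def coeff_def weight_def
    elementary_integral_eq_weighted_increments[OF partition_grid[OF assms(1)]]
    elementary_integral_eq_weighted_increments[OF partition_grid[OF assms(2)]]
  by simp

lemma form_diff:
  "form i j j' Y Y' \<omega> - form i j j' Z Z' \<omega> =
    form i j j' (\<lambda>u \<omega>. Y u \<omega> - Z u \<omega>) Y' \<omega> + form i j j' Z (\<lambda>u \<omega>. Y' u \<omega> - Z' u \<omega>) \<omega>"
  unfolding form_def coeff_def weighted_increments_diff distrib_left[symmetric] right_diff_distrib[symmetric]
    sum.distrib[symmetric] sum_subtractf[symmetric]
  by (simp add: algebra_simps)

lemma form_sum_left: "form i j j' (\<lambda>u \<omega>. \<Sum>k\<in>K. Y k u \<omega>) Z \<omega> = (\<Sum>k\<in>K. form i j j' (Y k) Z \<omega>)"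
proof -
  have "(\<Sum>l=1..m i. (\<Sum>k\<in>K. coeff i j l (Y k) \<omega>) * coeff i j' l Z \<omega>) = (\<Sum>k\<in>K. \<Sum>l=1..m i. coeff i j l (Y k) \<omega> * coeff i j' l Z \<omega>)"
    unfolding sum_distrib_right by (rule sum.swap)
  then show ?thesis unfolding form_def coeff_def weighted_increments_sum by (simp add: sum_distrib_left)
qed

lemma form_commute: "form i j j' Y Z \<omega> = form i j' j Z Y \<omega>"
  unfolding form_def by (simp add: mult.commute)

lemma form_sum_right: "form i j j' Z (\<lambda>u \<omega>. \<Sum>k\<in>K. Y k u \<omega>) \<omega> = (\<Sum>k\<in>K. form i j j' Z (Y k) \<omega>)"
  by (simp only: form_commute[of i j j' Z] form_sum_left)

lemma form_cmult_left: "form i j j' (\<lambda>u \<omega>. \<xi> \<omega> * Y u \<omega>) Z \<omega> = \<xi> \<omega> * form i j j' Y Z \<omega>"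
  unfolding form_def coeff_def weighted_increments_cmult by (simp add: sum_distrib_left mult_ac)

lemma form_cmult_right: "form i j j' Y (\<lambda>u \<omega>. \<xi> \<omega> * Z u \<omega>) \<omega> = \<xi> \<omega> * form i j j' Y Z \<omega>"
  by (simp only: form_commute[of i j j' Y] form_cmult_left)

section \<open>Brownian increments\<close>

text \<open>
  The integral over \<open>[0,u]\<close> of the indicator of \<open>[a,b)\<close> with respect to component \<open>r\<close>.
\<close>

definition brownian_piece :: "nat \<Rightarrow> real \<Rightarrow> real \<Rightarrow> real \<Rightarrow> 'a \<Rightarrow> real" where
  "brownian_piece r a b u \<omega> = W r (min b u) \<omega> - W r (min a u) \<omega>"

lemma brownian_piece_measurable:
  "r \<in> {1..d} \<Longrightarrow> 0 \<le> a \<Longrightarrow> 0 \<le> b \<Longrightarrow> measurable_process (brownian_piece r a b)"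
  unfolding brownian_piece_def[abs_def] by (auto intro!: borel_measurable_diff W_measurable)

lemma coeff_brownian_piece:
  assumes j: "j \<in> {1..J}" and \<tau>: "partition \<tau> n" and ref: "refines \<tau> n (t i j) (N i j)"
    and ab: "a \<in> \<tau> ` {0..n}" "b \<in> \<tau> ` {0..n}" "a \<le> b"
  shows "coeff i j l (brownian_piece r a b) \<omega> =
    (\<Sum>p<n. weight i j l (\<tau> p) * indicator {a..<b} (\<tau> p) * (W r (\<tau> (Suc p)) \<omega> - W r (\<tau> p) \<omega>))"
  unfolding coeff_def weighted_increments_refines[OF \<tau> partition_grid[OF j] ref step_on_weight[OF j]]
  unfolding weighted_increments_def
proof (intro sum.cong refl)
  fix p assume p: "p \<in> {..<n}"
  have lt: "\<tau> p < \<tau> (Suc p)" using partition_less_iff[OF \<tau>, of p "Suc p"] p by simp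
  have z: "z \<le> \<tau> p \<or> \<tau> (Suc p) \<le> z" if "z \<in> \<tau> ` {0..n}" for z
  proof -
    from that obtain l where l: "l \<le> n" "z = \<tau> l" by auto
    then show ?thesis
      using partition_le_iff[OF \<tau>, of l p] partition_le_iff[OF \<tau>, of "Suc p" l] p by auto
  qed
  have "brownian_piece r a b (\<tau> (Suc p)) \<omega> - brownian_piece r a b (\<tau> p) \<omega> =
      indicator {a..<b} (\<tau> p) * (W r (\<tau> (Suc p)) \<omega> - W r (\<tau> p) \<omega>)"
    using z[OF ab(1)] z[OF ab(2)] lt ab(3)
    by (cases "a = b") (auto simp: brownian_piece_def min_def indicator_def)
  then show "weight i j l (\<tau> p) * (brownian_piece r a b (\<tau> (Suc p)) \<omega> - brownian_piece r a b (\<tau> p) \<omega>) =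
      weight i j l (\<tau> p) * indicator {a..<b} (\<tau> p) * (W r (\<tau> (Suc p)) \<omega> - W r (\<tau> p) \<omega>)" by simp
qed

text \<open>
  On a common refinement of the two grids and the end points of the intervals, the form becomes a
  quadratic form in the increments of the Wiener process, whose coefficients are values of the
  kernel. Its mean and, once the indicators of the intervals are dropped, its variance bound are
  Riemann sums of step functions on this refinement, that is, integrals.
\<close>

lemma form_brownian_piece_l2:
  assumes j: "j \<in> {1..J}" "j' \<in> {1..J}" and r: "r \<in> {1..d}" "r' \<in> {1..d}"
    and ab: "0 \<le> a" "a \<le> b" "b \<le> 1" and ab': "0 \<le> a'" "a' \<le> b'" "b' \<le> 1"
  shows "l2 (\<lambda>\<omega>. form i j j' (brownian_piece r a b) (brownian_piece r' a' b') \<omega> -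
      of_bool (r = r') * (\<integral>s. kernel i j j' s s * indicator {max a a'..<min b b'} s \<partial>\<U>))
    \<le> ennreal (2 * (\<integral>u. (\<integral>s. (kernel i j j' u s)\<^sup>2 \<partial>\<U>) \<partial>\<U>))"
proof -
  let ?P = "t i j ` {0..N i j} \<union> t i j' ` {0..N i j'} \<union> {0, 1, a, b, a', b'}"
  obtain n \<tau> where \<tau>: "partition \<tau> n" and im: "\<tau> ` {0..n} = ?P"
  proof (rule partition_exists[of ?P])
    show "?P \<subseteq> {0..1}"
      using partition_bounds[OF partition_grid[OF j(1)]] partition_bounds[OF partition_grid[OF j(2)]] ab ab' by auto
  qed auto
  have ref: "refines \<tau> n (t i j) (N i j)" "refines \<tau> n (t i j') (N i j')" unfolding refines_def im by auto
  have mem: "a \<in> \<tau> ` {0..n}" "b \<in> \<tau> ` {0..n}" "a' \<in> \<tau> ` {0..n}" "b' \<in> \<tau> ` {0..n}"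
    "max a a' \<in> \<tau> ` {0..n}" "min b b' \<in> \<tau> ` {0..n}" unfolding im by (auto simp: max_def min_def)
  define \<Delta> where "\<Delta> r p \<omega> = W r (\<tau> (Suc p)) \<omega> - W r (\<tau> p) \<omega>" for r p \<omega>
  define v where "v p = \<tau> (Suc p) - \<tau> p" for p
  define x where "x = (\<lambda>p. indicator {a..<b} (\<tau> p) :: real)"
  define y where "y = (\<lambda>p. indicator {a'..<b'} (\<tau> p) :: real)"
  define K where "K p q = kernel i j j' (\<tau> p) (\<tau> q)" for p q
  define G where "G p q = K p q * (x p * y q)" for p q
  have v: "0 \<le> v p" if "p < n" for p using partition_le_iff[OF \<tau>, of p "Suc p"] that by (simp add: v_def)
  have form: "form i j j' (brownian_piece r a b) (brownian_piece r' a' b') \<omega> =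
      (\<Sum>p<n. \<Sum>q<n. G p q * (\<Delta> r p \<omega> * \<Delta> r' q \<omega>))" for \<omega>
  proof -
    have "form i j j' (brownian_piece r a b) (brownian_piece r' a' b') \<omega> = 2 / real (m i) *
       (\<Sum>l=1..m i. \<Sum>p<n. \<Sum>q<n. (weight i j l (\<tau> p) * weight i j' l (\<tau> q)) * (x p * y q * (\<Delta> r p \<omega> * \<Delta> r' q \<omega>)))"
      unfolding form_def coeff_brownian_piece[OF j(1) \<tau> ref(1) mem(1,2) ab(2)] coeff_brownian_piece[OF j(2) \<tau> ref(2) mem(3,4) ab'(2)]
        sum_product \<Delta>_def x_def y_def
      by (rule arg_cong[where f="\<lambda>x. 2 / real (m i) * x"], intro sum.cong refl, simp only: mult_ac)
    also have "(\<Sum>l=1..m i. \<Sum>p<n. \<Sum>q<n. (weight i j l (\<tau> p) * weight i j' l (\<tau> q)) * (x p * y q * (\<Delta> r p \<omega> * \<Delta> r' q \<omega>))) =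
       (\<Sum>p<n. \<Sum>l=1..m i. \<Sum>q<n. (weight i j l (\<tau> p) * weight i j' l (\<tau> q)) * (x p * y q * (\<Delta> r p \<omega> * \<Delta> r' q \<omega>)))"
      by (rule sum.swap)
    also have "\<dots> = (\<Sum>p<n. \<Sum>q<n. \<Sum>l=1..m i. (weight i j l (\<tau> p) * weight i j' l (\<tau> q)) * (x p * y q * (\<Delta> r p \<omega> * \<Delta> r' q \<omega>)))"
      by (intro sum.cong refl sum.swap)
    also have "2 / real (m i) * \<dots> = (\<Sum>p<n. \<Sum>q<n. G p q * (\<Delta> r p \<omega> * \<Delta> r' q \<omega>))"
      unfolding sum_distrib_left[of "2 / real (m i)"] G_def K_def kernel_eq_weights sum_distrib_right
      by (intro sum.cong refl) (simp only: mult_ac)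
    finally show ?thesis .
  qed
  have s\<phi>: "step_on \<tau> n (\<phi> i j)" "step_on \<tau> n (\<phi> i j')"
    by (rule step_on_refines[OF \<tau> partition_grid[OF j(1)] ref(1) step_on_\<phi>[OF j(1)]],
        rule step_on_refines[OF \<tau> partition_grid[OF j(2)] ref(2) step_on_\<phi>[OF j(2)]])
  define \<kappa> where "\<kappa> x y = 1 / (2 * real (m i)) * sin_ratio (m i) (x + y) + 1 / (2 * real (m i)) * sin_ratio (m i) (x - y)" for x y
  have \<kappa>: "kernel i j j' u s = \<kappa> (\<phi> i j u) (\<phi> i j' s)" for u s by (simp only: siml_kernel_def \<kappa>_def)
  have diag: "(\<Sum>p<n. G p p * v p) = (\<integral>s. kernel i j j' s s * indicator {max a a'..<min b b'} s \<partial>\<U>)"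
  proof -
    have "step_on \<tau> n (\<lambda>s. kernel i j j' s s * indicator {max a a'..<min b b'} s)"
      unfolding \<kappa> by (rule step_on_comp2[OF step_on_comp2[OF s\<phi>, of \<kappa>] step_on_indicator[OF \<tau> mem(5,6)], of "(*)"])
    from integral_step_on[OF \<tau> this] show ?thesis
      unfolding G_def v_def K_def x_def y_def
      by (simp only:) (intro sum.cong refl, simp add: indicator_def)
  qed
  have sq: "(\<integral>u. (\<integral>s. (kernel i j j' u s)\<^sup>2 \<partial>\<U>) \<partial>\<U>) = (\<Sum>p<n. \<Sum>q<n. (K p q)\<^sup>2 * v p * v q)"
  proof -
    have inner: "(\<integral>s. (kernel i j j' u s)\<^sup>2 \<partial>\<U>) = (\<Sum>q<n. (kernel i j j' u (\<tau> q))\<^sup>2 * v q)" for u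
    proof -
      have "step_on \<tau> n (\<lambda>s. (kernel i j j' u s)\<^sup>2)"
        unfolding \<kappa> by (rule step_on_comp2[OF s\<phi>(2,2), of "\<lambda>y _. (\<kappa> (\<phi> i j u) y)\<^sup>2"])
      from integral_step_on[OF \<tau> this] show ?thesis by (simp add: v_def)
    qed
    have "step_on \<tau> n (\<lambda>u. \<Sum>q<n. (kernel i j j' u (\<tau> q))\<^sup>2 * v q)"
      unfolding \<kappa> by (rule step_on_comp2[OF s\<phi>(1,1), of "\<lambda>x _. \<Sum>q<n. (\<kappa> x (\<phi> i j' (\<tau> q)))\<^sup>2 * v q"])
    from integral_step_on[OF \<tau> this] show ?thesis
      unfolding inner by (simp add: K_def v_def[symmetric] sum_distrib_left mult_ac)
  qed
  have "l2 (\<lambda>\<omega>. (\<Sum>p<n. \<Sum>q<n. G p q * (\<Delta> r p \<omega> * \<Delta> r' q \<omega>)) - of_bool (r = r') * (\<Sum>p<n. G p p * v p))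
    \<le> ennreal (2 * (\<Sum>p<n. \<Sum>q<n. (G p q)\<^sup>2 * v p * v q))"
    unfolding \<Delta>_def v_def by (rule increments_quadratic_form[OF \<tau> r])
  also have "\<dots> \<le> ennreal (2 * (\<Sum>p<n. \<Sum>q<n. (K p q)\<^sup>2 * v p * v q))"
  proof (intro ennreal_leI mult_left_mono sum_mono mult_right_mono)
    fix p q
    have "(x p * y q)\<^sup>2 \<le> 1" by (simp add: x_def y_def indicator_def)
    from mult_left_mono[OF this, of "(K p q)\<^sup>2"] show "(G p q)\<^sup>2 \<le> (K p q)\<^sup>2"
      by (simp add: G_def power_mult_distrib)
  qed (use v in auto)
  finally show ?thesis unfolding form diag sq .
qed

lemma form_brownian_piece_tendsto:
  assumes j: "j \<in> {1..J}" "j' \<in> {1..J}" and r: "r \<in> {1..d}" "r' \<in> {1..d}"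
    and ab: "0 \<le> a" "a \<le> b" "b \<le> 1" and ab': "0 \<le> a'" "a' \<le> b'" "b' \<le> 1"
  shows "tendsto_in_probability M (\<lambda>i. form i j j' (brownian_piece r a b) (brownian_piece r' a' b'))
    (\<lambda>_. of_bool (r = r') * max 0 (min b b' - max a a'))"
proof (rule tendsto_in_probabilityI_moment[where q=2])
  let ?f = "\<lambda>i. form i j j' (brownian_piece r a b) (brownian_piece r' a' b')"
  let ?c = "of_bool (r = r') * max 0 (min b b' - max a a') :: real"
  let ?c' = "\<lambda>i. of_bool (r = r') * (\<integral>s. kernel i j j' s s * indicator {max a a'..<min b b'} s \<partial>\<U>)"
  let ?D = "\<lambda>i. \<integral>u. (\<integral>s. (kernel i j j' u s)\<^sup>2 \<partial>\<U>) \<partial>\<U>"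
  show fm: "?f i \<in> borel_measurable M" for i
    using ab ab' r by (intro form_measurable j brownian_piece_measurable) auto
  have le: "l2 (\<lambda>\<omega>. ?f i \<omega> - ?c) \<le> 2 * ennreal (2 * ?D i) + 2 * ennreal ((?c' i - ?c)\<^sup>2)" for i
  proof -
    have "l2 (\<lambda>\<omega>. ?f i \<omega> - ?c) \<le> 2 * l2 (\<lambda>\<omega>. ?f i \<omega> - ?c' i) + 2 * l2 (\<lambda>\<omega>. ?c' i - ?c)"
      by (intro l2_triangle fm) auto
    also have "l2 (\<lambda>\<omega>. ?c' i - ?c) = ennreal ((?c' i - ?c)\<^sup>2)"
      unfolding l2_def by (simp add: emeasure_space_1)
    also have "l2 (\<lambda>\<omega>. ?f i \<omega> - ?c' i) \<le> ennreal (2 * ?D i)"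
      by (rule form_brownian_piece_l2[OF j r ab ab'])
    finally show ?thesis by (simp add: mult_left_mono)
  qed
  have "(\<lambda>i. 2 * ennreal (2 * ?D i) + 2 * ennreal ((?c' i - ?c)\<^sup>2)) \<longlonglongrightarrow> 2 * ennreal (2 * 0) + 2 * ennreal ((?c - ?c)\<^sup>2)"
    using ab ab' by (intro tendsto_add ennreal_tendsto_cmult tendsto_ennrealI tendsto_mult tendsto_power tendsto_diff
      tendsto_const kernel_square_tendsto_0 kernel_diagonal_tendsto j) auto
  then have "(\<lambda>i. 2 * ennreal (2 * ?D i) + 2 * ennreal ((?c' i - ?c)\<^sup>2)) \<longlonglongrightarrow> 0" by simp
  then have "(\<lambda>i. l2 (\<lambda>\<omega>. ?f i \<omega> - ?c)) \<longlonglongrightarrow> 0"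
    by (rule tendsto_sandwich[OF _ _ tendsto_const, rotated -1]) (use le in \<open>auto intro!: always_eventually\<close>)
  then show "(\<lambda>i. \<integral>\<^sup>+ \<omega>. ennreal (\<bar>?f i \<omega> - ?c\<bar> ^ 2) \<partial>M) \<longlonglongrightarrow> 0" by (simp add: l2_def)
qed simp

section \<open>Simple integrands\<close>

lemma elementary_integral_eq_pieces:
  "elementary_integral \<tau> n H (W r) = (\<lambda>u \<omega>. \<Sum>k<n. H (\<tau> k) \<omega> * brownian_piece r (\<tau> k) (\<tau> (Suc k)) u \<omega>)"
  unfolding elementary_integral_def brownian_piece_def by (intro ext) simp

lemma simple_product_integral:
  assumes H: "simple_process M F \<tau> n H" and H': "simple_process M F \<tau>' n' H'" and \<omega>: "\<omega> \<in> space M"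
  shows "(\<integral>s. H s \<omega> * H' s \<omega> \<partial>\<U>) =
    (\<Sum>k<n. \<Sum>k'<n'. H (\<tau> k) \<omega> * H' (\<tau>' k') \<omega> * max 0 (min (\<tau> (Suc k)) (\<tau>' (Suc k')) - max (\<tau> k) (\<tau>' k')))"
proof -
  note \<tau> = simple_process_partition[OF H] simple_process_partition[OF H']
  have ind: "indicator {a..<b} s * indicator {a'..<b'} s = (indicator {max a a'..<min b b'} s :: real)" for a b a' b' s :: real
    by (auto split: split_indicator)
  have "(\<integral>s. H s \<omega> * H' s \<omega> \<partial>\<U>) = (\<integral>s. (\<Sum>k<n. \<Sum>k'<n'. H (\<tau> k) \<omega> * H' (\<tau>' k') \<omega> *
      indicator {max (\<tau> k) (\<tau>' k')..<min (\<tau> (Suc k)) (\<tau>' (Suc k'))} s) \<partial>\<U>)"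
  proof (rule Bochner_Integration.integral_cong[OF refl])
    fix s assume "s \<in> space \<U>"
    then have s: "0 \<le> s" "s < 1" by auto
    show "H s \<omega> * H' s \<omega> = (\<Sum>k<n. \<Sum>k'<n'. H (\<tau> k) \<omega> * H' (\<tau>' k') \<omega> * indicator {max (\<tau> k) (\<tau>' k')..<min (\<tau> (Suc k)) (\<tau>' (Suc k'))} s)"
      unfolding simple_process_eq_sum[OF H s \<omega>] simple_process_eq_sum[OF H' s \<omega>] sum_product ind[symmetric]
      by (intro sum.cong refl) (simp only: mult_ac)
  qed
  also have "\<dots> = (\<Sum>k<n. \<Sum>k'<n'. H (\<tau> k) \<omega> * H' (\<tau>' k') \<omega> *
      (\<integral>s. indicator {max (\<tau> k) (\<tau>' k')..<min (\<tau> (Suc k)) (\<tau>' (Suc k'))} s \<partial>\<U>))"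
  proof -
    have "integrable \<U> (indicator {a..<b} :: real \<Rightarrow> real)" for a b
      by (intro unit_interval.integrable_const_bound[where B=1] AE_I2 indicator_measurable_unit_interval) (simp add: indicator_def)
    then show ?thesis
      by (simp only: Bochner_Integration.integral_sum Bochner_Integration.integrable_sum integrable_mult_right integral_mult_right_zero)
  qed
  also have "\<dots> = (\<Sum>k<n. \<Sum>k'<n'. H (\<tau> k) \<omega> * H' (\<tau>' k') \<omega> * max 0 (min (\<tau> (Suc k)) (\<tau>' (Suc k')) - max (\<tau> k) (\<tau>' k')))"
  proof (intro sum.cong refl arg_cong2[of _ _ _ _ "(*)"] integral_unit_interval_indicator)
    fix k k' assume "k \<in> {..<n}" "k' \<in> {..<n'}"
    then show "0 \<le> max (\<tau> k) (\<tau>' k')" "min (\<tau> (Suc k)) (\<tau>' (Suc k')) \<le> 1"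
      using partition_bounds[OF \<tau>(1), of k] partition_bounds[OF \<tau>(1), of "Suc k"] by auto
  qed
  finally show ?thesis .
qed

text \<open>
  The coefficients \<open>H (\<tau> k)\<close> are random but constant in time, so they factor out of the form and
  only the form of two Brownian pieces depends on \<open>i\<close>.
\<close>

lemma form_simple_tendsto:
  assumes j: "j \<in> {1..J}" "j' \<in> {1..J}" and r: "r \<in> {1..d}" "r' \<in> {1..d}"
    and H: "simple_process M F \<tau> n H" and H': "simple_process M F \<tau>' n' H'"
  shows "tendsto_in_probability M (\<lambda>i. form i j j' (elementary_integral \<tau> n H (W r)) (elementary_integral \<tau>' n' H' (W r')))
    (\<lambda>\<omega>. of_bool (r = r') * (\<integral>s. H s \<omega> * H' s \<omega> \<partial>\<U>))"
proof -
  note \<tau> = simple_process_partition[OF H] simple_process_partition[OF H']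
  obtain C where C: "\<And>k \<omega>. k < n \<Longrightarrow> \<omega> \<in> space M \<Longrightarrow> \<bar>H (\<tau> k) \<omega>\<bar> \<le> C"
    using H unfolding simple_process_def by blast
  obtain C' where C': "\<And>k \<omega>. k < n' \<Longrightarrow> \<omega> \<in> space M \<Longrightarrow> \<bar>H' (\<tau>' k) \<omega>\<bar> \<le> C'"
    using H' unfolding simple_process_def by blast
  let ?B = "\<lambda>k. brownian_piece r (\<tau> k) (\<tau> (Suc k))" and ?B' = "\<lambda>k. brownian_piece r' (\<tau>' k) (\<tau>' (Suc k))"
  let ?Z = "\<lambda>\<omega>. \<Sum>k<n. \<Sum>k'<n'. (H (\<tau> k) \<omega> * H' (\<tau>' k') \<omega>) * (of_bool (r = r') * max 0 (min (\<tau> (Suc k)) (\<tau>' (Suc k')) - max (\<tau> k) (\<tau>' k')))"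
  have "tendsto_in_probability M (\<lambda>i \<omega>. \<Sum>k<n. \<Sum>k'<n'. (H (\<tau> k) \<omega> * H' (\<tau>' k') \<omega>) * form i j j' (?B k) (?B' k') \<omega>) ?Z"
  proof (intro tendsto_in_probability_sum)
    fix k k' assume k: "k \<in> {..<n}" "k' \<in> {..<n'}"
    show "tendsto_in_probability M (\<lambda>i \<omega>. (H (\<tau> k) \<omega> * H' (\<tau>' k') \<omega>) * form i j j' (?B k) (?B' k') \<omega>)
      (\<lambda>\<omega>. (H (\<tau> k) \<omega> * H' (\<tau>' k') \<omega>) * (of_bool (r = r') * max 0 (min (\<tau> (Suc k)) (\<tau>' (Suc k')) - max (\<tau> k) (\<tau>' k'))))"
    proof (rule tendsto_in_probability_mult_bounded)
      show "tendsto_in_probability M (\<lambda>i. form i j j' (?B k) (?B' k'))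
        (\<lambda>\<omega>. of_bool (r = r') * max 0 (min (\<tau> (Suc k)) (\<tau>' (Suc k')) - max (\<tau> k) (\<tau>' k')))"
        using k partition_bounds[OF \<tau>(1)] partition_bounds[OF \<tau>(2)]
          partition_le_iff[OF \<tau>(1), of k "Suc k"] partition_le_iff[OF \<tau>(2), of k' "Suc k'"]
        by (intro form_brownian_piece_tendsto j r) auto
      show "(\<lambda>\<omega>. H (\<tau> k) \<omega> * H' (\<tau>' k') \<omega>) \<in> borel_measurable M"
        using k by (intro borel_measurable_times simple_process_measurable[OF H] simple_process_measurable[OF H']) auto
      show "\<bar>H (\<tau> k) \<omega> * H' (\<tau>' k') \<omega>\<bar> \<le> C * C'" if "\<omega> \<in> space M" for \<omega>
        unfolding abs_mult using k C[of k \<omega>] C'[of k' \<omega>] that by (intro mult_mono) auto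
    qed
  qed
  then show ?thesis
  proof (rule tendsto_in_probability_cong_AE)
    have *: "form i j j' (elementary_integral \<tau> n H (W r)) (elementary_integral \<tau>' n' H' (W r')) \<omega> =
       (\<Sum>k<n. \<Sum>k'<n'. (H (\<tau> k) \<omega> * H' (\<tau>' k') \<omega>) * form i j j' (?B k) (?B' k') \<omega>)" for i \<omega>
      unfolding elementary_integral_eq_pieces form_sum_left form_sum_right form_cmult_left form_cmult_right
      by (intro sum.cong refl) (simp only: mult_ac)
    then show "AE \<omega> in M. form i j j' (elementary_integral \<tau> n H (W r)) (elementary_integral \<tau>' n' H' (W r')) \<omega> =
       (\<Sum>k<n. \<Sum>k'<n'. (H (\<tau> k) \<omega> * H' (\<tau>' k') \<omega>) * form i j j' (?B k) (?B' k') \<omega>)" for i by simp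
    have Z: "of_bool (r = r') * (\<integral>s. H s \<omega> * H' s \<omega> \<partial>\<U>) = ?Z \<omega>" if "\<omega> \<in> space M" for \<omega>
      unfolding simple_product_integral[OF H H' that] sum_distrib_left by (intro sum.cong refl) (simp only: mult_ac)
    then show "AE \<omega> in M. of_bool (r = r') * (\<integral>s. H s \<omega> * H' s \<omega> \<partial>\<U>) = ?Z \<omega>" by (rule AE_I2)
    have "?Z \<in> borel_measurable M"
      by (intro borel_measurable_sum borel_measurable_times borel_measurable_const simple_process_measurable[OF H] simple_process_measurable[OF H']) auto
    then show "(\<lambda>\<omega>. of_bool (r = r') * (\<integral>s. H s \<omega> * H' s \<omega> \<partial>\<U>)) \<in> borel_measurable M"
      by (rule measurable_cong[THEN iffD2, rotated]) (rule Z)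
    show "form i j j' (elementary_integral \<tau> n H (W r)) (elementary_integral \<tau>' n' H' (W r')) \<in> borel_measurable M" for i
      by (intro form_measurable j allI impI elementary_integral_measurable H H' r)
  qed
qed

end

section \<open>Energy estimates\<close>

lemma ennreal_linear_combination:
  "0 \<le> c \<Longrightarrow> 0 \<le> \<delta> \<Longrightarrow> 0 \<le> x \<Longrightarrow> 0 \<le> y \<Longrightarrow> ennreal (c * x + \<delta> * y) = ennreal c * ennreal x + ennreal \<delta> * ennreal y"
  by (simp add: ennreal_mult)

lemma ennreal_mult_sum:
  "0 \<le> c \<Longrightarrow> (\<And>l. 0 \<le> f l) \<Longrightarrow> ennreal (c * (\<Sum>l\<in>L. f l)) = ennreal c * (\<Sum>l\<in>L. ennreal (f l))"
  by (simp add: ennreal_mult sum_nonneg)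

lemma weighted_young: "0 < \<delta> \<Longrightarrow> 2 * \<bar>x * y\<bar> \<le> 1 / \<delta> * x\<^sup>2 + \<delta> * (y::real)\<^sup>2"
proof -
  assume "0 < \<delta>"
  moreover have "2 * \<bar>x\<bar> * (\<delta> * \<bar>y\<bar>) \<le> x\<^sup>2 + (\<delta> * y)\<^sup>2"
    using sum_squares_bound[of "\<bar>x\<bar>" "\<delta> * \<bar>y\<bar>"] by (simp add: power_mult_distrib)
  ultimately show ?thesis by (simp add: abs_mult field_simps power2_eq_square)
qed

context siml begin

text \<open>
  The mean over \<open>l\<close> of the second moments of the coefficients; it plays the role of a squared norm
  for which \<open>form\<close> is continuous, uniformly in \<open>i\<close>.
\<close>

definition energy :: "nat \<Rightarrow> nat \<Rightarrow> (real \<Rightarrow> 'a \<Rightarrow> real) \<Rightarrow> ennreal" where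
  "energy i j Y = ennreal (1 / real (m i)) * (\<Sum>l=1..m i. l2 (coeff i j l Y))"

text \<open>
  Young's inequality with a free weight in place of the Cauchy-Schwarz inequality keeps the bound
  linear in the energies: one of them may be small and the other only bounded.
\<close>

lemma form_l1_le:
  assumes j: "j \<in> {1..J}" "j' \<in> {1..J}" and Y: "measurable_process Y" "measurable_process Y'" and \<delta>: "0 < \<delta>"
  shows "(\<integral>\<^sup>+ \<omega>. ennreal \<bar>form i j j' Y Y' \<omega>\<bar> \<partial>M) \<le> ennreal (1 / \<delta>) * energy i j Y + ennreal \<delta> * energy i j' Y'"
proof -
  note [measurable] = coeff_measurable[OF j(1) Y(1)] coeff_measurable[OF j(2) Y(2)]
  let ?a = "\<lambda>l \<omega>. coeff i j l Y \<omega>" and ?b = "\<lambda>l \<omega>. coeff i j' l Y' \<omega>"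
  have "ennreal \<bar>form i j j' Y Y' \<omega>\<bar> \<le> ennreal (1 / \<delta>) * (ennreal (1 / real (m i)) * (\<Sum>l=1..m i. ennreal ((?a l \<omega>)\<^sup>2)))
      + ennreal \<delta> * (ennreal (1 / real (m i)) * (\<Sum>l=1..m i. ennreal ((?b l \<omega>)\<^sup>2)))" for \<omega>
  proof -
    have "\<bar>form i j j' Y Y' \<omega>\<bar> \<le> 1 / real (m i) * (\<Sum>l=1..m i. 2 * \<bar>?a l \<omega> * ?b l \<omega>\<bar>)"
      unfolding form_def by (simp add: abs_mult sum_distrib_left[symmetric] divide_right_mono)
        (intro divide_right_mono mult_left_mono order_trans[OF sum_abs], simp_all add: abs_mult)
    also have "\<dots> \<le> 1 / real (m i) * (\<Sum>l=1..m i. 1 / \<delta> * (?a l \<omega>)\<^sup>2 + \<delta> * (?b l \<omega>)\<^sup>2)"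
      by (intro mult_left_mono sum_mono weighted_young \<delta>) simp
    also have "\<dots> = 1 / \<delta> * (1 / real (m i) * (\<Sum>l=1..m i. (?a l \<omega>)\<^sup>2)) + \<delta> * (1 / real (m i) * (\<Sum>l=1..m i. (?b l \<omega>)\<^sup>2))"
      unfolding sum.distrib sum_distrib_left[symmetric] by (simp add: algebra_simps)
    finally have "ennreal \<bar>form i j j' Y Y' \<omega>\<bar> \<le> ennreal \<dots>" by (rule ennreal_leI)
    also have "\<dots> = ennreal (1 / \<delta>) * (ennreal (1 / real (m i)) * (\<Sum>l=1..m i. ennreal ((?a l \<omega>)\<^sup>2)))
      + ennreal \<delta> * (ennreal (1 / real (m i)) * (\<Sum>l=1..m i. ennreal ((?b l \<omega>)\<^sup>2)))"
      unfolding ennreal_mult_sum[symmetric, OF divide_nonneg_nonneg[OF zero_le_one of_nat_0_le_iff] zero_le_power2]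
      using \<delta> by (intro ennreal_linear_combination) (auto intro!: mult_nonneg_nonneg sum_nonneg divide_nonneg_nonneg)
    finally show ?thesis .
  qed
  then have "(\<integral>\<^sup>+ \<omega>. ennreal \<bar>form i j j' Y Y' \<omega>\<bar> \<partial>M) \<le> (\<integral>\<^sup>+ \<omega>. ennreal (1 / \<delta>) * (ennreal (1 / real (m i)) * (\<Sum>l=1..m i. ennreal ((?a l \<omega>)\<^sup>2)))
      + ennreal \<delta> * (ennreal (1 / real (m i)) * (\<Sum>l=1..m i. ennreal ((?b l \<omega>)\<^sup>2))) \<partial>M)"
    by (intro nn_integral_mono)
  also have "\<dots> = ennreal (1 / \<delta>) * energy i j Y + ennreal \<delta> * energy i j' Y'"
    unfolding energy_def l2_def
    by (subst nn_integral_add) (simp_all add: nn_integral_cmult nn_integral_sum del: sum_ennreal)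
  finally show ?thesis .
qed

lemma energy_le:
  assumes "\<And>l. l2 (coeff i j l Y) \<le> C"
  shows "energy i j Y \<le> C"
proof -
  have "energy i j Y \<le> ennreal (1 / real (m i)) * (\<Sum>l=1..m i. C)"
    unfolding energy_def by (intro mult_left_mono sum_mono assms) simp
  also have "\<dots> = (ennreal (1 / real (m i)) * ennreal (real (m i))) * C"
    by (simp add: mult.assoc ennreal_of_nat_eq_real_of_nat)
  also have "\<dots> = C" using m_ge_1[of i] by (simp add: ennreal_mult'[symmetric])
  finally show ?thesis .
qed

lemma form_tendsto_0:
  assumes j: "j \<in> {1..J}" "j' \<in> {1..J}" and Y: "measurable_process Y" "measurable_process Y'"
    and lim: "(\<lambda>i. energy i j Y) \<longlonglongrightarrow> 0" and bdd: "\<forall>\<^sub>F i in sequentially. energy i j' Y' \<le> ennreal C"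
  shows "tendsto_in_probability M (\<lambda>i. form i j j' Y Y') (\<lambda>_. 0)"
proof (rule tendsto_in_probability_approx)
  fix e :: real assume e: "e > 0"
  (* With this Young weight the bounded energy contributes at most e / 2; the vanishing
     energy eventually contributes at most the rest. *)
  define \<delta> where "\<delta> = e / (2 * (\<bar>C\<bar> + 1))"
  have \<delta>: "\<delta> > 0" using e by (simp add: \<delta>_def)
  have "\<delta> * \<bar>C\<bar> \<le> \<delta> * (\<bar>C\<bar> + 1)" using \<delta> by simp
  also have "\<dots> = e / 2" by (simp add: \<delta>_def field_simps)
  finally have \<delta>C: "\<delta> * \<bar>C\<bar> \<le> e / 2" .
  have "\<forall>\<^sub>F i in sequentially. energy i j Y < ennreal (\<delta> * e / 2)"
    by (rule order_tendstoD(2)[OF lim]) (use \<delta> e in simp)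
  with bdd have "\<forall>\<^sub>F i in sequentially. (\<integral>\<^sup>+ \<omega>. ennreal \<bar>form i j j' Y Y' \<omega> - 0\<bar> \<partial>M) \<le> ennreal e"
  proof eventually_elim
    case (elim i)
    have "(\<integral>\<^sup>+ \<omega>. ennreal \<bar>form i j j' Y Y' \<omega> - 0\<bar> \<partial>M) \<le> ennreal (1 / \<delta>) * energy i j Y + ennreal \<delta> * energy i j' Y'"
      using form_l1_le[OF j Y \<delta>] by simp
    also have "\<dots> \<le> ennreal (1 / \<delta>) * ennreal (\<delta> * e / 2) + ennreal \<delta> * ennreal \<bar>C\<bar>"
      using elim order_trans[OF elim(1), of "ennreal \<bar>C\<bar>"] by (intro add_mono mult_left_mono) (auto intro: ennreal_leI)
    also have "\<dots> = ennreal (e / 2 + \<delta> * \<bar>C\<bar>)"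
      using \<delta> e by (simp add: ennreal_mult'[symmetric] ennreal_plus[symmetric] del: ennreal_plus)
    also have "\<dots> \<le> ennreal e" using \<delta>C by (intro ennreal_leI) simp
    finally show ?case .
  qed
  then show "\<exists>Y'' Z'. tendsto_in_probability M Y'' Z' \<and>
      (\<forall>\<^sub>F i in sequentially. (\<integral>\<^sup>+ \<omega>. ennreal \<bar>form i j j' Y Y' \<omega> - Y'' i \<omega>\<bar> \<partial>M) \<le> ennreal e) \<and>
      (\<integral>\<^sup>+ \<omega>. ennreal \<bar>0 - Z' \<omega>\<bar> \<partial>M) \<le> ennreal e"
    by (intro exI[of _ "\<lambda>_ _. 0"] exI[of _ "\<lambda>_. 0"]) (auto intro: tendsto_in_probability_const)
qed (use form_measurable[OF j Y] in auto)

section \<open>Ito integrals of square integrable integrands\<close>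

lemma section_measurable:
  assumes "jointly_measurable f" "\<omega> \<in> space M"
  shows "(\<lambda>s. f s \<omega>) \<in> borel_measurable \<U>"
  using measurable_compose[OF measurable_Pair2'[OF assms(2)] assms(1)] by simp

lemma integrable_product:
  assumes f: "jointly_measurable f" "(\<integral>\<^sup>+ s. ennreal ((f s \<omega>)\<^sup>2) \<partial>\<U>) < \<infinity>"
    and g: "jointly_measurable g" "(\<integral>\<^sup>+ s. ennreal ((g s \<omega>)\<^sup>2) \<partial>\<U>) < \<infinity>" and \<omega>: "\<omega> \<in> space M"
  shows "integrable \<U> (\<lambda>s. f s \<omega> * g s \<omega>)"
proof (rule Bochner_Integration.integrable_bound)
  note [measurable] = section_measurable[OF f(1) \<omega>] section_measurable[OF g(1) \<omega>]
  have "integrable \<U> (\<lambda>s. (f s \<omega>)\<^sup>2)" "integrable \<U> (\<lambda>s. (g s \<omega>)\<^sup>2)"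
    using f(2) g(2) by (auto intro!: integrableI_bounded)
  then show "integrable \<U> (\<lambda>s. (f s \<omega>)\<^sup>2 + (g s \<omega>)\<^sup>2)" by (rule Bochner_Integration.integrable_add)
  show "(\<lambda>s. f s \<omega> * g s \<omega>) \<in> borel_measurable \<U>" by measurable
  have "\<bar>x * y\<bar> \<le> \<bar>x\<^sup>2 + y\<^sup>2\<bar>" for x y :: real
    using weighted_young[of 1 x y] by simp
  then show "AE s in \<U>. norm (f s \<omega> * g s \<omega>) \<le> norm ((f s \<omega>)\<^sup>2 + (g s \<omega>)\<^sup>2)" by simp
qed

lemma AE_l2p_finite:
  assumes "jointly_measurable f" "l2p f < \<infinity>"
  shows "AE \<omega> in M. (\<integral>\<^sup>+ s. ennreal ((f s \<omega>)\<^sup>2) \<partial>\<U>) < \<infinity>"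
  using nn_integral_PInf_AE[OF measurable_inner_l2p[OF assms(1)]] assms(2)
  unfolding l2p_def by (simp add: top.not_eq_extremum)

lemma inner_measurable:
  assumes [measurable]: "jointly_measurable f" "jointly_measurable g"
  shows "(\<lambda>\<omega>. \<integral>s. f s \<omega> * g s \<omega> \<partial>\<U>) \<in> borel_measurable M"
  by (rule unit_interval.borel_measurable_lebesgue_integral) measurable

lemma inner_l1_le:
  assumes f[measurable]: "jointly_measurable f" and g[measurable]: "jointly_measurable g" and \<delta>: "0 < \<delta>"
  shows "(\<integral>\<^sup>+ \<omega>. ennreal \<bar>\<integral>s. f s \<omega> * g s \<omega> \<partial>\<U>\<bar> \<partial>M) \<le> ennreal (1 / \<delta>) * l2p f + ennreal \<delta> * l2p g"
proof -
  let ?F = "\<lambda>f \<omega>. \<integral>\<^sup>+ s. ennreal ((f s \<omega>)\<^sup>2) \<partial>\<U>"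
  have "ennreal \<bar>\<integral>s. f s \<omega> * g s \<omega> \<partial>\<U>\<bar> \<le> ennreal (1 / \<delta>) * ?F f \<omega> + ennreal \<delta> * ?F g \<omega>" if \<omega>: "\<omega> \<in> space M" for \<omega>
  proof -
    note [measurable] = section_measurable[OF f \<omega>] section_measurable[OF g \<omega>]
    have "ennreal \<bar>\<integral>s. f s \<omega> * g s \<omega> \<partial>\<U>\<bar> \<le> (\<integral>\<^sup>+ s. ennreal \<bar>f s \<omega> * g s \<omega>\<bar> \<partial>\<U>)"
    proof (cases "integrable \<U> (\<lambda>s. f s \<omega> * g s \<omega>)")
      case True
      from integral_norm_bound_ennreal[OF this] show ?thesis by simp
    qed (simp add: not_integrable_integral_eq)
    also have "\<dots> \<le> (\<integral>\<^sup>+ s. ennreal (1 / \<delta>) * ennreal ((f s \<omega>)\<^sup>2) + ennreal \<delta> * ennreal ((g s \<omega>)\<^sup>2) \<partial>\<U>)"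
    proof (rule nn_integral_mono)
      fix s
      have "\<bar>f s \<omega> * g s \<omega>\<bar> \<le> 1 / \<delta> * (f s \<omega>)\<^sup>2 + \<delta> * (g s \<omega>)\<^sup>2"
        using weighted_young[OF \<delta>, of "f s \<omega>" "g s \<omega>"] by linarith
      then have "ennreal \<bar>f s \<omega> * g s \<omega>\<bar> \<le> ennreal (1 / \<delta> * (f s \<omega>)\<^sup>2 + \<delta> * (g s \<omega>)\<^sup>2)" by (rule ennreal_leI)
      also have "\<dots> = ennreal (1 / \<delta>) * ennreal ((f s \<omega>)\<^sup>2) + ennreal \<delta> * ennreal ((g s \<omega>)\<^sup>2)"
        using \<delta> by (intro ennreal_linear_combination) auto
      finally show "ennreal \<bar>f s \<omega> * g s \<omega>\<bar> \<le> ennreal (1 / \<delta>) * ennreal ((f s \<omega>)\<^sup>2) + ennreal \<delta> * ennreal ((g s \<omega>)\<^sup>2)" .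
    qed
    also have "\<dots> = ennreal (1 / \<delta>) * ?F f \<omega> + ennreal \<delta> * ?F g \<omega>"
      by (subst nn_integral_add) (simp_all add: nn_integral_cmult)
    finally show ?thesis .
  qed
  then have "(\<integral>\<^sup>+ \<omega>. ennreal \<bar>\<integral>s. f s \<omega> * g s \<omega> \<partial>\<U>\<bar> \<partial>M) \<le> (\<integral>\<^sup>+ \<omega>. ennreal (1 / \<delta>) * ?F f \<omega> + ennreal \<delta> * ?F g \<omega> \<partial>M)"
    by (rule nn_integral_mono)
  also have "\<dots> = ennreal (1 / \<delta>) * l2p f + ennreal \<delta> * l2p g"
    unfolding l2p_def by (subst nn_integral_add) (simp_all add: nn_integral_cmult)
  finally show ?thesis .
qed

lemma inner_diff_l1_le:
  assumes f: "jointly_measurable f" "l2p f < \<infinity>" and g: "jointly_measurable g" "l2p g < \<infinity>"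
    and h: "jointly_measurable h" "l2p h < \<infinity>" and k: "jointly_measurable k" "l2p k < \<infinity>" and \<delta>: "0 < \<delta>"
  shows "(\<integral>\<^sup>+ \<omega>. ennreal \<bar>(\<integral>s. f s \<omega> * g s \<omega> \<partial>\<U>) - (\<integral>s. h s \<omega> * k s \<omega> \<partial>\<U>)\<bar> \<partial>M)
    \<le> ennreal (1 / \<delta>) * l2p (\<lambda>s \<omega>. h s \<omega> - f s \<omega>) + ennreal \<delta> * l2p g
      + (ennreal (1 / \<delta>) * l2p (\<lambda>s \<omega>. k s \<omega> - g s \<omega>) + ennreal \<delta> * l2p h)"
proof -
  note [measurable] = f(1) g(1) h(1) k(1)
  let ?A = "\<lambda>\<omega>. \<integral>s. (f s \<omega> - h s \<omega>) * g s \<omega> \<partial>\<U>"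
  let ?B = "\<lambda>\<omega>. \<integral>s. (g s \<omega> - k s \<omega>) * h s \<omega> \<partial>\<U>"
  have m: "jointly_measurable (\<lambda>s \<omega>. f s \<omega> - h s \<omega>)" "jointly_measurable (\<lambda>s \<omega>. g s \<omega> - k s \<omega>)" by measurable
  have [measurable]: "?A \<in> borel_measurable M" "?B \<in> borel_measurable M"
    by (intro inner_measurable m g h)+
  have "AE \<omega> in M. ennreal \<bar>(\<integral>s. f s \<omega> * g s \<omega> \<partial>\<U>) - (\<integral>s. h s \<omega> * k s \<omega> \<partial>\<U>)\<bar> \<le> ennreal \<bar>?A \<omega>\<bar> + ennreal \<bar>?B \<omega>\<bar>"
    using AE_l2p_finite[OF f] AE_l2p_finite[OF g] AE_l2p_finite[OF h] AE_l2p_finite[OF k] AE_space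
  proof eventually_elim
    case (elim \<omega>)
    note i = integrable_product[OF f(1) elim(1) g(1) elim(2,5)] integrable_product[OF h(1) elim(3) g(1) elim(2,5)]
      integrable_product[OF g(1) elim(2) h(1) elim(3,5)] integrable_product[OF k(1) elim(4) h(1) elim(3,5)]
    have "?A \<omega> = (\<integral>s. f s \<omega> * g s \<omega> \<partial>\<U>) - (\<integral>s. h s \<omega> * g s \<omega> \<partial>\<U>)"
      unfolding left_diff_distrib by (rule Bochner_Integration.integral_diff[OF i(1,2)])
    moreover have "?B \<omega> = (\<integral>s. g s \<omega> * h s \<omega> \<partial>\<U>) - (\<integral>s. k s \<omega> * h s \<omega> \<partial>\<U>)"
      unfolding left_diff_distrib by (rule Bochner_Integration.integral_diff[OF i(3,4)])
    ultimately have "(\<integral>s. f s \<omega> * g s \<omega> \<partial>\<U>) - (\<integral>s. h s \<omega> * k s \<omega> \<partial>\<U>) = ?A \<omega> + ?B \<omega>"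
      by (simp add: mult.commute)
    then have "ennreal \<bar>(\<integral>s. f s \<omega> * g s \<omega> \<partial>\<U>) - (\<integral>s. h s \<omega> * k s \<omega> \<partial>\<U>)\<bar> \<le> ennreal (\<bar>?A \<omega>\<bar> + \<bar>?B \<omega>\<bar>)"
      by (intro ennreal_leI) (simp only: abs_triangle_ineq)
    then show ?case by simp
  qed
  then have "(\<integral>\<^sup>+ \<omega>. ennreal \<bar>(\<integral>s. f s \<omega> * g s \<omega> \<partial>\<U>) - (\<integral>s. h s \<omega> * k s \<omega> \<partial>\<U>)\<bar> \<partial>M)
     \<le> (\<integral>\<^sup>+ \<omega>. ennreal \<bar>?A \<omega>\<bar> + ennreal \<bar>?B \<omega>\<bar> \<partial>M)" by (rule nn_integral_mono_AE)
  also have "\<dots> = (\<integral>\<^sup>+ \<omega>. ennreal \<bar>?A \<omega>\<bar> \<partial>M) + (\<integral>\<^sup>+ \<omega>. ennreal \<bar>?B \<omega>\<bar> \<partial>M)" by (rule nn_integral_add) auto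
  also have "\<dots> \<le> (ennreal (1 / \<delta>) * l2p (\<lambda>s \<omega>. f s \<omega> - h s \<omega>) + ennreal \<delta> * l2p g)
      + (ennreal (1 / \<delta>) * l2p (\<lambda>s \<omega>. g s \<omega> - k s \<omega>) + ennreal \<delta> * l2p h)"
    by (intro add_mono inner_l1_le m g h \<delta>)
  finally show ?thesis unfolding l2p_minus_commute[of f] l2p_minus_commute[of g] .
qed

text \<open>
  A version of the Ito integral for each time, chosen separately; each grid evaluates finitely
  many of them.
\<close>

definition ito_family :: "nat \<Rightarrow> (real \<Rightarrow> 'a \<Rightarrow> real) \<Rightarrow> (real \<Rightarrow> 'a \<Rightarrow> real) \<Rightarrow> bool" where
  "ito_family r \<theta> I \<longleftrightarrow> \<theta> \<in> L2a M F \<and> (\<forall>u. 0 \<le> u \<longrightarrow> u \<le> 1 \<longrightarrow> has_ito_integral M F (W r) \<theta> u (I u))"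

lemma ito_family_measurable: "ito_family r \<theta> I \<Longrightarrow> measurable_process I"
  unfolding ito_family_def has_ito_integral_def by blast

lemma ito_family_approximation:
  assumes "ito_family r \<theta> I"
  obtains \<tau> n H where "\<And>k::nat. simple_process M F (\<tau> k) (n k) (H k)" "(\<lambda>k. l2p (\<lambda>s \<omega>. H k s \<omega> - \<theta> s \<omega>)) \<longlonglongrightarrow> 0"
proof -
  have "has_ito_integral M F (W r) \<theta> 1 (I 1)" using assms by (simp add: ito_family_def)
  then show ?thesis
    by (rule has_ito_integral_approximation) (rule that, assumption, assumption)
qed

lemma simple_l2p_le:
  assumes H: "simple_process M F \<tau> n H" and \<theta>: "jointly_measurable \<theta>"
  shows "l2p H \<le> 2 * l2p (\<lambda>s \<omega>. H s \<omega> - \<theta> s \<omega>) + 2 * l2p \<theta>"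
proof -
  note [measurable] = simple_process_jointly_measurable[OF H] \<theta>
  have "jointly_measurable (\<lambda>s \<omega>. H s \<omega> - \<theta> s \<omega>)" by measurable
  from l2p_add_le[OF this \<theta>] show ?thesis by simp
qed

text \<open>
  This is where the weights being at most 1 and the isometry turn into a bound that does not
  depend on \<open>i\<close>.
\<close>

lemma energy_simple:
  assumes H: "simple_process M F \<tau> n H" and j: "j \<in> {1..J}" and r: "r \<in> {1..d}"
  shows "energy i j (elementary_integral \<tau> n H (W r)) \<le> l2p H"
  unfolding coeff_def
  by (rule energy_le, unfold coeff_def)
     (rule l2_weighted_increments_simple[OF H r partition_grid[OF j] step_on_weight[OF j] weight_bound])

lemma energy_ito_diff:
  assumes I: "ito_family r \<theta> I" and H: "simple_process M F \<tau> n H" and j: "j \<in> {1..J}" and r: "r \<in> {1..d}"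
  shows "energy i j (\<lambda>u \<omega>. I u \<omega> - elementary_integral \<tau> n H (W r) u \<omega>) \<le> 4 * l2p (\<lambda>s \<omega>. H s \<omega> - \<theta> s \<omega>)"
proof (rule energy_le, unfold coeff_def)
  fix l
  have "l2 (\<lambda>\<omega>. weighted_increments (t i j) (N i j) (weight i j l) (elementary_integral \<tau> n H (W r)) \<omega>
      - weighted_increments (t i j) (N i j) (weight i j l) I \<omega>) \<le> 4 * l2p (\<lambda>s \<omega>. H s \<omega> - \<theta> s \<omega>)"
    by (rule ito_integral_weighted_approximation[OF _ r _ H partition_grid[OF j] step_on_weight[OF j] weight_bound])
       (use I in \<open>auto simp: ito_family_def intro: L2a_jointly_measurable\<close>)
  then show "l2 (weighted_increments (t i j) (N i j) (weight i j l) (\<lambda>u \<omega>. I u \<omega> - elementary_integral \<tau> n H (W r) u \<omega>))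
      \<le> 4 * l2p (\<lambda>s \<omega>. H s \<omega> - \<theta> s \<omega>)"
    unfolding weighted_increments_diff[abs_def] by (subst l2_minus_commute)
qed

lemma energy_add_le:
  assumes j: "j \<in> {1..J}" and Y: "measurable_process Y" "measurable_process Z"
  shows "energy i j (\<lambda>u \<omega>. Y u \<omega> + Z u \<omega>) \<le> 2 * energy i j Y + 2 * energy i j Z"
proof -
  have "l2 (coeff i j l (\<lambda>u \<omega>. Y u \<omega> + Z u \<omega>)) \<le> 2 * l2 (coeff i j l Y) + 2 * l2 (coeff i j l Z)" for l
    using l2_add_le[OF coeff_measurable[OF j Y(1)] coeff_measurable[OF j Y(2)], of i l i l]
    unfolding coeff_def weighted_increments_add[abs_def] .
  then have "(\<Sum>l=1..m i. l2 (coeff i j l (\<lambda>u \<omega>. Y u \<omega> + Z u \<omega>))) \<le> (\<Sum>l=1..m i. 2 * l2 (coeff i j l Y) + 2 * l2 (coeff i j l Z))"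
    by (rule sum_mono)
  also have "\<dots> = 2 * (\<Sum>l=1..m i. l2 (coeff i j l Y)) + 2 * (\<Sum>l=1..m i. l2 (coeff i j l Z))"
    unfolding sum.distrib sum_distrib_left ..
  finally have "energy i j (\<lambda>u \<omega>. Y u \<omega> + Z u \<omega>) \<le> ennreal (1 / real (m i)) * \<dots>"
    unfolding energy_def by (rule mult_left_mono) simp
  then show ?thesis unfolding energy_def by (simp only: distrib_left mult_ac)
qed

lemma energy_ito_bounded:
  assumes I: "ito_family r \<theta> I" and j: "j \<in> {1..J}" and r: "r \<in> {1..d}"
  obtains C where "0 \<le> C" "\<And>i. energy i j I \<le> ennreal C"
proof -
  obtain \<tau> n H where H: "\<And>k::nat. simple_process M F (\<tau> k) (n k) (H k)" and lim: "(\<lambda>k. l2p (\<lambda>s \<omega>. H k s \<omega> - \<theta> s \<omega>)) \<longlonglongrightarrow> 0"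
    by (rule ito_family_approximation[OF I]) (rule that, assumption, assumption)
  have "\<theta> \<in> L2a M F" using I by (simp add: ito_family_def)
  note \<theta> = L2a_jointly_measurable[OF this] L2a_l2p_finite[OF this]
  (* One simple process at finite distance from \<theta> suffices, because the energies of its
     integral and of the difference are bounded independently of i. *)
  have "\<forall>\<^sub>F k in sequentially. l2p (\<lambda>s \<omega>. H k s \<omega> - \<theta> s \<omega>) < 1" by (rule order_tendstoD(2)[OF lim]) simp
  then obtain k where k: "l2p (\<lambda>s \<omega>. H k s \<omega> - \<theta> s \<omega>) < 1" by (auto simp: eventually_sequentially)
  let ?E = "elementary_integral (\<tau> k) (n k) (H k) (W r)"
  have E: "measurable_process ?E" using elementary_integral_measurable[OF H _ _ r] by blast
  have "energy i j I \<le> 2 * (4 * 1) + 2 * (2 * 1 + 2 * l2p \<theta>)" for i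
  proof -
    have "energy i j I = energy i j (\<lambda>u \<omega>. (I u \<omega> - ?E u \<omega>) + ?E u \<omega>)" by simp
    also have "\<dots> \<le> 2 * energy i j (\<lambda>u \<omega>. I u \<omega> - ?E u \<omega>) + 2 * energy i j ?E"
      by (rule energy_add_le[OF j]) (use E ito_family_measurable[OF I] in \<open>auto intro!: borel_measurable_diff\<close>)
    also have "\<dots> \<le> 2 * (4 * 1) + 2 * (2 * 1 + 2 * l2p \<theta>)"
    proof (intro add_mono mult_left_mono)
      show "energy i j (\<lambda>u \<omega>. I u \<omega> - ?E u \<omega>) \<le> 4 * 1"
        by (rule order_trans[OF energy_ito_diff[OF I H j r] mult_left_mono]) (use k in auto)
      show "energy i j ?E \<le> 2 * 1 + 2 * l2p \<theta>"
        by (rule order_trans[OF energy_simple[OF H j r]], rule order_trans[OF simple_l2p_le[OF H \<theta>(1)]], intro add_mono mult_left_mono)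
           (use k in auto)
    qed auto
    finally show ?thesis .
  qed
  moreover have "2 * (4 * 1) + 2 * (2 * 1 + 2 * l2p \<theta>) < \<infinity>"
    using \<theta>(2) by (simp add: ennreal_mult_less_top ennreal_add_less_top)
  ultimately show ?thesis
    using that[of "enn2real (2 * (4 * 1) + 2 * (2 * 1 + 2 * l2p \<theta>))"] by (simp add: ennreal_enn2real)
qed

text \<open>
  Both integrands are replaced by simple processes \<open>H k\<close> and \<open>H' k\<close>. In \<open>form(I, I') - form(E, E')
  = form(I - E, I') + form(E, I' - E')\<close> each term pairs a process of small energy with one of
  bounded energy, uniformly in \<open>i\<close>. The difference of the limits splits in the same way.
\<close>

lemma form_ito_tendsto:
  assumes j: "j \<in> {1..J}" "j' \<in> {1..J}" and r: "r \<in> {1..d}" "r' \<in> {1..d}"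
    and I: "ito_family r \<theta> I" and I': "ito_family r' \<theta>' I'"
  shows "tendsto_in_probability M (\<lambda>i. form i j j' I I') (\<lambda>\<omega>. of_bool (r = r') * (\<integral>s. \<theta> s \<omega> * \<theta>' s \<omega> \<partial>\<U>))"
proof (rule tendsto_in_probability_approx)
  have "\<theta> \<in> L2a M F" using I by (simp add: ito_family_def)
  note \<theta> = L2a_jointly_measurable[OF this] L2a_l2p_finite[OF this]
  have "\<theta>' \<in> L2a M F" using I' by (simp add: ito_family_def)
  note \<theta>' = L2a_jointly_measurable[OF this] L2a_l2p_finite[OF this]
  note Im = ito_family_measurable[OF I] ito_family_measurable[OF I']
  show "form i j j' I I' \<in> borel_measurable M" for i by (rule form_measurable[OF j Im])
  show "(\<lambda>\<omega>. of_bool (r = r') * (\<integral>s. \<theta> s \<omega> * \<theta>' s \<omega> \<partial>\<U>)) \<in> borel_measurable M"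
    by (intro borel_measurable_times borel_measurable_const inner_measurable \<theta> \<theta>')
  obtain \<tau> n H where H: "\<And>k::nat. simple_process M F (\<tau> k) (n k) (H k)" and lim: "(\<lambda>k. l2p (\<lambda>s \<omega>. H k s \<omega> - \<theta> s \<omega>)) \<longlonglongrightarrow> 0"
    by (rule ito_family_approximation[OF I]) (rule that, assumption, assumption)
  obtain \<tau>' n' H' where H': "\<And>k::nat. simple_process M F (\<tau>' k) (n' k) (H' k)" and lim': "(\<lambda>k. l2p (\<lambda>s \<omega>. H' k s \<omega> - \<theta>' s \<omega>)) \<longlonglongrightarrow> 0"
    by (rule ito_family_approximation[OF I']) (rule that, assumption, assumption)
  obtain C0 where C0: "0 \<le> C0" "\<And>i. energy i j' I' \<le> ennreal C0" by (rule energy_ito_bounded[OF I' j(2) r(2)]) (rule that, assumption, assumption)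
  (* C1 bounds everything that stays fixed: the energy of I', the squared norm of \<theta>', and
     the squared norm of every simple process at squared distance at most 1 from \<theta>. The
     Young weight \<delta> makes \<delta> C1 at most e / 4, and then \<eta> makes the approximation error 4 \<eta>
     / \<delta> at most e / 4; four such terms add up to e. *)
  define C1 where "C1 = max C0 (max (enn2real (l2p \<theta>')) (enn2real (2 * 1 + 2 * l2p \<theta>)))"
  have C1: "0 \<le> C1" "energy i j' I' \<le> ennreal C1" "l2p \<theta>' \<le> ennreal C1" "2 * 1 + 2 * l2p \<theta> \<le> ennreal C1" for i
  proof -
    have *: "x \<le> ennreal C1" if "x < top" "enn2real x \<le> C1" for x
    proof -
      have "x = ennreal (enn2real x)" using that(1) by simp
      also have "\<dots> \<le> ennreal C1" by (rule ennreal_leI[OF that(2)])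
      finally show ?thesis .
    qed
    show "0 \<le> C1" using C0(1) by (simp add: C1_def)
    show "energy i j' I' \<le> ennreal C1" by (rule order_trans[OF C0(2)]) (simp add: C1_def ennreal_leI)
    show "l2p \<theta>' \<le> ennreal C1"
    proof (rule *)
      show "l2p \<theta>' < top" using \<theta>'(2) by simp
    qed (simp add: C1_def)
    show "2 * 1 + 2 * l2p \<theta> \<le> ennreal C1"
    proof (rule *)
      show "2 * 1 + 2 * l2p \<theta> < top" using \<theta>(2) by (simp add: ennreal_mult_less_top ennreal_add_less_top)
    qed (simp add: C1_def)
  qed
  fix e :: real assume e: "e > 0"
  define \<delta> where "\<delta> = e / (4 * (C1 + 1))"
  define \<eta> where "\<eta> = min 1 (\<delta> * e / 16)"
  have \<delta>: "\<delta> > 0" using e C1(1) by (simp add: \<delta>_def)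
  have \<delta>C: "\<delta> * C1 \<le> e / 4"
  proof -
    have "\<delta> * C1 \<le> \<delta> * (C1 + 1)" using \<delta> by simp
    also have "\<dots> = e / 4" using C1(1) by (simp add: \<delta>_def field_simps)
    finally show ?thesis .
  qed
  have \<eta>: "\<eta> > 0" "\<eta> \<le> 1" using \<delta> e by (auto simp: \<eta>_def)
  have \<delta>\<eta>: "1 / \<delta> * (4 * \<eta>) \<le> e / 4"
  proof -
    have "1 / \<delta> * (4 * \<eta>) \<le> 1 / \<delta> * (4 * (\<delta> * e / 16))" using \<delta> by (intro mult_left_mono) (auto simp: \<eta>_def)
    also have "\<dots> = e / 4" using \<delta> by simp
    finally show ?thesis .
  qed
  have "\<forall>\<^sub>F k in sequentially. l2p (\<lambda>s \<omega>. H k s \<omega> - \<theta> s \<omega>) < ennreal \<eta> \<and> l2p (\<lambda>s \<omega>. H' k s \<omega> - \<theta>' s \<omega>) < ennreal \<eta>"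
    by (intro eventually_conj order_tendstoD(2)[OF lim] order_tendstoD(2)[OF lim']) (use \<eta> in auto)
  then obtain k where k: "l2p (\<lambda>s \<omega>. H k s \<omega> - \<theta> s \<omega>) < ennreal \<eta>" "l2p (\<lambda>s \<omega>. H' k s \<omega> - \<theta>' s \<omega>) < ennreal \<eta>"
    by (auto simp: eventually_sequentially)
  have \<eta>1: "ennreal \<eta> \<le> 1" using ennreal_leI[OF \<eta>(2)] by simp
  note k1 = order_trans[OF less_imp_le[OF k(1)] \<eta>1] order_trans[OF less_imp_le[OF k(2)] \<eta>1]
  have Hk: "l2p (H k) \<le> ennreal C1"
    by (rule order_trans[OF simple_l2p_le[OF H \<theta>(1)] order_trans[OF _ C1(4)]], intro add_mono mult_left_mono)
       (use k1 in auto)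
  have H'k: "l2p (H' k) < \<infinity>"
  proof -
    have "l2p (H' k) \<le> 2 * 1 + 2 * l2p \<theta>'"
      by (rule order_trans[OF simple_l2p_le[OF H' \<theta>'(1)]], intro add_mono mult_left_mono) (use k1 in auto)
    also have "\<dots> < \<infinity>" using \<theta>'(2) by (simp add: ennreal_mult_less_top ennreal_add_less_top)
    finally show ?thesis .
  qed
  let ?E = "elementary_integral (\<tau> k) (n k) (H k) (W r)" and ?E' = "elementary_integral (\<tau>' k) (n' k) (H' k) (W r')"
  have Em: "measurable_process ?E" "measurable_process ?E'"
    using elementary_integral_measurable[OF H _ _ r(1)] elementary_integral_measurable[OF H' _ _ r(2)] by blast+
  have Dm: "measurable_process (\<lambda>u \<omega>. I u \<omega> - ?E u \<omega>)" "measurable_process (\<lambda>u \<omega>. I' u \<omega> - ?E' u \<omega>)"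
    using Em Im by (auto intro!: borel_measurable_diff)
  have total: "ennreal (1 / \<delta>) * (4 * ennreal \<eta>) + ennreal \<delta> * ennreal C1 + (ennreal (1 / \<delta>) * (4 * ennreal \<eta>) + ennreal \<delta> * ennreal C1) \<le> ennreal e"
  proof -
    have 4: "4 * ennreal \<eta> = ennreal (4 * \<eta>)" using \<eta> by (simp add: ennreal_mult)
    have "ennreal (1 / \<delta>) * (4 * ennreal \<eta>) + ennreal \<delta> * ennreal C1 = ennreal (1 / \<delta> * (4 * \<eta>) + \<delta> * C1)"
      unfolding 4 using \<delta> \<eta> C1(1) by (simp add: ennreal_mult'[symmetric] ennreal_plus[symmetric] del: ennreal_plus)
    then have "ennreal (1 / \<delta>) * (4 * ennreal \<eta>) + ennreal \<delta> * ennreal C1 + (ennreal (1 / \<delta>) * (4 * ennreal \<eta>) + ennreal \<delta> * ennreal C1)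
      = ennreal ((1 / \<delta> * (4 * \<eta>) + \<delta> * C1) + (1 / \<delta> * (4 * \<eta>) + \<delta> * C1))"
      using \<delta> \<eta> C1(1) by (simp add: ennreal_plus[symmetric] del: ennreal_plus)
    also have "\<dots> \<le> ennreal e" using \<delta>\<eta> \<delta>C by (intro ennreal_leI) linarith
    finally show ?thesis .
  qed
  have forms: "(\<integral>\<^sup>+ \<omega>. ennreal \<bar>form i j j' I I' \<omega> - form i j j' ?E ?E' \<omega>\<bar> \<partial>M) \<le> ennreal e" for i
  proof -
    let ?P = "form i j j' (\<lambda>u \<omega>. I u \<omega> - ?E u \<omega>) I'" and ?Q = "form i j j' ?E (\<lambda>u \<omega>. I' u \<omega> - ?E' u \<omega>)"
    have [measurable]: "?P \<in> borel_measurable M" "?Q \<in> borel_measurable M"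
      using form_measurable[OF j Dm(1) Im(2)] form_measurable[OF j Em(1) Dm(2)] by auto
    have "(\<integral>\<^sup>+ \<omega>. ennreal \<bar>form i j j' I I' \<omega> - form i j j' ?E ?E' \<omega>\<bar> \<partial>M) \<le> (\<integral>\<^sup>+ \<omega>. ennreal \<bar>?P \<omega>\<bar> + ennreal \<bar>?Q \<omega>\<bar> \<partial>M)"
    proof (rule nn_integral_mono)
      fix \<omega>
      have "ennreal \<bar>form i j j' I I' \<omega> - form i j j' ?E ?E' \<omega>\<bar> \<le> ennreal (\<bar>?P \<omega>\<bar> + \<bar>?Q \<omega>\<bar>)"
        unfolding form_diff by (intro ennreal_leI abs_triangle_ineq)
      then show "ennreal \<bar>form i j j' I I' \<omega> - form i j j' ?E ?E' \<omega>\<bar> \<le> ennreal \<bar>?P \<omega>\<bar> + ennreal \<bar>?Q \<omega>\<bar>" by simp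
    qed
    also have "\<dots> = (\<integral>\<^sup>+ \<omega>. ennreal \<bar>?P \<omega>\<bar> \<partial>M) + (\<integral>\<^sup>+ \<omega>. ennreal \<bar>?Q \<omega>\<bar> \<partial>M)" by (rule nn_integral_add) auto
    also have "\<dots> \<le> (ennreal (1 / \<delta>) * (4 * ennreal \<eta>) + ennreal \<delta> * ennreal C1) + (ennreal (1 / \<delta>) * (4 * ennreal \<eta>) + ennreal \<delta> * ennreal C1)"
    proof (rule add_mono)
      show "(\<integral>\<^sup>+ \<omega>. ennreal \<bar>?P \<omega>\<bar> \<partial>M) \<le> ennreal (1 / \<delta>) * (4 * ennreal \<eta>) + ennreal \<delta> * ennreal C1"
      proof (rule order_trans[OF form_l1_le[OF j Dm(1) Im(2) \<delta>]], intro add_mono mult_left_mono)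
        show "energy i j (\<lambda>u \<omega>. I u \<omega> - ?E u \<omega>) \<le> 4 * ennreal \<eta>"
          by (rule order_trans[OF energy_ito_diff[OF I H j(1) r(1)] mult_left_mono]) (use k in auto)
      qed (use C1 in auto)
      have \<delta>': "0 < 1 / \<delta>" using \<delta> by simp
      have "(\<integral>\<^sup>+ \<omega>. ennreal \<bar>?Q \<omega>\<bar> \<partial>M) \<le> ennreal (1 / (1 / \<delta>)) * ennreal C1 + ennreal (1 / \<delta>) * (4 * ennreal \<eta>)"
      proof (rule order_trans[OF form_l1_le[OF j Em(1) Dm(2) \<delta>']], intro add_mono mult_left_mono)
        show "energy i j' (\<lambda>u \<omega>. I' u \<omega> - ?E' u \<omega>) \<le> 4 * ennreal \<eta>"
          by (rule order_trans[OF energy_ito_diff[OF I' H' j(2) r(2)] mult_left_mono]) (use k in auto)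
        show "energy i j ?E \<le> ennreal C1" by (rule order_trans[OF energy_simple[OF H j(1) r(1)] Hk])
      qed auto
      then show "(\<integral>\<^sup>+ \<omega>. ennreal \<bar>?Q \<omega>\<bar> \<partial>M) \<le> ennreal (1 / \<delta>) * (4 * ennreal \<eta>) + ennreal \<delta> * ennreal C1"
        by (simp add: add.commute)
    qed
    also note total
    finally show ?thesis .
  qed
  let ?Z = "\<lambda>\<omega>. of_bool (r = r') * (\<integral>s. \<theta> s \<omega> * \<theta>' s \<omega> \<partial>\<U>)"
  let ?Z' = "\<lambda>\<omega>. of_bool (r = r') * (\<integral>s. H k s \<omega> * H' k s \<omega> \<partial>\<U>)"
  have limits: "(\<integral>\<^sup>+ \<omega>. ennreal \<bar>?Z \<omega> - ?Z' \<omega>\<bar> \<partial>M) \<le> ennreal e"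
  proof -
    have "(\<integral>\<^sup>+ \<omega>. ennreal \<bar>?Z \<omega> - ?Z' \<omega>\<bar> \<partial>M) \<le>
      (\<integral>\<^sup>+ \<omega>. ennreal \<bar>(\<integral>s. \<theta> s \<omega> * \<theta>' s \<omega> \<partial>\<U>) - (\<integral>s. H k s \<omega> * H' k s \<omega> \<partial>\<U>)\<bar> \<partial>M)"
      by (intro nn_integral_mono ennreal_leI) simp
    also have "\<dots> \<le> ennreal (1 / \<delta>) * l2p (\<lambda>s \<omega>. H k s \<omega> - \<theta> s \<omega>) + ennreal \<delta> * l2p \<theta>'
      + (ennreal (1 / \<delta>) * l2p (\<lambda>s \<omega>. H' k s \<omega> - \<theta>' s \<omega>) + ennreal \<delta> * l2p (H k))"
      using le_less_trans[OF Hk] H'k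
      by (intro inner_diff_l1_le \<theta> \<theta>' simple_process_jointly_measurable[OF H] simple_process_jointly_measurable[OF H'] \<delta>) auto
    also have "\<dots> \<le> ennreal (1 / \<delta>) * (4 * ennreal \<eta>) + ennreal \<delta> * ennreal C1 + (ennreal (1 / \<delta>) * (4 * ennreal \<eta>) + ennreal \<delta> * ennreal C1)"
    proof -
      have "ennreal \<eta> \<le> 4 * ennreal \<eta>" using mult_right_mono[of 1 4 "ennreal \<eta>"] by simp
      then have le: "x \<le> 4 * ennreal \<eta>" if "x < ennreal \<eta>" for x
        using less_imp_le[OF that] by (rule order_trans[rotated])
      show ?thesis by (intro add_mono mult_left_mono le k C1 Hk) auto
    qed
    also note total
    finally show ?thesis .
  qed
  show "\<exists>Y' Z'. tendsto_in_probability M Y' Z' \<and>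
      (\<forall>\<^sub>F i in sequentially. (\<integral>\<^sup>+ \<omega>. ennreal \<bar>form i j j' I I' \<omega> - Y' i \<omega>\<bar> \<partial>M) \<le> ennreal e) \<and>
      (\<integral>\<^sup>+ \<omega>. ennreal \<bar>?Z \<omega> - Z' \<omega>\<bar> \<partial>M) \<le> ennreal e"
    using form_simple_tendsto[OF j r H H'] forms limits
    by (intro exI[of _ "\<lambda>i. form i j j' ?E ?E'"] exI[of _ ?Z'] conjI always_eventually allI)
qed

end

section \<open>The drift\<close>

lemma integral_upto_unit_interval:
  fixes f :: "real \<Rightarrow> real"
  assumes f[measurable]: "f \<in> borel_measurable \<U>" and u: "0 \<le> u" "u \<le> 1"
  shows "(LINT s:{0..u}|lborel. f s) = (\<integral>s. indicator {0..<u} s * f s \<partial>\<U>)"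
proof -
  have ind: "(indicator {0..u} :: real \<Rightarrow> real) \<in> borel_measurable \<U>"
    by (rule measurable_restrict_space1) simp
  have "(LINT s:{0..u}|lborel. f s) = (LINT s:{0..1}|lborel. indicator {0..u} s * f s)"
    unfolding set_lebesgue_integral_def using u
    by (intro Bochner_Integration.integral_cong refl) (auto split: split_indicator)
  also have "\<dots> = (\<integral>s. indicator {0..u} s * f s \<partial>\<U>)"
    by (intro integral_unit_interval_closed borel_measurable_times ind f)
  also have "\<dots> = (\<integral>s. indicator {0..<u} s * f s \<partial>\<U>)"
  proof (rule integral_cong_AE)
    show "AE s in \<U>. indicator {0..u} s * f s = indicator {0..<u} s * f s"
      using AE_lborel_singleton[of u] by (subst AE_restrict_space_iff) (auto elim!: eventually_mono split: split_indicator)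
  qed (intro borel_measurable_times ind f indicator_measurable_unit_interval)+
  finally show ?thesis .
qed

context siml begin

definition drift :: "(real \<Rightarrow> 'a \<Rightarrow> real) \<Rightarrow> real \<Rightarrow> 'a \<Rightarrow> real" where
  "drift b u \<omega> = (LINT s:{0..u}|lborel. b s \<omega>)"

lemma drift_measurable:
  assumes b: "jointly_measurable b"
  shows "measurable_process (drift b)"
proof (intro allI impI)
  fix u :: real assume u: "0 \<le> u" "u \<le> 1"
  have "(\<lambda>(s, \<omega>). indicator {0..<u} s :: real) \<in> borel_measurable (\<U> \<Otimes>\<^sub>M M)"
    unfolding split_beta by (rule measurable_compose[OF measurable_fst indicator_measurable_unit_interval])
  then have "(\<lambda>\<omega>. \<integral>s. indicator {0..<u} s * b s \<omega> \<partial>\<U>) \<in> borel_measurable M"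
    by (rule inner_measurable[OF _ b])
  then show "drift b u \<in> borel_measurable M"
    by (rule measurable_cong[THEN iffD2, rotated])
       (simp add: drift_def integral_upto_unit_interval[OF section_measurable[OF b] u])
qed

lemma coeff_drift:
  assumes j: "j \<in> {1..J}" and b: "jointly_measurable b" and \<omega>: "\<omega> \<in> space M"
    and i: "integrable \<U> (\<lambda>s. b s \<omega>)"
  shows "coeff i j l (drift b) \<omega> = (\<integral>s. weight i j l s * b s \<omega> \<partial>\<U>)"
proof -
  note t = partition_grid[OF j, of i]
  have ib: "integrable \<U> (\<lambda>s. indicator {x..<y} s * b s \<omega>)" for x y :: real
    by (rule Bochner_Integration.integrable_bound[OF i])
       (auto intro!: borel_measurable_times indicator_measurable_unit_interval section_measurable[OF b \<omega>] split: split_indicator)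
  have inc: "drift b y \<omega> - drift b x \<omega> = (\<integral>s. indicator {x..<y} s * b s \<omega> \<partial>\<U>)" if "0 \<le> x" "x \<le> y" "y \<le> 1" for x y
  proof -
    have x1: "x \<le> 1" and y0: "0 \<le> y" using that by auto
    have "drift b y \<omega> - drift b x \<omega> = (\<integral>s. indicator {0..<y} s * b s \<omega> - indicator {0..<x} s * b s \<omega> \<partial>\<U>)"
      unfolding drift_def integral_upto_unit_interval[OF section_measurable[OF b \<omega>] that(1) x1]
        integral_upto_unit_interval[OF section_measurable[OF b \<omega>] y0 that(3)]
      by (rule Bochner_Integration.integral_diff[OF ib ib, symmetric])
    also have "\<dots> = (\<integral>s. indicator {x..<y} s * b s \<omega> \<partial>\<U>)"
      using that by (intro Bochner_Integration.integral_cong refl) (auto split: split_indicator)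
    finally show ?thesis .
  qed
  have "coeff i j l (drift b) \<omega> = (\<Sum>q<N i j. \<integral>s. weight i j l (t i j q) * (indicator {t i j q..<t i j (Suc q)} s * b s \<omega>) \<partial>\<U>)"
    unfolding coeff_def weighted_increments_def
  proof (intro sum.cong refl)
    fix q assume q: "q \<in> {..<N i j}"
    have "drift b (t i j (Suc q)) \<omega> - drift b (t i j q) \<omega> = (\<integral>s. indicator {t i j q..<t i j (Suc q)} s * b s \<omega> \<partial>\<U>)"
      using q partition_bounds[OF t, of q] partition_bounds[OF t, of "Suc q"] partition_le_iff[OF t, of q "Suc q"] by (intro inc) auto
    then show "weight i j l (t i j q) * (drift b (t i j (Suc q)) \<omega> - drift b (t i j q) \<omega>) =
      (\<integral>s. weight i j l (t i j q) * (indicator {t i j q..<t i j (Suc q)} s * b s \<omega>) \<partial>\<U>)"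
      by (simp only: integral_mult_right_zero)
  qed
  also have "\<dots> = (\<integral>s. (\<Sum>q<N i j. weight i j l (t i j q) * (indicator {t i j q..<t i j (Suc q)} s * b s \<omega>)) \<partial>\<U>)"
    by (intro Bochner_Integration.integral_sum[symmetric] integrable_mult_right ib)
  also have "\<dots> = (\<integral>s. weight i j l s * b s \<omega> \<partial>\<U>)"
  proof (intro Bochner_Integration.integral_cong refl)
    fix s assume "s \<in> space \<U>"
    then have "0 \<le> s" "s < 1" by auto
    from step_on_eq_sum[OF t step_on_weight[OF j] this]
    show "(\<Sum>q<N i j. weight i j l (t i j q) * (indicator {t i j q..<t i j (Suc q)} s * b s \<omega>)) = weight i j l s * b s \<omega>"
      by (simp only: sum_distrib_right mult.assoc)
  qed
  finally show ?thesis .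
qed

lemma weight_measurable: "j \<in> {1..J} \<Longrightarrow> weight i j l \<in> borel_measurable \<U>"
  by (rule step_on_measurable[OF partition_grid step_on_weight])

text \<open>
  Schur's test. Writing \<open>a\<^sub>l = \<integral> c\<^sub>l b\<close>, the sum \<open>(2/m) \<Sum> a\<^sub>l\<^sup>2\<close> is the double integral of \<open>D(u,s)
  b(u) b(s)\<close>. Bounding \<open>2 \<bar>b(u) b(s)\<bar>\<close> by \<open>b(u)\<^sup>2 + b(s)\<^sup>2\<close> and using the symmetry of the kernel
  leaves the row masses integrated against \<open>b\<^sup>2\<close>.
\<close>

lemma drift_energy_pointwise:
  assumes j: "j \<in> {1..J}" and b: "jointly_measurable b" and \<omega>: "\<omega> \<in> space M"
    and i: "integrable \<U> (\<lambda>s. b s \<omega>)"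
  shows "ennreal (2 / real (m i)) * (\<Sum>l=1..m i. ennreal ((coeff i j l (drift b) \<omega>)\<^sup>2)) \<le>
    (\<integral>\<^sup>+ u. ennreal ((b u \<omega>)\<^sup>2 * kernel_mass i j j u) \<partial>\<U>)"
proof -
  define f where "f s = b s \<omega>" for s
  define a where "a l = (\<integral>s. weight i j l s * f s \<partial>\<U>)" for l
  have fm [measurable]: "f \<in> borel_measurable \<U>" unfolding f_def by (rule section_measurable[OF b \<omega>])
  note [measurable] = kernel_measurable2[OF j j]
  have if': "integrable \<U> f" using i by (simp add: f_def[abs_def])
  have iw: "integrable \<U> (\<lambda>s. weight i j l s * f s)" for l
    by (rule Bochner_Integration.integrable_bound[OF if'])
       (use weight_measurable[OF j] mult_right_mono[OF weight_bound abs_ge_zero] in \<open>auto intro!: borel_measurable_times simp: abs_mult\<close>)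
  have inner: "(\<integral>s. kernel i j j u s * f s \<partial>\<U>) = 2 / real (m i) * (\<Sum>l=1..m i. weight i j l u * a l)" for u
  proof -
    have "(\<integral>s. kernel i j j u s * f s \<partial>\<U>) = (\<integral>s. 2 / real (m i) * (\<Sum>l=1..m i. weight i j l u * (weight i j l s * f s)) \<partial>\<U>)"
      unfolding kernel_eq_weights by (intro Bochner_Integration.integral_cong refl) (simp only: sum_distrib_right sum_distrib_left mult_ac)
    also have "\<dots> = 2 / real (m i) * (\<Sum>l=1..m i. weight i j l u * a l)"
      unfolding a_def by (simp only: integral_mult_right_zero Bochner_Integration.integral_sum[OF integrable_mult_right[OF iw]])
    finally show ?thesis .
  qed
  have outer: "(\<integral>u. f u * (\<integral>s. kernel i j j u s * f s \<partial>\<U>) \<partial>\<U>) = 2 / real (m i) * (\<Sum>l=1..m i. (a l)\<^sup>2)"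
  proof -
    have "(\<integral>u. f u * (\<integral>s. kernel i j j u s * f s \<partial>\<U>) \<partial>\<U>) =
       (\<integral>u. 2 / real (m i) * (\<Sum>l=1..m i. a l * (weight i j l u * f u)) \<partial>\<U>)"
      unfolding inner by (intro Bochner_Integration.integral_cong refl) (simp only: sum_distrib_right sum_distrib_left mult_ac)
    also have "\<dots> = 2 / real (m i) * (\<Sum>l=1..m i. a l * a l)"
      unfolding a_def by (simp only: integral_mult_right_zero Bochner_Integration.integral_sum[OF integrable_mult_right[OF iw]])
    finally show ?thesis by (simp only: power2_eq_square)
  qed
  have norm_le: "ennreal \<bar>\<integral>s. g s \<partial>\<U>\<bar> \<le> (\<integral>\<^sup>+ s. ennreal \<bar>g s\<bar> \<partial>\<U>)" for g :: "real \<Rightarrow> real"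
  proof (cases "integrable \<U> g")
    case True
    from integral_norm_bound_ennreal[OF this] show ?thesis by simp
  qed (simp add: not_integrable_integral_eq)
  have mass: "(\<integral>\<^sup>+ s. ennreal \<bar>kernel i j j u s\<bar> \<partial>\<U>) = ennreal (kernel_mass i j j u)" if "0 \<le> u" "u < 1" for u
    unfolding kernel_mass_def by (rule nn_integral_eq_integral[OF kernel_section_integrable[OF j j that]]) simp
  have sym: "kernel i j j u s = kernel i j j s u" for u s
    by (simp add: kernel_eq_weights mult.commute)
  let ?h = "\<lambda>u. ennreal ((f u)\<^sup>2)"
  let ?T = "\<integral>\<^sup>+ u. ?h u * ennreal (kernel_mass i j j u) \<partial>\<U>"
  have left: "(\<integral>\<^sup>+ u. \<integral>\<^sup>+ s. ?h u * ennreal \<bar>kernel i j j u s\<bar> \<partial>\<U> \<partial>\<U>) = ?T"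
  proof (rule nn_integral_cong)
    fix u assume "u \<in> space \<U>"
    then have u: "0 \<le> u" "u < 1" by auto
    note [measurable] = kernel_section_measurable[OF j j u]
    show "(\<integral>\<^sup>+ s. ?h u * ennreal \<bar>kernel i j j u s\<bar> \<partial>\<U>) = ?h u * ennreal (kernel_mass i j j u)"
      by (subst nn_integral_cmult) (simp_all add: mass[OF u])
  qed
  have right: "(\<integral>\<^sup>+ u. \<integral>\<^sup>+ s. ?h s * ennreal \<bar>kernel i j j u s\<bar> \<partial>\<U> \<partial>\<U>) = ?T"
  proof -
    interpret pair_sigma_finite \<U> \<U> ..
    have "(\<integral>\<^sup>+ u. \<integral>\<^sup>+ s. ?h s * ennreal \<bar>kernel i j j u s\<bar> \<partial>\<U> \<partial>\<U>) =
       (\<integral>\<^sup>+ s. \<integral>\<^sup>+ u. ?h s * ennreal \<bar>kernel i j j u s\<bar> \<partial>\<U> \<partial>\<U>)"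
      by (rule Fubini') measurable
    also have "\<dots> = ?T" unfolding left[symmetric] by (simp only: sym)
    finally show ?thesis .
  qed
  have "ennreal (2 / real (m i)) * (\<Sum>l=1..m i. ennreal ((coeff i j l (drift b) \<omega>)\<^sup>2)) = ennreal (2 / real (m i) * (\<Sum>l=1..m i. (a l)\<^sup>2))"
    unfolding coeff_drift[OF j b \<omega> i] a_def f_def by (rule ennreal_mult_sum[symmetric]) auto
  also have "\<dots> \<le> ennreal \<bar>\<integral>u. f u * (\<integral>s. kernel i j j u s * f s \<partial>\<U>) \<partial>\<U>\<bar>"
    unfolding outer by (rule ennreal_leI) (rule abs_ge_self)
  also have "\<dots> \<le> (\<integral>\<^sup>+ u. ennreal \<bar>f u * (\<integral>s. kernel i j j u s * f s \<partial>\<U>)\<bar> \<partial>\<U>)" by (rule norm_le)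
  also have "\<dots> \<le> (\<integral>\<^sup>+ u. \<integral>\<^sup>+ s. ennreal (1/2) * (?h u * ennreal \<bar>kernel i j j u s\<bar>) + ennreal (1/2) * (?h s * ennreal \<bar>kernel i j j u s\<bar>) \<partial>\<U> \<partial>\<U>)"
  proof (rule nn_integral_mono)
    fix u assume "u \<in> space \<U>"
    then have u: "0 \<le> u" "u < 1" by auto
    note [measurable] = kernel_section_measurable[OF j j u]
    have "ennreal \<bar>f u * (\<integral>s. kernel i j j u s * f s \<partial>\<U>)\<bar> = ennreal \<bar>f u\<bar> * ennreal \<bar>\<integral>s. kernel i j j u s * f s \<partial>\<U>\<bar>"
      by (simp add: abs_mult ennreal_mult)
    also have "\<dots> \<le> ennreal \<bar>f u\<bar> * (\<integral>\<^sup>+ s. ennreal \<bar>kernel i j j u s * f s\<bar> \<partial>\<U>)"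
      by (rule mult_left_mono[OF norm_le]) simp
    also have "\<dots> = (\<integral>\<^sup>+ s. ennreal \<bar>f u\<bar> * ennreal \<bar>kernel i j j u s * f s\<bar> \<partial>\<U>)"
      by (rule nn_integral_cmult[symmetric]) measurable
    also have "\<dots> \<le> (\<integral>\<^sup>+ s. ennreal (1/2) * (?h u * ennreal \<bar>kernel i j j u s\<bar>) + ennreal (1/2) * (?h s * ennreal \<bar>kernel i j j u s\<bar>) \<partial>\<U>)"
    proof (rule nn_integral_mono)
      fix s
      have "2 * \<bar>f u * f s\<bar> \<le> (f u)\<^sup>2 + (f s)\<^sup>2" using weighted_young[of 1 "f u" "f s"] by simp
      then have "\<bar>f u * f s\<bar> \<le> 1/2 * (f u)\<^sup>2 + 1/2 * (f s)\<^sup>2" by simp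
      from mult_right_mono[OF this, of "\<bar>kernel i j j u s\<bar>"]
      have "\<bar>f u\<bar> * \<bar>kernel i j j u s * f s\<bar> \<le> 1/2 * ((f u)\<^sup>2 * \<bar>kernel i j j u s\<bar>) + 1/2 * ((f s)\<^sup>2 * \<bar>kernel i j j u s\<bar>)"
        by (simp add: abs_mult algebra_simps)
      then have "ennreal (\<bar>f u\<bar> * \<bar>kernel i j j u s * f s\<bar>) \<le> ennreal \<dots>" by (rule ennreal_leI)
      also have "\<dots> = ennreal (1/2) * ennreal ((f u)\<^sup>2 * \<bar>kernel i j j u s\<bar>) + ennreal (1/2) * ennreal ((f s)\<^sup>2 * \<bar>kernel i j j u s\<bar>)"
        by (rule ennreal_linear_combination) auto
      finally show "ennreal \<bar>f u\<bar> * ennreal \<bar>kernel i j j u s * f s\<bar> \<le>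
        ennreal (1/2) * (?h u * ennreal \<bar>kernel i j j u s\<bar>) + ennreal (1/2) * (?h s * ennreal \<bar>kernel i j j u s\<bar>)"
        by (simp add: ennreal_mult)
    qed
    finally show "ennreal \<bar>f u * (\<integral>s. kernel i j j u s * f s \<partial>\<U>)\<bar> \<le>
      (\<integral>\<^sup>+ s. ennreal (1/2) * (?h u * ennreal \<bar>kernel i j j u s\<bar>) + ennreal (1/2) * (?h s * ennreal \<bar>kernel i j j u s\<bar>) \<partial>\<U>)" .
  qed
  also have "\<dots> = (\<integral>\<^sup>+ u. ennreal (1/2) * (\<integral>\<^sup>+ s. ?h u * ennreal \<bar>kernel i j j u s\<bar> \<partial>\<U>)
      + ennreal (1/2) * (\<integral>\<^sup>+ s. ?h s * ennreal \<bar>kernel i j j u s\<bar> \<partial>\<U>) \<partial>\<U>)"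
  proof (rule nn_integral_cong)
    fix u assume "u \<in> space \<U>"
    then have u: "0 \<le> u" "u < 1" by auto
    note [measurable] = kernel_section_measurable[OF j j u]
    show "(\<integral>\<^sup>+ s. ennreal (1/2) * (?h u * ennreal \<bar>kernel i j j u s\<bar>) + ennreal (1/2) * (?h s * ennreal \<bar>kernel i j j u s\<bar>) \<partial>\<U>)
      = ennreal (1/2) * (\<integral>\<^sup>+ s. ?h u * ennreal \<bar>kernel i j j u s\<bar> \<partial>\<U>) + ennreal (1/2) * (\<integral>\<^sup>+ s. ?h s * ennreal \<bar>kernel i j j u s\<bar> \<partial>\<U>)"
      by (subst nn_integral_add, measurable) (subst nn_integral_cmult, measurable)+
  qed
  also have "\<dots> = ennreal (1/2) * ?T + ennreal (1/2) * ?T"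
  proof -
    have [measurable]: "(\<lambda>u. \<integral>\<^sup>+ s. ?h u * ennreal \<bar>kernel i j j u s\<bar> \<partial>\<U>) \<in> borel_measurable \<U>"
      "(\<lambda>u. \<integral>\<^sup>+ s. ?h s * ennreal \<bar>kernel i j j u s\<bar> \<partial>\<U>) \<in> borel_measurable \<U>"
      by (rule unit_interval.borel_measurable_nn_integral, measurable)+
    show ?thesis
      by (subst nn_integral_add, measurable, subst (1 2) nn_integral_cmult, measurable) (simp only: left right)
  qed
  also have "\<dots> = ?T"
  proof -
    have "ennreal (1/2) * ?T + ennreal (1/2) * ?T = (ennreal (1/2) + ennreal (1/2)) * ?T" by (simp only: distrib_right)
    also have "ennreal (1/2) + ennreal (1/2) = 1" by (subst ennreal_plus[symmetric]) auto
    finally show ?thesis by simp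
  qed
  also have "\<dots> = (\<integral>\<^sup>+ u. ennreal ((b u \<omega>)\<^sup>2 * kernel_mass i j j u) \<partial>\<U>)"
    unfolding f_def by (rule nn_integral_cong) (use kernel_mass_bounds[OF j j] in \<open>auto simp: ennreal_mult\<close>)
  finally show ?thesis .
qed

text \<open>
  Dominated convergence, first in time for almost every sample point and then over the sample
  points, with majorant \<open>2 b\<^sup>2\<close> throughout.
\<close>

lemma energy_drift_tendsto_0:
  assumes j: "j \<in> {1..J}" and b: "jointly_measurable b" "l2p b < \<infinity>"
  shows "(\<lambda>i. energy i j (drift b)) \<longlonglongrightarrow> 0"
proof -
  let ?B = "\<lambda>\<omega>. \<integral>\<^sup>+ u. ennreal ((b u \<omega>)\<^sup>2) \<partial>\<U>"
  let ?T = "\<lambda>i \<omega>. \<integral>\<^sup>+ u. ennreal ((b u \<omega>)\<^sup>2 * kernel_mass i j j u) \<partial>\<U>"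
  note [measurable] = b(1) kernel_mass_measurable[OF j j]
  have fin: "AE \<omega> in M. ?B \<omega> < \<infinity>" by (rule AE_l2p_finite[OF b])
  have one: "jointly_measurable (\<lambda>_ _. 1)" by measurable
  have le: "energy i j (drift b) \<le> (\<integral>\<^sup>+ \<omega>. ?T i \<omega> \<partial>M)" for i
  proof -
    note [measurable] = coeff_measurable[OF j drift_measurable[OF b(1)]]
    have "energy i j (drift b) = (\<integral>\<^sup>+ \<omega>. ennreal (1 / real (m i)) * (\<Sum>l=1..m i. ennreal ((coeff i j l (drift b) \<omega>)\<^sup>2)) \<partial>M)"
      unfolding energy_def l2_def by (simp add: nn_integral_cmult nn_integral_sum del: sum_ennreal)
    also have "\<dots> \<le> (\<integral>\<^sup>+ \<omega>. ?T i \<omega> \<partial>M)"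
    proof (rule nn_integral_mono_AE)
      show "AE \<omega> in M. ennreal (1 / real (m i)) * (\<Sum>l=1..m i. ennreal ((coeff i j l (drift b) \<omega>)\<^sup>2)) \<le> ?T i \<omega>"
        using fin AE_space
      proof eventually_elim
        case (elim \<omega>)
        have "integrable \<U> (\<lambda>s. b s \<omega> * 1)"
          by (rule integrable_product[OF b(1) elim(1) one _ elim(2)]) (simp add: emeasure_restrict_space)
        then have "ennreal (2 / real (m i)) * (\<Sum>l=1..m i. ennreal ((coeff i j l (drift b) \<omega>)\<^sup>2)) \<le> ?T i \<omega>"
          by (intro drift_energy_pointwise[OF j b(1) elim(2)]) simp
        moreover have "ennreal (1 / real (m i)) * (\<Sum>l=1..m i. ennreal ((coeff i j l (drift b) \<omega>)\<^sup>2))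
            \<le> ennreal (2 / real (m i)) * (\<Sum>l=1..m i. ennreal ((coeff i j l (drift b) \<omega>)\<^sup>2))"
          by (intro mult_right_mono ennreal_leI divide_right_mono) auto
        ultimately show ?case by (rule order_trans[rotated])
      qed
    qed
    finally show ?thesis .
  qed
  have Tm: "?T i \<in> borel_measurable M" for i
    by (rule unit_interval.borel_measurable_nn_integral) measurable
  have bound: "ennreal ((b u \<omega>)\<^sup>2 * kernel_mass i j j u) \<le> 2 * ennreal ((b u \<omega>)\<^sup>2)" if "0 \<le> u" "u < 1" for i u \<omega>
  proof -
    have "(b u \<omega>)\<^sup>2 * kernel_mass i j j u \<le> (b u \<omega>)\<^sup>2 * 2"
      by (rule mult_left_mono) (use kernel_mass_bounds[OF j j that] in auto)
    then have "ennreal ((b u \<omega>)\<^sup>2 * kernel_mass i j j u) \<le> ennreal (2 * (b u \<omega>)\<^sup>2)" by (intro ennreal_leI) simp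
    then show ?thesis by (simp add: ennreal_mult)
  qed
  have sec: "(\<lambda>u. b u \<omega>) \<in> borel_measurable \<U>" if "\<omega> \<in> space M" for \<omega> by (rule section_measurable[OF b(1) that])
  have "(\<lambda>i. \<integral>\<^sup>+ \<omega>. ?T i \<omega> \<partial>M) \<longlonglongrightarrow> (\<integral>\<^sup>+ \<omega>. 0 \<partial>M)"
  proof (rule nn_integral_dominated_convergence[where w="\<lambda>\<omega>. 2 * ?B \<omega>"])
    show "AE \<omega> in M. ?T i \<omega> \<le> 2 * ?B \<omega>" for i
      using AE_space
    proof eventually_elim
      case (elim \<omega>)
      note [measurable] = sec[OF elim]
      have "?T i \<omega> \<le> (\<integral>\<^sup>+ u. 2 * ennreal ((b u \<omega>)\<^sup>2) \<partial>\<U>)"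
        by (rule nn_integral_mono) (rule bound; simp)
      then show ?case by (simp add: nn_integral_cmult)
    qed
    show "(\<integral>\<^sup>+ \<omega>. 2 * ?B \<omega> \<partial>M) < \<infinity>"
      using b(2) unfolding l2p_def by (simp add: nn_integral_cmult ennreal_mult_less_top)
    show "AE \<omega> in M. (\<lambda>i. ?T i \<omega>) \<longlonglongrightarrow> 0"
      using fin AE_space
    proof eventually_elim
      case (elim \<omega>)
      note [measurable] = sec[OF elim(2)]
      have "(\<lambda>i. ?T i \<omega>) \<longlonglongrightarrow> (\<integral>\<^sup>+ u. 0 \<partial>\<U>)"
      proof (rule nn_integral_dominated_convergence[where w="\<lambda>u. 2 * ennreal ((b u \<omega>)\<^sup>2)"])
        show "AE u in \<U>. ennreal ((b u \<omega>)\<^sup>2 * kernel_mass i j j u) \<le> 2 * ennreal ((b u \<omega>)\<^sup>2)" for i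
          using AE_space by eventually_elim (rule bound; simp)
        show "(\<integral>\<^sup>+ u. 2 * ennreal ((b u \<omega>)\<^sup>2) \<partial>\<U>) < \<infinity>"
          using elim(1) by (simp add: nn_integral_cmult ennreal_mult_less_top)
        show "AE u in \<U>. (\<lambda>i. ennreal ((b u \<omega>)\<^sup>2 * kernel_mass i j j u)) \<longlonglongrightarrow> 0"
          using AE_unit_interval_neq[of 0] AE_space
        proof eventually_elim
          case (elim u)
          have "(\<lambda>i. ennreal ((b u \<omega>)\<^sup>2 * kernel_mass i j j u)) \<longlonglongrightarrow> ennreal ((b u \<omega>)\<^sup>2 * 0)"
            using elim by (intro tendsto_ennrealI tendsto_mult tendsto_const kernel_mass_tendsto_0 j) auto
          then show ?case by simp
        qed
      qed measurable
      then show ?case by simp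
    qed
  qed (use Tm in \<open>auto\<close>)
  then have "(\<lambda>i. \<integral>\<^sup>+ \<omega>. ?T i \<omega> \<partial>M) \<longlonglongrightarrow> 0" by simp
  then show ?thesis
    by (rule tendsto_sandwich[OF _ _ tendsto_const, rotated -1]) (use le in \<open>auto intro!: always_eventually\<close>)
qed

section \<open>Ito processes\<close>

lemma ito_process_decomposition:
  assumes X: "ito_process M d W b \<sigma> X"
  obtains I where "\<And>r. r \<in> {1..d} \<Longrightarrow> ito_family r (\<sigma> r) (I r)"
    "\<And>u. 0 \<le> u \<Longrightarrow> u \<le> 1 \<Longrightarrow> AE \<omega> in M. X u \<omega> = X 0 \<omega> + (drift b u \<omega> + (\<Sum>r\<in>{1..d}. I r u \<omega>))"
proof -
  have "\<forall>u\<in>{0..1}. \<exists>I. (\<forall>r\<in>{1..d}. has_ito_integral M F (W r) (\<sigma> r) u (I r)) \<and>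
      (AE \<omega> in M. X u \<omega> = X 0 \<omega> + (LINT s:{0..u}|lborel. b s \<omega>) + (\<Sum>r\<in>{1..d}. I r \<omega>))"
    using X unfolding ito_process_def by blast
  then obtain I where I: "\<forall>u\<in>{0..1}. (\<forall>r\<in>{1..d}. has_ito_integral M F (W r) (\<sigma> r) u (I u r)) \<and>
      (AE \<omega> in M. X u \<omega> = X 0 \<omega> + (LINT s:{0..u}|lborel. b s \<omega>) + (\<Sum>r\<in>{1..d}. I u r \<omega>))"
    by (rule bchoice[THEN exE])
  show ?thesis
  proof (rule that[of "\<lambda>r u. I u r"])
    show "ito_family r (\<sigma> r) (\<lambda>u. I u r)" if "r \<in> {1..d}" for r
      using X I that unfolding ito_family_def ito_process_def by auto
    show "AE \<omega> in M. X u \<omega> = X 0 \<omega> + (drift b u \<omega> + (\<Sum>r\<in>{1..d}. I u r \<omega>))" if "0 \<le> u" "u \<le> 1" for u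
      using bspec[OF I, of u] that by (auto simp: drift_def add.assoc)
  qed
qed

text \<open>
  The initial value cancels because the coefficients depend on increments only. The exceptional
  null sets may depend on the time, but a grid has finitely many times.
\<close>

lemma form_AE_eq:
  assumes j: "j \<in> {1..J}" "j' \<in> {1..J}"
    and X: "\<And>u. 0 \<le> u \<Longrightarrow> u \<le> 1 \<Longrightarrow> AE \<omega> in M. X u \<omega> = x \<omega> + Y u \<omega>"
    and X': "\<And>u. 0 \<le> u \<Longrightarrow> u \<le> 1 \<Longrightarrow> AE \<omega> in M. X' u \<omega> = x' \<omega> + Y' u \<omega>"
  shows "AE \<omega> in M. form i j j' X X' \<omega> = form i j j' Y Y' \<omega>"
proof -
  have grid_eq: "AE \<omega> in M. \<forall>q\<in>{0..N i j}. X (t i j q) \<omega> = x \<omega> + Y (t i j q) \<omega>"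
    if "j \<in> {1..J}" "\<And>u. 0 \<le> u \<Longrightarrow> u \<le> 1 \<Longrightarrow> AE \<omega> in M. X u \<omega> = x \<omega> + Y u \<omega>" for j X x Y
    by (rule AE_finite_allI) (use partition_bounds[OF partition_grid[OF that(1)]] that(2) in auto)
  have X_eq: "AE \<omega> in M. \<forall>q\<in>{0..N i j}. X (t i j q) \<omega> = x \<omega> + Y (t i j q) \<omega>"
    by (rule grid_eq[OF j(1)]) (rule X)
  have X'_eq: "AE \<omega> in M. \<forall>q\<in>{0..N i j'}. X' (t i j' q) \<omega> = x' \<omega> + Y' (t i j' q) \<omega>"
    by (rule grid_eq[OF j(2)]) (rule X')
  have coeff_eq: "coeff i k l Z \<omega> = coeff i k l Z' \<omega>"
    if "\<forall>q\<in>{0..N i k}. Z (t i k q) \<omega> = z \<omega> + Z' (t i k q) \<omega>" for k l Z z Z' \<omega>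
    unfolding coeff_def weighted_increments_def by (intro sum.cong refl) (use that in auto)
  show ?thesis
    using X_eq X'_eq
  proof eventually_elim
    case (elim \<omega>)
    have "coeff i j l X \<omega> = coeff i j l Y \<omega>" "coeff i j' l X' \<omega> = coeff i j' l Y' \<omega>" for l
      by (rule coeff_eq[of j X \<omega> x Y], rule elim(1), rule coeff_eq[of j' X' \<omega> x' Y'], rule elim(2))
    then show ?case unfolding form_def by simp
  qed
qed

lemma form_add_left: "form i j j' (\<lambda>u \<omega>. Y u \<omega> + Z u \<omega>) X \<omega> = form i j j' Y X \<omega> + form i j j' Z X \<omega>"
  unfolding form_def coeff_def weighted_increments_add distrib_right sum.distrib distrib_left ..

lemma form_add_right: "form i j j' X (\<lambda>u \<omega>. Y u \<omega> + Z u \<omega>) \<omega> = form i j j' X Y \<omega> + form i j j' X Z \<omega>"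
  unfolding form_def coeff_def weighted_increments_add distrib_left sum.distrib ..

text \<open>
  All terms that involve a drift vanish in the limit. Among the pairs of Ito integrals only those
  with respect to the same component survive, which turns the double sum over components into a
  single one.
\<close>

lemma form_ito_process_tendsto:
  assumes j: "j \<in> {1..J}" "j' \<in> {1..J}"
    and b: "b \<in> L2a M F" "b' \<in> L2a M F"
    and I: "\<And>r. r \<in> {1..d} \<Longrightarrow> ito_family r (\<sigma> r) (I r)" and I': "\<And>r. r \<in> {1..d} \<Longrightarrow> ito_family r (\<sigma>' r) (I' r)"
  shows "tendsto_in_probability M
    (\<lambda>i. form i j j' (\<lambda>u \<omega>. drift b u \<omega> + (\<Sum>r\<in>{1..d}. I r u \<omega>)) (\<lambda>u \<omega>. drift b' u \<omega> + (\<Sum>r\<in>{1..d}. I' r u \<omega>)))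
    (\<lambda>\<omega>. \<Sum>r\<in>{1..d}. \<integral>s. \<sigma> r s \<omega> * \<sigma>' r s \<omega> \<partial>\<U>)"
proof -
  note bj = L2a_jointly_measurable[OF b(1)] L2a_jointly_measurable[OF b(2)]
  note E = energy_drift_tendsto_0[OF j(1) bj(1) L2a_l2p_finite[OF b(1)]] energy_drift_tendsto_0[OF j(2) bj(2) L2a_l2p_finite[OF b(2)]]
  note Dm = drift_measurable[OF bj(1)] drift_measurable[OF bj(2)]
  have "\<forall>\<^sub>F i in sequentially. energy i j' (drift b') < ennreal 1" by (rule order_tendstoD(2)[OF E(2)]) simp
  then have "\<forall>\<^sub>F i in sequentially. energy i j' (drift b') \<le> ennreal 1" by (rule eventually_mono) (rule less_imp_le)
  then have 1: "tendsto_in_probability M (\<lambda>i. form i j j' (drift b) (drift b')) (\<lambda>_. 0)"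
    by (rule form_tendsto_0[OF j Dm E(1)])
  have 2: "tendsto_in_probability M (\<lambda>i. form i j j' (drift b) (I' r)) (\<lambda>_. 0)" if r: "r \<in> {1..d}" for r
  proof -
    obtain C where "\<And>i. energy i j' (I' r) \<le> ennreal C"
      by (rule energy_ito_bounded[OF I'[OF r] j(2) r]) (rule that, assumption)
    then show ?thesis
      by (intro form_tendsto_0[OF j Dm(1) ito_family_measurable[OF I'[OF r]] E(1)] always_eventually allI)
  qed
  have 3: "tendsto_in_probability M (\<lambda>i. form i j j' (I r) (drift b')) (\<lambda>_. 0)" if r: "r \<in> {1..d}" for r
  proof -
    obtain C where "\<And>i. energy i j (I r) \<le> ennreal C"
      by (rule energy_ito_bounded[OF I[OF r] j(1) r]) (rule that, assumption)
    then have "tendsto_in_probability M (\<lambda>i. form i j' j (drift b') (I r)) (\<lambda>_. 0)"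
      by (intro form_tendsto_0[OF j(2,1) Dm(2) ito_family_measurable[OF I[OF r]] E(2)] always_eventually allI)
    then show ?thesis unfolding form_commute[of _ j' j, abs_def] .
  qed
  have 4: "tendsto_in_probability M (\<lambda>i. form i j j' (I r) (I' r')) (\<lambda>\<omega>. of_bool (r = r') * (\<integral>s. \<sigma> r s \<omega> * \<sigma>' r' s \<omega> \<partial>\<U>))"
    if "r \<in> {1..d}" "r' \<in> {1..d}" for r r'
    by (rule form_ito_tendsto[OF j that I[OF that(1)] I'[OF that(2)]])
  have "tendsto_in_probability M (\<lambda>i \<omega>. (form i j j' (drift b) (drift b') \<omega> + (\<Sum>r\<in>{1..d}. form i j j' (drift b) (I' r) \<omega>)) +
      ((\<Sum>r\<in>{1..d}. form i j j' (I r) (drift b') \<omega>) + (\<Sum>r\<in>{1..d}. \<Sum>r'\<in>{1..d}. form i j j' (I r) (I' r') \<omega>)))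
     (\<lambda>\<omega>. (0 + (\<Sum>r\<in>{1..d}. 0)) + ((\<Sum>r\<in>{1..d}. 0) + (\<Sum>r\<in>{1..d}. \<Sum>r'\<in>{1..d}. of_bool (r = r') * (\<integral>s. \<sigma> r s \<omega> * \<sigma>' r' s \<omega> \<partial>\<U>))))"
    by (intro tendsto_in_probability_add tendsto_in_probability_sum 1 2 3 4)
  moreover have "(\<Sum>r'\<in>{1..d}. of_bool (r = r') * (\<integral>s. \<sigma> r s \<omega> * \<sigma>' r' s \<omega> \<partial>\<U>)) = (\<integral>s. \<sigma> r s \<omega> * \<sigma>' r s \<omega> \<partial>\<U>)"
    if "r \<in> {1..d}" for r \<omega>
  proof -
    have "(\<Sum>r'\<in>{1..d}. of_bool (r = r') * (\<integral>s. \<sigma> r s \<omega> * \<sigma>' r' s \<omega> \<partial>\<U>)) =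
       (\<Sum>r'\<in>{1..d}. if r = r' then \<integral>s. \<sigma> r s \<omega> * \<sigma>' r s \<omega> \<partial>\<U> else 0)" by (intro sum.cong) auto
    then show ?thesis using that by simp
  qed
  ultimately show ?thesis
    unfolding form_add_left form_add_right form_sum_left form_sum_right
    by (simp add: sum.distrib add_ac)
qed

lemma l2p_pair_integrals:
  assumes \<sigma>: "\<And>r. r \<in> {1..d} \<Longrightarrow> \<sigma> r \<in> L2a M F" "\<And>r. r \<in> {1..d} \<Longrightarrow> \<sigma>' r \<in> L2a M F"
  shows "AE \<omega> in M. (LINT s:{0..1}|lborel. (\<Sum>r\<in>{1..d}. \<sigma> r s \<omega> * \<sigma>' r s \<omega>)) = (\<Sum>r\<in>{1..d}. \<integral>s. \<sigma> r s \<omega> * \<sigma>' r s \<omega> \<partial>\<U>)"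
    and "(\<lambda>\<omega>. LINT s:{0..1}|lborel. (\<Sum>r\<in>{1..d}. \<sigma> r s \<omega> * \<sigma>' r s \<omega>)) \<in> borel_measurable M"
    and "(\<integral>\<^sup>+ \<omega>. ennreal \<bar>\<Sum>r\<in>{1..d}. \<integral>s. \<sigma> r s \<omega> * \<sigma>' r s \<omega> \<partial>\<U>\<bar> \<partial>M) < \<infinity>"
proof -
  note jm = L2a_jointly_measurable[OF \<sigma>(1)] L2a_jointly_measurable[OF \<sigma>(2)]
  note fin = L2a_l2p_finite[OF \<sigma>(1)] L2a_l2p_finite[OF \<sigma>(2)]
  have eq: "(LINT s:{0..1}|lborel. (\<Sum>r\<in>{1..d}. \<sigma> r s \<omega> * \<sigma>' r s \<omega>)) = (\<integral>s. (\<Sum>r\<in>{1..d}. \<sigma> r s \<omega> * \<sigma>' r s \<omega>) \<partial>\<U>)"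
    if "\<omega> \<in> space M" for \<omega>
    by (intro integral_unit_interval_closed borel_measurable_sum borel_measurable_times section_measurable jm that)
  have "AE \<omega> in M. \<forall>r\<in>{1..d}. (\<integral>\<^sup>+ s. ennreal ((\<sigma> r s \<omega>)\<^sup>2) \<partial>\<U>) < \<infinity> \<and> (\<integral>\<^sup>+ s. ennreal ((\<sigma>' r s \<omega>)\<^sup>2) \<partial>\<U>) < \<infinity>"
    by (intro AE_finite_allI AE_conjI AE_l2p_finite jm fin) auto
  then show "AE \<omega> in M. (LINT s:{0..1}|lborel. (\<Sum>r\<in>{1..d}. \<sigma> r s \<omega> * \<sigma>' r s \<omega>)) = (\<Sum>r\<in>{1..d}. \<integral>s. \<sigma> r s \<omega> * \<sigma>' r s \<omega> \<partial>\<U>)"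
    using AE_space
  proof eventually_elim
    case (elim \<omega>)
    show ?case unfolding eq[OF elim(2)]
      by (intro Bochner_Integration.integral_sum integrable_product jm) (use elim in auto)
  qed
  have "(\<lambda>\<omega>. \<integral>s. (\<Sum>r\<in>{1..d}. \<sigma> r s \<omega> * \<sigma>' r s \<omega>) \<partial>\<U>) \<in> borel_measurable M"
  proof (rule unit_interval.borel_measurable_lebesgue_integral)
    have "(\<lambda>x. \<sigma> r (snd x) (fst x)) \<in> borel_measurable (M \<Otimes>\<^sub>M \<U>)" "(\<lambda>x. \<sigma>' r (snd x) (fst x)) \<in> borel_measurable (M \<Otimes>\<^sub>M \<U>)"
      if "r \<in> {1..d}" for r
      using measurable_compose[OF measurable_Pair[OF measurable_snd measurable_fst] jm(1)[OF that]]
        measurable_compose[OF measurable_Pair[OF measurable_snd measurable_fst] jm(2)[OF that]] by simp_all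
    then show "(\<lambda>(\<omega>, s). \<Sum>r\<in>{1..d}. \<sigma> r s \<omega> * \<sigma>' r s \<omega>) \<in> borel_measurable (M \<Otimes>\<^sub>M \<U>)"
      unfolding split_beta by (intro borel_measurable_sum borel_measurable_times)
  qed
  then show "(\<lambda>\<omega>. LINT s:{0..1}|lborel. (\<Sum>r\<in>{1..d}. \<sigma> r s \<omega> * \<sigma>' r s \<omega>)) \<in> borel_measurable M"
    by (rule measurable_cong[THEN iffD2, rotated]) (rule eq)
  have im: "(\<lambda>\<omega>. \<integral>s. \<sigma> r s \<omega> * \<sigma>' r s \<omega> \<partial>\<U>) \<in> borel_measurable M" if "r \<in> {1..d}" for r
    by (rule inner_measurable[OF jm(1)[OF that] jm(2)[OF that]])
  have "(\<integral>\<^sup>+ \<omega>. ennreal \<bar>\<Sum>r\<in>{1..d}. \<integral>s. \<sigma> r s \<omega> * \<sigma>' r s \<omega> \<partial>\<U>\<bar> \<partial>M) \<le>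
    (\<integral>\<^sup>+ \<omega>. (\<Sum>r\<in>{1..d}. ennreal \<bar>\<integral>s. \<sigma> r s \<omega> * \<sigma>' r s \<omega> \<partial>\<U>\<bar>) \<partial>M)"
  proof (rule nn_integral_mono)
    fix \<omega>
    show "ennreal \<bar>\<Sum>r\<in>{1..d}. \<integral>s. \<sigma> r s \<omega> * \<sigma>' r s \<omega> \<partial>\<U>\<bar> \<le> (\<Sum>r\<in>{1..d}. ennreal \<bar>\<integral>s. \<sigma> r s \<omega> * \<sigma>' r s \<omega> \<partial>\<U>\<bar>)"
      by (simp only: sum_ennreal[OF abs_ge_zero]) (rule ennreal_leI[OF sum_abs])
  qed
  also have "\<dots> = (\<Sum>r\<in>{1..d}. \<integral>\<^sup>+ \<omega>. ennreal \<bar>\<integral>s. \<sigma> r s \<omega> * \<sigma>' r s \<omega> \<partial>\<U>\<bar> \<partial>M)"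
    by (rule nn_integral_sum) (use im in measurable)
  also have "\<dots> \<le> (\<Sum>r\<in>{1..d}. ennreal (1 / 1) * l2p (\<sigma> r) + ennreal 1 * l2p (\<sigma>' r))"
    by (intro sum_mono inner_l1_le jm) auto
  also have "\<dots> < \<infinity>" using fin by (simp add: ennreal_mult_less_top)
  finally show "(\<integral>\<^sup>+ \<omega>. ennreal \<bar>\<Sum>r\<in>{1..d}. \<integral>s. \<sigma> r s \<omega> * \<sigma>' r s \<omega> \<partial>\<U>\<bar> \<partial>M) < \<infinity>" .
qed

theorem siml_estimator_tendsto:
  assumes j: "j \<in> {1..J}" "j' \<in> {1..J}"
    and X: "ito_process M d W (b j) (\<sigma> j) (X j)" "ito_process M d W (b j') (\<sigma> j') (X j')"
    and size: "filterlim (\<lambda>i. grid_size J (N i)) at_top sequentially"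
  shows "tendsto_in_probability M (\<lambda>i. siml_estimator J (N i) (t i) (\<phi> i) (m i) X j j')
    (\<lambda>\<omega>. LINT s:{0..1}|lborel. (\<Sum>r\<in>{1..d}. \<sigma> j r s \<omega> * \<sigma> j' r s \<omega>))"
proof -
  have L: "b j \<in> L2a M F" "b j' \<in> L2a M F" "\<And>r. r \<in> {1..d} \<Longrightarrow> \<sigma> j r \<in> L2a M F" "\<And>r. r \<in> {1..d} \<Longrightarrow> \<sigma> j' r \<in> L2a M F"
    and X0: "X j 0 \<in> borel_measurable M" "X j' 0 \<in> borel_measurable M"
    using X unfolding ito_process_def by blast+
  obtain I where I: "\<And>r. r \<in> {1..d} \<Longrightarrow> ito_family r (\<sigma> j r) (I r)"
    "\<And>u. 0 \<le> u \<Longrightarrow> u \<le> 1 \<Longrightarrow> AE \<omega> in M. X j u \<omega> = X j 0 \<omega> + (drift (b j) u \<omega> + (\<Sum>r\<in>{1..d}. I r u \<omega>))"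
    by (rule ito_process_decomposition[OF X(1)]) (rule that, assumption, assumption)
  obtain I' where I': "\<And>r. r \<in> {1..d} \<Longrightarrow> ito_family r (\<sigma> j' r) (I' r)"
    "\<And>u. 0 \<le> u \<Longrightarrow> u \<le> 1 \<Longrightarrow> AE \<omega> in M. X j' u \<omega> = X j' 0 \<omega> + (drift (b j') u \<omega> + (\<Sum>r\<in>{1..d}. I' r u \<omega>))"
    by (rule ito_process_decomposition[OF X(2)]) (rule that, assumption, assumption)
  let ?Y = "\<lambda>u \<omega>. drift (b j) u \<omega> + (\<Sum>r\<in>{1..d}. I r u \<omega>)" and ?Y' = "\<lambda>u \<omega>. drift (b j') u \<omega> + (\<Sum>r\<in>{1..d}. I' r u \<omega>)"
  define \<kappa> where "\<kappa> i = real (grid_size J (N i)) / (real (grid_size J (N i)) + 1/2)" for i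
  have \<kappa>: "\<kappa> \<longlonglongrightarrow> 1"
  proof -
    have "filterlim (\<lambda>i. 1/2 + real (grid_size J (N i))) at_top sequentially"
      by (rule filterlim_tendsto_add_at_top[OF tendsto_const filterlim_compose[OF filterlim_real_sequentially size]])
    then have "(\<lambda>i. 1 - (1/2) / (1/2 + real (grid_size J (N i)))) \<longlonglongrightarrow> 1 - 0"
      by (intro tendsto_diff tendsto_const tendsto_divide_0[OF tendsto_const] filterlim_at_top_imp_at_infinity)
    moreover have "(\<lambda>i. 1 - (1/2) / (1/2 + real (grid_size J (N i)))) = \<kappa>"
      by (rule ext) (simp add: \<kappa>_def field_simps)
    ultimately show ?thesis by (simp only: diff_zero)
  qed
  have Ym: "measurable_process ?Y" "measurable_process ?Y'"
    using drift_measurable[OF L2a_jointly_measurable[OF L(1)]] drift_measurable[OF L2a_jointly_measurable[OF L(2)]]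
      ito_family_measurable[OF I(1)] ito_family_measurable[OF I'(1)]
    by (intro allI impI borel_measurable_add borel_measurable_sum; blast)+
  have Xm: "measurable_process (X j)" "measurable_process (X j')"
    by (intro allI impI, rule complete_measure.borel_measurable_AE_eq[OF complete borel_measurable_add[OF X0(1) Ym(1)[rule_format]] I(2)]; assumption)
       (intro allI impI, rule complete_measure.borel_measurable_AE_eq[OF complete borel_measurable_add[OF X0(2) Ym(2)[rule_format]] I'(2)]; assumption)
  note form = form_ito_process_tendsto[OF j L(1,2) I(1) I'(1)]
  note limit = l2p_pair_integrals[OF L(3,4)]
  have "tendsto_in_probability M (\<lambda>i \<omega>. \<kappa> i * form i j j' ?Y ?Y' \<omega>) (\<lambda>\<omega>. \<Sum>r\<in>{1..d}. \<integral>s. \<sigma> j r s \<omega> * \<sigma> j' r s \<omega> \<partial>\<U>)"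
    by (rule tendsto_in_probability_scale[OF form \<kappa> limit(3)])
  then show ?thesis
  proof (rule tendsto_in_probability_cong_AE)
    have eq: "siml_estimator J (N i) (t i) (\<phi> i) (m i) X j j' = (\<lambda>\<omega>. \<kappa> i * form i j j' (X j) (X j') \<omega>)" for i
      unfolding siml_estimator_eq_form[OF j, abs_def] \<kappa>_def ..
    show "siml_estimator J (N i) (t i) (\<phi> i) (m i) X j j' \<in> borel_measurable M" for i
      unfolding eq by (intro borel_measurable_times borel_measurable_const form_measurable j Xm)
    show "AE \<omega> in M. siml_estimator J (N i) (t i) (\<phi> i) (m i) X j j' \<omega> = \<kappa> i * form i j j' ?Y ?Y' \<omega>" for i
    proof -
      have "AE \<omega> in M. form i j j' (X j) (X j') \<omega> = form i j j' ?Y ?Y' \<omega>"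
        by (rule form_AE_eq[OF j, where x="X j 0" and x'="X j' 0"]) (erule (1) I(2), erule (1) I'(2))
      then show ?thesis unfolding eq by eventually_elim simp
    qed
    show "(\<lambda>\<omega>. LINT s:{0..1}|lborel. (\<Sum>r\<in>{1..d}. \<sigma> j r s \<omega> * \<sigma> j' r s \<omega>)) \<in> borel_measurable M"
      by (rule limit(2))
    show "AE \<omega> in M. (LINT s:{0..1}|lborel. (\<Sum>r\<in>{1..d}. \<sigma> j r s \<omega> * \<sigma> j' r s \<omega>)) =
      (\<Sum>r\<in>{1..d}. \<integral>s. \<sigma> j r s \<omega> * \<sigma> j' r s \<omega> \<partial>\<U>)"
      by (rule limit(1))
  qed
qed

end

theorem theorem2p5:
  fixes M :: "'a measure"
    and d J :: nat
    and W :: "nat \<Rightarrow> real \<Rightarrow> 'a \<Rightarrow> real"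
    and X b :: "nat \<Rightarrow> real \<Rightarrow> 'a \<Rightarrow> real"
    and \<sigma> :: "nat \<Rightarrow> nat \<Rightarrow> real \<Rightarrow> 'a \<Rightarrow> real"
    and N :: "nat \<Rightarrow> nat \<Rightarrow> nat"
    and t :: "nat \<Rightarrow> nat \<Rightarrow> nat \<Rightarrow> real"
    and \<phi> :: "nat \<Rightarrow> nat \<Rightarrow> real \<Rightarrow> real"
    and m :: "nat \<Rightarrow> nat"
  assumes "prob_space M" and "complete_measure M"
    and "d \<ge> 1" and "J \<ge> 1"
    and "wiener_process M d W"
    and "\<And>j. j \<in> {1..J} \<Longrightarrow> ito_process M d W (b j) (\<sigma> j) (X j)"
    and "\<And>i. sampling_grid J (N i) (t i)"
    and "\<And>i. \<phi> i \<in> Pi_star J (N i) (t i)"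
    and "\<And>i. m i \<ge> 1"
    and "filterlim (\<lambda>i. grid_size J (N i)) at_top sequentially"
    and "(\<lambda>i. grid_mesh J (N i) (t i)) \<longlonglongrightarrow> 0"
    and "filterlim m at_top sequentially"
    and "\<And>j j' g. j \<in> {1..J} \<Longrightarrow> j' \<in> {1..J} \<Longrightarrow> continuous_on {0..1} g \<Longrightarrow>
      (\<lambda>i. LINT s:{0..1}|lborel. siml_kernel (m i) (\<phi> i j) (\<phi> i j') s s * g s)
        \<longlonglongrightarrow> (LINT s:{0..1}|lborel. g s)"
    and "\<And>p. p \<ge> 1 \<Longrightarrow>
      sup_moment M (p / 2) (\<lambda>s \<omega>. \<Sum>j\<in>{1..J}. \<bar>b j s \<omega>\<bar>\<^sup>2) +
      sup_moment M (p / 2) (\<lambda>s \<omega>. \<Sum>r\<in>{1..d}. \<Sum>j\<in>{1..J}. \<bar>\<sigma> j r s \<omega>\<bar>\<^sup>2) < \<infinity>"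
    and "\<And>j r. j \<in> {1..J} \<Longrightarrow> r \<in> {1..d} \<Longrightarrow>
      (AE \<omega> in M. continuous_on {0..1} (\<lambda>s. \<sigma> j r s \<omega>))"
  shows "\<forall>j\<in>{1..J}. \<forall>j'\<in>{1..J}.
    tendsto_in_probability M
      (\<lambda>i. siml_estimator J (N i) (t i) (\<phi> i) (m i) X j j')
      (\<lambda>\<omega>. LINT s:{0..1}|lborel. (\<Sum>r\<in>{1..d}. \<sigma> j r s \<omega> * \<sigma> j' r s \<omega>))"
proof (intro ballI)
  fix j j' assume j: "j \<in> {1..J}" "j' \<in> {1..J}"
  interpret siml M d W J N t \<phi> m
    by (intro siml.intro wiener.intro wiener_axioms.intro sampling.intro assms)
  show "tendsto_in_probability M
      (\<lambda>i. siml_estimator J (N i) (t i) (\<phi> i) (m i) X j j')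
      (\<lambda>\<omega>. LINT s:{0..1}|lborel. (\<Sum>r\<in>{1..d}. \<sigma> j r s \<omega> * \<sigma> j' r s \<omega>))"
    by (rule siml_estimator_tendsto[where b=b]) (fact j assms(6)[OF j(1)] assms(6)[OF j(2)] assms(10))+
qed

end
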